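(* Let $d\ge 2$ and consider the annealed Ising model on the random $d$-regular (multi)graph with $n$ vertices. Then the following hold. (i) For all $\beta\ge 0$ and $B\in\mathbb{R}$, the annealed pressure converges: $$\lim_{n\to\infty}\psi_n(\beta,B)=\psi(\beta,B)=\frac{\beta d}{2}-B+\max_{0\le t\le 1}\Big[(t-1)\log(1-t)-t\log t+2Bt+dF(t)\Big],$$ where $$F(t)=\int_0^{u(t)}\log f(s)\,ds,\qquad u(t)=\min\{t,1-t\},\qquad f(s)=\frac{e^{-2\beta}(1-2s)+\sqrt{1+(e^{-4\beta}-1)(1-2s)^2}}{2(1-s)}.$$ (ii) For all $(\beta,B)\in\mathcal{U}$, the annealed magnetization converges: $$\lim_{n\to\infty}M_n(\beta,B)=\mathcal{M}(\beta,B)=\frac{\partial}{\partial B}\psi(\beta,B).$$ Moreover, the critical inverse temperature is $\beta_c=\operatorname{atanh}(1/(d-1))$, that is, $\beta_c=\frac12\log\left(\frac{d}{d-2}\right)$ if $d\ge 3$ and $\beta_c=\infty$ if $d=2$. (iii) For all $(\beta,B)\in\mathcal{U}$, the annealed susceptibility converges: $$\lim_{n\to\infty}\chi_n(\beta,B)=\chi(\beta,B)=\frac{\partial^2}{\partial B^2}\psi(\beta,B).$$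
   Context: Random $d$-regular graph $G_{n,d}$ (configuration model): attach $d$ half-edges to each of the vertices $v_1,\dots,v_n$ and pair all half-edges by a uniformly random perfect matching, each pair forming an edge; self-loops and multiple edges are allowed. The total number of half-edges is assumed even (if $dn$ is odd, the degree of one vertex is increased by $1$). Ising model: let $k_{i,j}$ be the number of edges between $v_i$ and $v_j$ (for $i=j$, the number of self-loops at $v_i$), $\beta\ge 0$, $B\in\mathbb{R}$, $\Omega_n=\{-1,1\}^n$. For $\sigma\in\Omega_n$ put $$H(\sigma)=-\beta\sum_{i\le j}k_{i,j}\sigma_i\sigma_j-B\sum_{i=1}^n\sigma_i,\qquad Z_n(\beta,B)=\sum_{\sigma\in\Omega_n}e^{-H(\sigma)}.$$ With $\mathbb{E}$ the expectation over the random graph, the annealed measure on $\Omega_n$ is $\mu_n(\sigma)=\mathbb{E}(e^{-H(\sigma)})/\mathbb{E}(Z_n(\beta,B))$. Let $S_n=\sigma_1+\dots+\sigma_n$ and define - annealed pressure: $\psi_n(\beta,B)=\frac1n\log\mathbb{E}(Z_n(\beta,B))$; - annealed magnetization: $M_n(\beta,B)=\mathbb{E}_{\mu_n}(S_n/n)$; - annealed susceptibility: $\chi_n(\beta,B)=\operatorname{Var}_{\mu_n}(S_n/\sqrt n)$. When $(M_n(\beta,B))_n$ converges, its limit is denoted $\mathcal{M}(\beta,B)$; the spontaneous magnetization is $\mathcal{M}(\beta,0^+)=\lim_{B\searrow 0}\mathcal{M}(\beta,B)$; the critical inverse temperature is $\beta_c=\inf\{\beta>0:\mathcal{M}(\beta,0^+)>0\}$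 (with $\inf\emptyset=\infty$). Finally $\mathcal{U}=\{(\beta,B):\ \beta\ge 0,\ B\ne 0,\ \text{ or }\ 0<\beta<\beta_c,\ B=0\}$. Convention: $0\log 0=0$. *)

theory Defs
  imports "HOL-Probability.Probability"
begin

text \<open>
  Vertices are \<open>1, \<dots>, n\<close>. If \<open>d * n\<close> is odd, one vertex gets an extra half-edge; which one is
  left open, and is given by a choice function \<open>w\<close> (vertex \<open>w n\<close> in the graph on \<open>n\<close> vertices).
\<close>

definition vertex_degree :: "nat \<Rightarrow> (nat \<Rightarrow> nat) \<Rightarrow> nat \<Rightarrow> nat \<Rightarrow> nat" where
  "vertex_degree d w n i = (if odd (d * n) \<and> i = w n then d + 1 else d)"

definition half_edges :: "nat \<Rightarrow> (nat \<Rightarrow> nat) \<Rightarrow> nat \<Rightarrow> (nat \<times> nat) set" where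
  "half_edges d w n = (SIGMA i:{1..n}. {1..vertex_degree d w n i})"

definition perfect_matchings :: "'a set \<Rightarrow> 'a set set set" where
  "perfect_matchings X = {P. partition_on X P \<and> (\<forall>e\<in>P. card e = 2)}"

definition configuration_model :: "nat \<Rightarrow> (nat \<Rightarrow> nat) \<Rightarrow> nat \<Rightarrow> (nat \<times> nat) set set pmf" where
  "configuration_model d w n = pmf_of_set (perfect_matchings (half_edges d w n))"

text \<open>
  An edge of the multigraph is a pair \<open>e\<close> of half-edges, and \<open>fst ` e\<close> is its set of end vertices,
  a singleton exactly when the edge is a self-loop.
\<close>

definition edge_count :: "(nat \<times> nat) set set \<Rightarrow> nat \<Rightarrow> nat \<Rightarrow> nat" where
  "edge_count P i j = card {e \<in> P. fst ` e = {i, j}}"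

definition spin_configs :: "nat \<Rightarrow> (nat \<Rightarrow> real) set" where
  "spin_configs n = ({1..n} \<rightarrow>\<^sub>E {-1, 1})"

definition total_spin :: "nat \<Rightarrow> (nat \<Rightarrow> real) \<Rightarrow> real" where
  "total_spin n \<sigma> = (\<Sum>i=1..n. \<sigma> i)"

definition hamiltonian ::
  "nat \<Rightarrow> real \<Rightarrow> real \<Rightarrow> (nat \<times> nat) set set \<Rightarrow> (nat \<Rightarrow> real) \<Rightarrow> real" where
  "hamiltonian n \<beta> B P \<sigma> =
     - \<beta> * (\<Sum>i=1..n. \<Sum>j=i..n. real (edge_count P i j) * \<sigma> i * \<sigma> j) - B * (\<Sum>i=1..n. \<sigma> i)"

definition partition_function :: "nat \<Rightarrow> real \<Rightarrow> real \<Rightarrow> (nat \<times> nat) set set \<Rightarrow> real" where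
  "partition_function n \<beta> B P = (\<Sum>\<sigma>\<in>spin_configs n. exp (- hamiltonian n \<beta> B P \<sigma>))"

definition annealed_partition_function ::
  "nat \<Rightarrow> (nat \<Rightarrow> nat) \<Rightarrow> nat \<Rightarrow> real \<Rightarrow> real \<Rightarrow> real" where
  "annealed_partition_function d w n \<beta> B =
     measure_pmf.expectation (configuration_model d w n) (partition_function n \<beta> B)"

definition annealed_mass ::
  "nat \<Rightarrow> (nat \<Rightarrow> nat) \<Rightarrow> nat \<Rightarrow> real \<Rightarrow> real \<Rightarrow> (nat \<Rightarrow> real) \<Rightarrow> real" where
  "annealed_mass d w n \<beta> B \<sigma> =
     measure_pmf.expectation (configuration_model d w n) (\<lambda>P. exp (- hamiltonian n \<beta> B P \<sigma>))
       / annealed_partition_function d w n \<beta> B"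

definition annealed_expectation ::
  "nat \<Rightarrow> (nat \<Rightarrow> nat) \<Rightarrow> nat \<Rightarrow> real \<Rightarrow> real \<Rightarrow> ((nat \<Rightarrow> real) \<Rightarrow> real) \<Rightarrow> real" where
  "annealed_expectation d w n \<beta> B X = (\<Sum>\<sigma>\<in>spin_configs n. annealed_mass d w n \<beta> B \<sigma> * X \<sigma>)"

definition annealed_variance ::
  "nat \<Rightarrow> (nat \<Rightarrow> nat) \<Rightarrow> nat \<Rightarrow> real \<Rightarrow> real \<Rightarrow> ((nat \<Rightarrow> real) \<Rightarrow> real) \<Rightarrow> real" where
  "annealed_variance d w n \<beta> B X =
     annealed_expectation d w n \<beta> B (\<lambda>\<sigma>. (X \<sigma> - annealed_expectation d w n \<beta> B X)\<^sup>2)"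

definition pressure_n :: "nat \<Rightarrow> (nat \<Rightarrow> nat) \<Rightarrow> nat \<Rightarrow> real \<Rightarrow> real \<Rightarrow> real" where
  "pressure_n d w n \<beta> B = 1 / real n * ln (annealed_partition_function d w n \<beta> B)"

definition magnetization_n :: "nat \<Rightarrow> (nat \<Rightarrow> nat) \<Rightarrow> nat \<Rightarrow> real \<Rightarrow> real \<Rightarrow> real" where
  "magnetization_n d w n \<beta> B = annealed_expectation d w n \<beta> B (\<lambda>\<sigma>. total_spin n \<sigma> / real n)"

definition susceptibility_n :: "nat \<Rightarrow> (nat \<Rightarrow> nat) \<Rightarrow> nat \<Rightarrow> real \<Rightarrow> real \<Rightarrow> real" where
  "susceptibility_n d w n \<beta> B =
     annealed_variance d w n \<beta> B (\<lambda>\<sigma>. total_spin n \<sigma> / sqrt (real n))"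

definition magnetization :: "nat \<Rightarrow> (nat \<Rightarrow> nat) \<Rightarrow> real \<Rightarrow> real \<Rightarrow> real" where
  "magnetization d w \<beta> B = lim (\<lambda>n. magnetization_n d w n \<beta> B)"

definition susceptibility :: "nat \<Rightarrow> (nat \<Rightarrow> nat) \<Rightarrow> real \<Rightarrow> real \<Rightarrow> real" where
  "susceptibility d w \<beta> B = lim (\<lambda>n. susceptibility_n d w n \<beta> B)"

definition spontaneous_magnetization :: "nat \<Rightarrow> (nat \<Rightarrow> nat) \<Rightarrow> real \<Rightarrow> real" where
  "spontaneous_magnetization d w \<beta> = Lim (at_right 0) (\<lambda>B. magnetization d w \<beta> B)"

definition critical_beta :: "nat \<Rightarrow> (nat \<Rightarrow> nat) \<Rightarrow> ereal" where
  "critical_beta d w = Inf (ereal ` {\<beta>. \<beta> > 0 \<and> spontaneous_magnetization d w \<beta> > 0})"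

definition uniqueness_regime :: "nat \<Rightarrow> (nat \<Rightarrow> nat) \<Rightarrow> (real \<times> real) set" where
  "uniqueness_regime d w =
     {(\<beta>, B). (\<beta> \<ge> 0 \<and> B \<noteq> 0) \<or> (0 < \<beta> \<and> ereal \<beta> < critical_beta d w \<and> B = 0)}"

definition f_fun :: "real \<Rightarrow> real \<Rightarrow> real" where
  "f_fun \<beta> s =
     (exp (-2 * \<beta>) * (1 - 2 * s) + sqrt (1 + (exp (-4 * \<beta>) - 1) * (1 - 2 * s)\<^sup>2)) / (2 * (1 - s))"

definition F_fun :: "real \<Rightarrow> real \<Rightarrow> real" where
  "F_fun \<beta> t = integral {0..min t (1 - t)} (\<lambda>s. ln (f_fun \<beta> s))"

text \<open>The convention \<open>0 * log 0 = 0\<close> holds automatically because \<open>ln\<close> is total.\<close>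

definition pressure_objective :: "nat \<Rightarrow> real \<Rightarrow> real \<Rightarrow> real \<Rightarrow> real" where
  "pressure_objective d \<beta> B t =
     (t - 1) * ln (1 - t) - t * ln t + 2 * B * t + real d * F_fun \<beta> t"

definition pressure :: "nat \<Rightarrow> real \<Rightarrow> real \<Rightarrow> real" where
  "pressure d \<beta> B = \<beta> * real d / 2 - B + (SUP t\<in>{0..1}. pressure_objective d \<beta> B t)"

end

theory Submission
  imports Defs "HOL-Real_Asymp.Real_Asymp"
begin

text \<open>
  The annealed partition function is, up to an explicit factor, an integral over an angle, and
  everything follows from Laplace's method in one variable.

  Put \<open>\<theta> = tanh \<beta>\<close> and \<open>s = sqrt \<theta>\<close>. A pair of half-edges with spins \<open>\<tau>\<close>, \<open>\<tau>'\<close> has Boltzmann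
  factor \<open>exp (\<beta> * \<tau> * \<tau>') = cosh \<beta> * (1 + \<theta> * \<tau> * \<tau>')\<close>, and \<open>1 + \<theta> * \<tau> * \<tau>'\<close> is the inner product
  of the plane vectors \<open>(1, s * \<tau>)\<close> and \<open>(1, s * \<tau>')\<close>. By Wick's formula the sum over all perfect
  matchings of the product of these inner products is a Gaussian moment
  \<open>E (\<Prod>h. U + s * \<tau> h * V)\<close>. The integrand is homogeneous, so the radius integrates out and
  \<open>\<integral> (\<Prod>h. cos \<phi> + s * \<tau> h * sin \<phi>) d\<phi>\<close> remains (\<open>matching_sum_eq_integral\<close>). Under this
  integral the spins are independent: the sum over spin configurations factorises over the
  vertices, and the annealed partition function is a factor times
  \<open>\<integral> p \<phi> ^ (n - 1) * q \<phi> d\<phi>\<close>, where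
  \<open>p \<phi> = exp B * (cos \<phi> + s * sin \<phi>) ^ d + exp (- B) * (cos \<phi> - s * sin \<phi>) ^ d\<close> and \<open>q\<close> is the
  same expression for the degree of the one vertex that may carry an extra half-edge.

  Hence the pressure tends to \<open>d / 2 * ln (cosh \<beta>) + ln (max p)\<close>. This agrees with the stated
  maximum over the density \<open>t\<close> of plus spins: \<open>F\<close> is the maximum over \<open>\<phi>\<close> of
  \<open>t * ln (cos \<phi> + s * sin \<phi>) + (1 - t) * ln (cos \<phi> - s * sin \<phi>)\<close> up to a constant
  (\<open>F_fun_variational\<close>), the Gibbs variational principle turns the maximum over \<open>t\<close> into the
  logarithm of a sum of two exponentials, and the two maxima commute.

  In the coordinate \<open>y = s * tan \<phi>\<close> the critical points of \<open>p\<close> are the solutions of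
  \<open>B = artanh (y / \<theta>) - (d - 1) * artanh y\<close>. If \<open>B \<noteq> 0\<close> or \<open>(d - 1) * \<theta> < 1\<close>, only one of them can
  be a maximum, and it is nondegenerate (\<open>stable_unique\<close>, \<open>stable_stability_pos\<close>). Laplace's
  method then gives the mean and the variance of the total spin (\<open>laplace_mean_variance\<close>): the
  magnetization tends to \<open>m = y * (1 + \<theta>) / (\<theta> + y\<^sup>2)\<close>, and the susceptibility tends to the sum
  of the variance of a single spin and a contribution of the fluctuations of \<open>\<phi>\<close>. Since \<open>y\<close> is a
  local inverse of the explicit function above, the pressure is twice differentiable in the field
  with these derivatives (\<open>has_real_derivative_pressure\<close>, \<open>susceptibility_identity\<close>).
  As \<open>B\<close> decreases to \<open>0\<close>, the solution \<open>y\<close> stays away from \<open>0\<close> exactly when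
  \<open>(d - 1) * \<theta> > 1\<close>, which gives the critical inverse temperature.

  For \<open>\<beta> = 0\<close> the coordinate \<open>y\<close> degenerates, but then the spins are independent under the
  annealed measure and the limits are those of \<open>n\<close> independent spins.
\<close>

section \<open>Perfect matchings as angular integrals\<close>

text \<open>
  The factor that a half-edge with spin \<open>\<tau>\<close> contributes at angle \<open>\<phi>\<close>: the inner product of
  \<open>(1, s * \<tau>)\<close> with the unit vector at \<open>\<phi>\<close>.
\<close>
definition amplitude :: "real \<Rightarrow> real \<Rightarrow> real \<Rightarrow> real" where
  "amplitude s \<tau> \<phi> = cos \<phi> + s * \<tau> * sin \<phi>"

lemma perfect_matchings_empty: "perfect_matchings {} = {{}}"
  by (auto simp: perfect_matchings_def partition_on_empty)

lemma finite_perfect_matchings: "finite X \<Longrightarrow> finite (perfect_matchings X)"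
  unfolding perfect_matchings_def by (rule finite_subset[OF _ finitely_many_partition_on]) auto

lemma perfect_matchings_insert_iff:
  assumes "h \<in> X" "g \<in> X" "h \<noteq> g" "{h, g} \<notin> Q"
  shows "insert {h, g} Q \<in> perfect_matchings X \<longleftrightarrow> Q \<in> perfect_matchings (X - {h, g})"
proof (cases "disjoint (insert {h, g} Q)")
  case True
  then have "disjnt {h, g} (\<Union>Q)"
    using assms(4) by (auto simp: pairwise_insert disjnt_iff)
  then have "partition_on X (insert {h, g} Q) \<longleftrightarrow> partition_on (X - {h, g}) Q"
    using partition_on_insert[of "{h, g}" Q X] assms by simp
  then show ?thesis
    using assms by (auto simp: perfect_matchings_def)
next
  case False
  have "disjoint (insert {h, g} Q)" if "partition_on (X - {h, g}) Q"
    using that assms by (auto simp: partition_on_def pairwise_insert disjnt_iff)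
  then show ?thesis
    using False by (auto simp: perfect_matchings_def partition_on_def)
qed

lemma perfect_matchings_decompose:
  assumes "h \<in> X"
  shows "perfect_matchings X =
    (\<Union>g\<in>X - {h}. insert {h, g} ` perfect_matchings (X - {h, g}))"
proof (intro equalityI subsetI)
  fix P assume P: "P \<in> perfect_matchings X"
  then obtain e where e: "e \<in> P" "h \<in> e"
    using assms by (auto simp: perfect_matchings_def partition_on_def)
  then have "card e = 2"
    using P by (auto simp: perfect_matchings_def)
  then obtain g where g: "e = {h, g}" "h \<noteq> g"
    using e by (auto simp: card_2_iff doubleton_eq_iff)
  then have "g \<in> X"
    using P e by (auto simp: perfect_matchings_def partition_on_def)
  have eq: "P = insert {h, g} (P - {{h, g}})"
    using e g by auto
  then have "P - {{h, g}} \<in> perfect_matchings (X - {h, g})"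
    using perfect_matchings_insert_iff[of h X g "P - {{h, g}}"] P assms g \<open>g \<in> X\<close> by simp
  then show "P \<in> (\<Union>g\<in>X - {h}. insert {h, g} ` perfect_matchings (X - {h, g}))"
    using eq g \<open>g \<in> X\<close> by blast
next
  fix P assume "P \<in> (\<Union>g\<in>X - {h}. insert {h, g} ` perfect_matchings (X - {h, g}))"
  then obtain g Q where gQ: "g \<in> X" "g \<noteq> h" "Q \<in> perfect_matchings (X - {h, g})"
    "P = insert {h, g} Q" by auto
  then have "{h, g} \<notin> Q"
    by (auto simp: perfect_matchings_def partition_on_def)
  then show "P \<in> perfect_matchings X"
    using perfect_matchings_insert_iff gQ assms by metis
qed

text \<open>
  A perfect matching is determined by the partner \<open>g\<close> of a fixed element \<open>h\<close> together with a
  perfect matching of the remaining elements. This is the recursion of Wick's formula.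
\<close>
lemma sum_perfect_matchings_remove:
  fixes f :: "'a set \<Rightarrow> real"
  assumes "finite X" "h \<in> X"
  shows "(\<Sum>P\<in>perfect_matchings X. \<Prod>e\<in>P. f e) =
    (\<Sum>g\<in>X - {h}. f {h, g} * (\<Sum>P\<in>perfect_matchings (X - {h, g}). \<Prod>e\<in>P. f e))"
proof -
  let ?A = "\<lambda>g. insert {h, g} ` perfect_matchings (X - {h, g})"
  have notin: "{h, g} \<notin> P" "finite P" if "P \<in> perfect_matchings (X - {h, g'})" for g g' P
    using that assms finite_elements[of "X - {h, g'}" P]
    by (auto simp: perfect_matchings_def partition_on_def)
  have "(\<Sum>P\<in>perfect_matchings X. \<Prod>e\<in>P. f e) = (\<Sum>g\<in>X - {h}. \<Sum>P\<in>?A g. \<Prod>e\<in>P. f e)"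
    unfolding perfect_matchings_decompose[OF assms(2)]
  proof (rule sum.UNION_disjoint)
    show "\<forall>g\<in>X - {h}. \<forall>g'\<in>X - {h}. g \<noteq> g' \<longrightarrow> ?A g \<inter> ?A g' = {}"
    proof (intro ballI impI)
      fix g g' assume gg: "g \<in> X - {h}" "g' \<in> X - {h}" "g \<noteq> g'"
      { fix P assume "P \<in> ?A g" "P \<in> ?A g'"
        then obtain Q Q' where "P = insert {h, g} Q" "P = insert {h, g'} Q'"
          "Q \<in> perfect_matchings (X - {h, g})" by blast
        then have "{h, g'} \<in> Q" using gg by (auto simp: doubleton_eq_iff)
        with notin(1) \<open>Q \<in> _\<close> have False by blast }
      then show "?A g \<inter> ?A g' = {}" by blast
    qed
  qed (use assms in \<open>auto intro!: finite_perfect_matchings\<close>)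
  also have "\<dots> = (\<Sum>g\<in>X - {h}. \<Sum>P\<in>perfect_matchings (X - {h, g}). f {h, g} * (\<Prod>e\<in>P. f e))"
  proof (rule sum.cong[OF refl])
    fix g
    have "inj_on (insert {h, g}) (perfect_matchings (X - {h, g}))"
    proof (rule inj_onI)
      fix P Q
      assume PQ: "P \<in> perfect_matchings (X - {h, g})" "Q \<in> perfect_matchings (X - {h, g})"
        "insert {h, g} P = insert {h, g} Q"
      show "P = Q"
        using PQ(3) notin(1)[OF PQ(1), of g] notin(1)[OF PQ(2), of g] by (metis insert_ident)
    qed
    then have "(\<Sum>P\<in>?A g. \<Prod>e\<in>P. f e)
        = (\<Sum>P\<in>perfect_matchings (X - {h, g}). \<Prod>e\<in>insert {h, g} P. f e)"
      by (rule sum.reindex_cong) auto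
    also have "\<dots> = (\<Sum>P\<in>perfect_matchings (X - {h, g}). f {h, g} * (\<Prod>e\<in>P. f e))"
      by (rule sum.cong[OF refl], rule prod.insert) (use notin in blast)+
    finally show "(\<Sum>P\<in>?A g. \<Prod>e\<in>P. f e)
        = (\<Sum>P\<in>perfect_matchings (X - {h, g}). f {h, g} * (\<Prod>e\<in>P. f e))" .
  qed
  finally show ?thesis
    by (simp add: sum_distrib_left)
qed

lemma continuous_on_amplitude [continuous_intros]:
  fixes f :: "real \<Rightarrow> real"
  shows "continuous_on A f \<Longrightarrow> continuous_on A (\<lambda>x. amplitude s \<tau> (f x))"
  unfolding amplitude_def by (intro continuous_intros) auto

text \<open>
  Integration by parts. The unit vector at \<open>\<phi>\<close> and its derivative are orthonormal, so the product
  of the derivatives of two amplitudes is the inner product of their vectors minus the product of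
  the amplitudes. Differentiating \<open>(amplitude of h)' * (product of the others)\<close> therefore produces
  \<open>card X\<close> copies of the full product and the terms with a pair removed. The boundary terms cancel
  because a half turn multiplies the product of an even number of amplitudes by \<open>1\<close>.
\<close>
lemma amplitude_integral_remove:
  fixes \<tau> :: "'a \<Rightarrow> real"
  assumes "finite X" "even (card X)" "h \<in> X"
  shows "real (card X) * integral {-(pi/2)..pi/2} (\<lambda>\<phi>. \<Prod>g\<in>X. amplitude s (\<tau> g) \<phi>) =
    (\<Sum>g\<in>X - {h}. (1 + s\<^sup>2 * \<tau> h * \<tau> g) *
       integral {-(pi/2)..pi/2} (\<lambda>\<phi>. \<Prod>k\<in>X - {h, g}. amplitude s (\<tau> k) \<phi>))"
proof -
  define Y where "Y = X - {h}"
  have Y: "finite Y" "h \<notin> Y" "X = insert h Y" "odd (card Y)" "card X = Suc (card Y)"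
    using assms by (auto simp: Y_def card_Diff_singleton insert_absorb)
     (metis Suc_pred assms(2) card_gt_0_iff empty_iff even_Suc)+
  define a where "a = (\<lambda>g \<phi>. amplitude s (\<tau> g) \<phi>)"
  define a' where "a' = (\<lambda>g \<phi>. s * \<tau> g * cos \<phi> - sin \<phi>)"
  define R where "R = (\<lambda>\<phi>. (\<Sum>g\<in>Y. (1 + s\<^sup>2 * \<tau> h * \<tau> g) * (\<Prod>k\<in>Y - {g}. a k \<phi>))
      - real (card X) * (\<Prod>g\<in>X. a g \<phi>))"
  have orth: "a' h \<phi> * a' g \<phi> = (1 + s\<^sup>2 * \<tau> h * \<tau> g) - a h \<phi> * a g \<phi>" for g \<phi>
  proof -
    have "a' h \<phi> * a' g \<phi> + a h \<phi> * a g \<phi>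
        = ((sin \<phi>)\<^sup>2 + (cos \<phi>)\<^sup>2) * (1 + s\<^sup>2 * \<tau> h * \<tau> g)"
      unfolding a_def a'_def amplitude_def by algebra
    then show ?thesis by simp
  qed
  have da: "(a g has_real_derivative a' g \<phi>) (at \<phi> within A)" for g \<phi> A
    unfolding a_def a'_def amplitude_def by (auto intro!: derivative_eq_intros)
  have da': "(a' g has_real_derivative - a g \<phi>) (at \<phi> within A)" for g \<phi> A
    unfolding a_def a'_def amplitude_def by (auto intro!: derivative_eq_intros)
  have dprod: "((\<lambda>\<phi>. \<Prod>g\<in>Y. a g \<phi>) has_real_derivative (\<Sum>g\<in>Y. a' g \<phi> * (\<Prod>k\<in>Y - {g}. a k \<phi>)))
      (at \<phi> within A)" for \<phi> A
    by (rule has_field_derivative_at_within[OF has_field_derivative_prod[of Y a "\<lambda>g. a' g \<phi>" \<phi>, OF da]])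
  have D: "((\<lambda>\<phi>. a' h \<phi> * (\<Prod>g\<in>Y. a g \<phi>)) has_real_derivative R \<phi>) (at \<phi> within A)" for \<phi> A
  proof -
    have "a' h \<phi> * (\<Sum>g\<in>Y. a' g \<phi> * (\<Prod>k\<in>Y - {g}. a k \<phi>)) =
        (\<Sum>g\<in>Y. (1 + s\<^sup>2 * \<tau> h * \<tau> g) * (\<Prod>k\<in>Y - {g}. a k \<phi>) - a h \<phi> * (\<Prod>k\<in>Y. a k \<phi>))"
      unfolding sum_distrib_left
    proof (intro sum.cong refl)
      fix g assume "g \<in> Y"
      then have "(\<Prod>k\<in>Y. a k \<phi>) = a g \<phi> * (\<Prod>k\<in>Y - {g}. a k \<phi>)"
        using Y by (simp add: prod.remove)
      then have "a h \<phi> * (\<Prod>k\<in>Y. a k \<phi>) = (a h \<phi> * a g \<phi>) * (\<Prod>k\<in>Y - {g}. a k \<phi>)"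
        by simp
      moreover have "a' h \<phi> * (a' g \<phi> * (\<Prod>k\<in>Y - {g}. a k \<phi>)) =
          (1 + s\<^sup>2 * \<tau> h * \<tau> g - a h \<phi> * a g \<phi>) * (\<Prod>k\<in>Y - {g}. a k \<phi>)"
        by (simp add: orth[symmetric])
      ultimately show "a' h \<phi> * (a' g \<phi> * (\<Prod>k\<in>Y - {g}. a k \<phi>)) =
         (1 + s\<^sup>2 * \<tau> h * \<tau> g) * (\<Prod>k\<in>Y - {g}. a k \<phi>) - a h \<phi> * (\<Prod>k\<in>Y. a k \<phi>)"
        by (simp only: left_diff_distrib)
    qed
    then have "- a h \<phi> * (\<Prod>g\<in>Y. a g \<phi>) + (\<Sum>g\<in>Y. a' g \<phi> * (\<Prod>k\<in>Y - {g}. a k \<phi>)) * a' h \<phi> = R \<phi>"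
      unfolding R_def using Y(1,2) by (simp add: Y(3,5) sum_subtractf mult.commute distrib_right)
    then show ?thesis
      using DERIV_mult[OF da'[of h \<phi> A] dprod[of \<phi> A]] by (simp only:)
  qed
  have "(R has_integral a' h (pi/2) * (\<Prod>g\<in>Y. a g (pi/2)) - a' h (-(pi/2)) * (\<Prod>g\<in>Y. a g (-(pi/2))))
      {-(pi/2)..pi/2}"
    using D by (intro fundamental_theorem_of_calculus)
      (auto simp: has_real_derivative_iff_has_vector_derivative[symmetric])
  moreover have "(\<Prod>g\<in>Y. a g (-(pi/2))) = - (\<Prod>g\<in>Y. a g (pi/2))"
    using Y(4) by (simp add: a_def amplitude_def prod_uminus)
  ultimately have R0: "(R has_integral 0) {-(pi/2)..pi/2}"
    by (simp add: a'_def)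
  have int: "(\<lambda>\<phi>. \<Prod>k\<in>Z. a k \<phi>) integrable_on {-(pi/2)..pi/2}" for Z
    unfolding a_def by (intro integrable_continuous_interval continuous_intros)
  have "integral {-(pi/2)..pi/2} R =
     (\<Sum>g\<in>Y. (1 + s\<^sup>2 * \<tau> h * \<tau> g) * integral {-(pi/2)..pi/2} (\<lambda>\<phi>. \<Prod>k\<in>Y - {g}. a k \<phi>))
      - real (card X) * integral {-(pi/2)..pi/2} (\<lambda>\<phi>. \<Prod>g\<in>X. a g \<phi>)"
    unfolding R_def using Y(1) int
    by (simp add: integral_diff integral_sum integrable_sum integrable_on_mult_right)
  then show ?thesis
    using R0 by (simp add: integral_unique Y_def[symmetric] a_def)
       (simp add: Y_def insert_commute flip: Diff_insert2)
qed

text \<open>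
  Wick's formula in polar coordinates: both sides satisfy the same recursion. The factor
  \<open>2 ^ m * fact m\<close> is the moment of order \<open>2 * m\<close> of the Gaussian radius, and \<open>pi\<close> is the length of
  the interval of integration.
\<close>
lemma matching_sum_eq_integral:
  fixes \<tau> :: "'a \<Rightarrow> real"
  assumes "finite X" "card X = 2 * m"
  shows "(\<Sum>P\<in>perfect_matchings X. \<Prod>e\<in>P. 1 + s\<^sup>2 * (\<Prod>h\<in>e. \<tau> h)) =
    2 ^ m * fact m / pi * integral {-(pi/2)..pi/2} (\<lambda>\<phi>. \<Prod>h\<in>X. amplitude s (\<tau> h) \<phi>)"
  using assms
proof (induction m arbitrary: X)
  case 0
  then show ?case
    by (simp add: perfect_matchings_empty)
next
  case (Suc m)
  let ?I = "\<lambda>X. integral {-(pi/2)..pi/2} (\<lambda>\<phi>. \<Prod>h\<in>X. amplitude s (\<tau> h) \<phi>)"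
  let ?T = "\<lambda>X. \<Sum>P\<in>perfect_matchings X. \<Prod>e\<in>P. 1 + s\<^sup>2 * (\<Prod>h\<in>e. \<tau> h)"
  obtain h where h: "h \<in> X"
    using Suc.prems by fastforce
  have T: "?T (X - {h, g}) = 2 ^ m * fact m / pi * ?I (X - {h, g})" if "g \<in> X - {h}" for g
    using that Suc.prems h by (intro Suc.IH) (auto simp: card_Diff_subset)
  have "?T X = (\<Sum>g\<in>X - {h}. (1 + s\<^sup>2 * (\<Prod>h\<in>{h, g}. \<tau> h)) * ?T (X - {h, g}))"
    using Suc.prems h by (intro sum_perfect_matchings_remove) auto
  also have "\<dots> = (\<Sum>g\<in>X - {h}. 2 ^ m * fact m / pi * ((1 + s\<^sup>2 * \<tau> h * \<tau> g) * ?I (X - {h, g})))"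
  proof (intro sum.cong refl)
    fix g assume g: "g \<in> X - {h}"
    then have "(\<Prod>h\<in>{h, g}. \<tau> h) = \<tau> h * \<tau> g"
      by (subst prod.insert) auto
    then show "(1 + s\<^sup>2 * (\<Prod>h\<in>{h, g}. \<tau> h)) * ?T (X - {h, g}) =
      2 ^ m * fact m / pi * ((1 + s\<^sup>2 * \<tau> h * \<tau> g) * ?I (X - {h, g}))"
      using T[OF g] by (simp add: mult.assoc)
  qed
  also have "\<dots> = 2 ^ m * fact m / pi * (real (card X) * ?I X)"
    using Suc.prems h by (subst amplitude_integral_remove[of X h]) (auto simp: sum_distrib_left)
  also have "\<dots> = 2 ^ Suc m * fact (Suc m) / pi * ?I X"
    using Suc.prems by simp
  finally show ?case .
qed

text \<open>
  The same formula with \<open>s = 0\<close> counts the matchings, so the expectation over a uniform matching is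
  a quotient of two angular integrals and the double factorials disappear.
\<close>
lemma card_perfect_matchings:
  assumes "finite X" "card X = 2 * m"
  shows "real (card (perfect_matchings X)) =
    2 ^ m * fact m / pi * integral {-(pi/2)..pi/2} (\<lambda>\<phi>. cos \<phi> ^ card X)"
  using matching_sum_eq_integral[OF assms, of 0 "\<lambda>_. 0"] by (simp add: amplitude_def)

section \<open>Annealed expectations as angular integrals\<close>

lemma card_eq_twice_card_perfect_matching:
  assumes "finite X" "P \<in> perfect_matchings X"
  shows "card X = 2 * card P"
proof -
  have P: "partition_on X P" "\<And>e. e \<in> P \<Longrightarrow> card e = 2"
    using assms(2) by (auto simp: perfect_matchings_def)
  have "card X = card (\<Union>P)"
    using P(1) by (simp add: partition_on_def)
  also have "\<dots> = sum card P"
    using P by (intro card_Union_disjoint) (auto simp: partition_on_def disjnt_def pairwise_def intro!: card_ge_0_finite)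
  finally show ?thesis
    using P(2) by simp
qed

lemma finite_half_edges [simp]: "finite (half_edges d w n)"
  by (simp add: half_edges_def)

text \<open>
  For an edge of \<open>P\<close> with end vertices \<open>a \<le> b\<close>, exactly one pair \<open>(i, j)\<close> with \<open>i \<le> j\<close> has
  \<open>{i, j} = {a, b}\<close>, also when \<open>a = b\<close>. As an edge has two half-edges, the product of the spins
  over its half-edges counts the spin of a loop twice, as it should.
\<close>
lemma interaction_eq_sum_edges:
  fixes \<sigma> :: "nat \<Rightarrow> real"
  assumes "P \<in> perfect_matchings (half_edges d w n)"
  shows "(\<Sum>i=1..n. \<Sum>j=i..n. real (edge_count P i j) * \<sigma> i * \<sigma> j) = (\<Sum>e\<in>P. \<Prod>h\<in>e. \<sigma> (fst h))"
proof -
  have P: "partition_on (half_edges d w n) P" "\<And>e. e \<in> P \<Longrightarrow> card e = 2"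
    using assms by (auto simp: perfect_matchings_def)
  have fin: "finite P"
    using finite_elements[OF _ P(1)] by simp
  have count: "real (edge_count P i j) * \<sigma> i * \<sigma> j =
      (\<Sum>e\<in>P. if fst ` e = {i, j} then \<sigma> i * \<sigma> j else 0)" for i j
    using fin unfolding edge_count_def
    by (subst sum.inter_filter[symmetric]) auto
  have edge: "(\<Sum>i=1..n. \<Sum>j=i..n. if fst ` e = {i, j} then \<sigma> i * \<sigma> j else 0) = (\<Prod>h\<in>e. \<sigma> (fst h))"
    if e: "e \<in> P" for e
  proof -
    obtain h g where hg: "e = {h, g}" "h \<noteq> g" "fst h \<le> fst g"
    proof -
      obtain h g where "e = {h, g}" "h \<noteq> g"
        using P(2)[OF e] by (auto simp: card_2_iff)
      then show ?thesis
        using that[of h g] that[of g h] by (cases "fst h \<le> fst g") (auto simp: insert_commute)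
    qed
    have "e \<subseteq> half_edges d w n"
      using P(1) e by (auto simp: partition_on_def)
    then have range: "fst h \<in> {1..n}" "fst g \<in> {1..n}"
      using hg by (auto simp: half_edges_def)
    have "(\<Sum>i=1..n. \<Sum>j=i..n. if fst ` e = {i, j} then \<sigma> i * \<sigma> j else 0)
        = (\<Sum>i=1..n. \<Sum>j=i..n. if i = fst h then if j = fst g then \<sigma> i * \<sigma> j else 0 else 0)"
      using hg(3) by (intro sum.cong refl) (auto simp: hg(1) doubleton_eq_iff)
    also have "\<dots> = (\<Sum>i=1..n. if i = fst h then \<Sum>j=i..n. if j = fst g then \<sigma> i * \<sigma> j else 0 else 0)"
      by (intro sum.cong refl) auto
    also have "\<dots> = \<sigma> (fst h) * \<sigma> (fst g)"
      using range hg(3) by (simp add: sum.delta)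
    finally show ?thesis
      using hg by simp
  qed
  have "(\<Sum>i=1..n. \<Sum>j=i..n. real (edge_count P i j) * \<sigma> i * \<sigma> j) =
      (\<Sum>i=1..n. \<Sum>e\<in>P. \<Sum>j=i..n. if fst ` e = {i, j} then \<sigma> i * \<sigma> j else 0)"
    unfolding count by (intro sum.cong refl sum.swap)
  also have "\<dots> = (\<Sum>e\<in>P. \<Sum>i=1..n. \<Sum>j=i..n. if fst ` e = {i, j} then \<sigma> i * \<sigma> j else 0)"
    by (rule sum.swap)
  also have "\<dots> = (\<Sum>e\<in>P. \<Prod>h\<in>e. \<sigma> (fst h))"
    by (intro sum.cong refl edge)
  finally show ?thesis .
qed

lemma exp_mult_spin:
  fixes \<beta> t :: real
  assumes "t \<in> {-1, 1}"
  shows "exp (\<beta> * t) = cosh \<beta> * (1 + tanh \<beta> * t)"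
proof -
  have "cosh \<beta> * (1 + tanh \<beta> * t) = cosh \<beta> + sinh \<beta> * t"
    by (simp add: tanh_def field_simps)
  also have "\<dots> = exp (\<beta> * t)"
    using assms by (auto simp: cosh_plus_sinh cosh_minus_sinh)
  finally show ?thesis by simp
qed

lemma prod_pm_one:
  fixes f :: "'a \<Rightarrow> real"
  assumes "\<And>x. x \<in> A \<Longrightarrow> f x \<in> {-1, 1}" "finite A"
  shows "prod f A \<in> {-1, 1}"
  using assms(2,1)
proof (induction A rule: finite_induct)
  case (insert x F)
  then have "f x \<in> {-1, 1}" "prod f F \<in> {-1, 1}" by blast+
  then show ?case using insert.hyps by auto
qed simp

lemma boltzmann_weight_eq_prod:
  assumes "P \<in> perfect_matchings (half_edges d w n)" "\<sigma> \<in> spin_configs n"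
  shows "exp (- hamiltonian n \<beta> B P \<sigma>) =
    exp (B * total_spin n \<sigma>) * cosh \<beta> ^ card P * (\<Prod>e\<in>P. 1 + tanh \<beta> * (\<Prod>h\<in>e. \<sigma> (fst h)))"
proof -
  have P: "partition_on (half_edges d w n) P"
    using assms by (auto simp: perfect_matchings_def)
  have fin: "finite P"
    using finite_elements[OF _ P] by simp
  have pm: "(\<Prod>h\<in>e. \<sigma> (fst h)) \<in> {-1, 1}" if "e \<in> P" for e
  proof -
    have sub: "e \<subseteq> half_edges d w n"
      using P that by (auto simp: partition_on_def)
    then have "\<sigma> (fst h) \<in> {-1, 1}" if "h \<in> e" for h
    proof -
      have "fst h \<in> {1..n}"
        using sub that by (auto simp: half_edges_def)
      then show ?thesis
        using PiE_mem[of \<sigma> "{1..n}" "\<lambda>_. {-1, 1}" "fst h"] assms(2) unfolding spin_configs_def by blast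
    qed
    moreover have "finite e"
      using finite_subset[OF sub] by simp
    ultimately show ?thesis
      by (intro prod_pm_one)
  qed
  have "- hamiltonian n \<beta> B P \<sigma> = B * total_spin n \<sigma> + (\<Sum>e\<in>P. \<beta> * (\<Prod>h\<in>e. \<sigma> (fst h)))"
    unfolding hamiltonian_def interaction_eq_sum_edges[OF assms(1)]
    by (simp add: total_spin_def sum_distrib_left sum_negf)
  then have "exp (- hamiltonian n \<beta> B P \<sigma>) =
      exp (B * total_spin n \<sigma>) * (\<Prod>e\<in>P. exp (\<beta> * (\<Prod>h\<in>e. \<sigma> (fst h))))"
    by (simp add: exp_add exp_sum fin)
  also have "(\<Prod>e\<in>P. exp (\<beta> * (\<Prod>h\<in>e. \<sigma> (fst h)))) =
      (\<Prod>e\<in>P. cosh \<beta> * (1 + tanh \<beta> * (\<Prod>h\<in>e. \<sigma> (fst h))))"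
    by (intro prod.cong refl exp_mult_spin pm)
  also have "\<dots> = cosh \<beta> ^ card P * (\<Prod>e\<in>P. 1 + tanh \<beta> * (\<Prod>h\<in>e. \<sigma> (fst h)))"
    by (simp add: prod.distrib)
  finally show ?thesis by simp
qed

text \<open>
  What the configuration \<open>\<sigma>\<close> contributes to the integrand at angle \<open>\<phi>\<close> after averaging over the
  graph. Given \<open>\<phi>\<close> it is a product over the vertices.
\<close>
definition config_weight ::
  "real \<Rightarrow> real \<Rightarrow> nat \<Rightarrow> (nat \<Rightarrow> nat) \<Rightarrow> nat \<Rightarrow> (nat \<Rightarrow> real) \<Rightarrow> real \<Rightarrow> real" where
  "config_weight s B d w n \<sigma> \<phi> =
     exp (B * total_spin n \<sigma>) * (\<Prod>i=1..n. amplitude s (\<sigma> i) \<phi> ^ vertex_degree d w n i)"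

lemma continuous_on_config_weight [continuous_intros]:
  "continuous_on A (config_weight s B d w n \<sigma>)"
  unfolding config_weight_def[abs_def] by (intro continuous_intros)

text \<open>
  The degree of vertex \<open>w n\<close>; all other vertices have degree \<open>d\<close>.
\<close>
definition exceptional_degree :: "nat \<Rightarrow> nat \<Rightarrow> nat" where
  "exceptional_degree d n = (if odd (d * n) then d + 1 else d)"

lemma prod_vertex_degree:
  fixes g :: "nat \<Rightarrow> nat \<Rightarrow> 'b :: comm_monoid_mult"
  assumes "w n \<in> {1..n}"
  shows "(\<Prod>i=1..n. g i (vertex_degree d w n i)) =
    g (w n) (exceptional_degree d n) * (\<Prod>i\<in>{1..n} - {w n}. g i d)"
proof -
  have "(\<Prod>i=1..n. g i (vertex_degree d w n i)) =
    g (w n) (vertex_degree d w n (w n)) * (\<Prod>i\<in>{1..n} - {w n}. g i (vertex_degree d w n i))"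
    using assms by (intro prod.remove) auto
  also have "(\<Prod>i\<in>{1..n} - {w n}. g i (vertex_degree d w n i)) = (\<Prod>i\<in>{1..n} - {w n}. g i d)"
    by (intro prod.cong refl) (auto simp: vertex_degree_def)
  finally show ?thesis
    by (simp add: vertex_degree_def exceptional_degree_def)
qed

lemma card_half_edges:
  assumes "w n \<in> {1..n}"
  shows "card (half_edges d w n) = d * (n - 1) + exceptional_degree d n"
    and "even (d * (n - 1) + exceptional_degree d n)"
proof -
  have "card (half_edges d w n) = (\<Sum>i=1..n. vertex_degree d w n i)"
    by (simp add: half_edges_def card_SigmaI)
  also have "\<dots> = vertex_degree d w n (w n) + (\<Sum>i\<in>{1..n} - {w n}. vertex_degree d w n i)"
    using assms by (intro sum.remove) auto
  also have "(\<Sum>i\<in>{1..n} - {w n}. vertex_degree d w n i) = (\<Sum>i\<in>{1..n} - {w n}. d)"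
    by (intro sum.cong refl) (auto simp: vertex_degree_def)
  also have "\<dots> = d * (n - 1)"
    using assms by (simp add: card_Diff_singleton)
  finally show "card (half_edges d w n) = d * (n - 1) + exceptional_degree d n"
    by (simp add: vertex_degree_def exceptional_degree_def)
  obtain k where "n = Suc k" using assms by (cases n) auto
  then show "even (d * (n - 1) + exceptional_degree d n)"
    by (auto simp: exceptional_degree_def)
qed

abbreviation cos_integral :: "nat \<Rightarrow> real" where
  "cos_integral N \<equiv> integral {-(pi/2)..pi/2} (\<lambda>\<phi>. cos \<phi> ^ N)"

text \<open>
  The integral is the normalisation of the uniform matching, so positivity also shows that matchings
  of the half-edges exist.
\<close>
lemma cos_integral_pos: "cos_integral N > 0"
proof -
  have cont: "continuous_on {-(pi/2)..pi/2} (\<lambda>\<phi>::real. cos \<phi> ^ N)"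
    by (intro continuous_intros)
  have nonneg: "0 \<le> cos \<phi> ^ N" if "\<phi> \<in> {-(pi/2)..pi/2}" for \<phi> :: real
    using that by (intro zero_le_power cos_ge_zero) auto
  have "cos_integral N \<ge> 0"
    using cont nonneg by (intro integral_nonneg integrable_continuous_interval) auto
  moreover have "cos_integral N \<noteq> 0"
  proof
    assume "cos_integral N = 0"
    then have "((\<lambda>\<phi>. cos \<phi> ^ N) has_integral 0) (cbox (-(pi/2)) (pi/2))"
      using integrable_integral[OF integrable_continuous_interval[OF cont]] by simp
    then have "cos (0::real) ^ N = 0"
      by (rule has_integral_0_cbox_imp_0[rotated 2]) (use cont nonneg pi_gt_zero in \<open>auto simp: not_le[symmetric]\<close>)
    then show False by simp
  qed
  ultimately show ?thesis by linarith
qed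

lemma perfect_matchings_half_edges_nonempty:
  assumes "w n \<in> {1..n}"
  shows "perfect_matchings (half_edges d w n) \<noteq> {}"
proof -
  let ?X = "half_edges d w n"
  obtain m where m: "card ?X = 2 * m"
    using card_half_edges[of w n d, OF assms] by (metis evenE)
  have "real (card (perfect_matchings ?X)) > 0"
    unfolding card_perfect_matchings[OF finite_half_edges m]
    using cos_integral_pos[of "card ?X"] by simp
  then show ?thesis by auto
qed

lemma expected_boltzmann_weight:
  fixes d :: nat
  assumes "\<beta> \<ge> 0" "w n \<in> {1..n}" "\<sigma> \<in> spin_configs n"
  defines "N \<equiv> d * (n - 1) + exceptional_degree d n"
  shows "measure_pmf.expectation (configuration_model d w n) (\<lambda>P. exp (- hamiltonian n \<beta> B P \<sigma>)) =
    cosh \<beta> ^ (N div 2) / cos_integral N *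
      integral {-(pi/2)..pi/2} (config_weight (sqrt (tanh \<beta>)) B d w n \<sigma>)"
proof -
  define X where "X = half_edges d w n"
  define m where "m = N div 2"
  have X: "finite X" "card X = 2 * m" and N: "N = 2 * m"
    using card_half_edges[of w n d, OF assms(2)] by (auto simp: X_def m_def N_def)
  have s: "(sqrt (tanh \<beta>))\<^sup>2 = tanh \<beta>"
    using assms(1) by simp
  define K where "K = 2 ^ m * fact m / pi"
  have K: "K > 0" by (simp add: K_def)
  have card: "real (card (perfect_matchings X)) = K * cos_integral N"
    using card_perfect_matchings[OF X] X(2) N by (simp add: K_def)
  have amp: "(\<Prod>h\<in>X. amplitude s (\<sigma> (fst h)) \<phi>) = (\<Prod>i=1..n. amplitude s (\<sigma> i) \<phi> ^ vertex_degree d w n i)"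
    for s \<phi>
    unfolding X_def half_edges_def
    by (subst prod.Sigma[symmetric, where g = "\<lambda>i _. amplitude s (\<sigma> i) \<phi>", unfolded split_def fst_conv]) auto
  have sum: "(\<Sum>P\<in>perfect_matchings X. exp (- hamiltonian n \<beta> B P \<sigma>)) =
      cosh \<beta> ^ m * (K * integral {-(pi/2)..pi/2} (config_weight (sqrt (tanh \<beta>)) B d w n \<sigma>))"
  proof -
    have "(\<Sum>P\<in>perfect_matchings X. exp (- hamiltonian n \<beta> B P \<sigma>)) =
      (\<Sum>P\<in>perfect_matchings X. exp (B * total_spin n \<sigma>) * cosh \<beta> ^ m *
        (\<Prod>e\<in>P. 1 + (sqrt (tanh \<beta>))\<^sup>2 * (\<Prod>h\<in>e. \<sigma> (fst h))))"
    proof (intro sum.cong refl)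
      fix P assume P: "P \<in> perfect_matchings X"
      then have "card P = m"
        using card_eq_twice_card_perfect_matching[OF X(1)] X(2) by simp
      then show "exp (- hamiltonian n \<beta> B P \<sigma>) = exp (B * total_spin n \<sigma>) * cosh \<beta> ^ m *
        (\<Prod>e\<in>P. 1 + (sqrt (tanh \<beta>))\<^sup>2 * (\<Prod>h\<in>e. \<sigma> (fst h)))"
        using boltzmann_weight_eq_prod[of P d w n \<sigma> \<beta> B] P assms(3) s by (simp add: X_def)
    qed
    also have "\<dots> = exp (B * total_spin n \<sigma>) * cosh \<beta> ^ m *
        (K * integral {-(pi/2)..pi/2} (\<lambda>\<phi>. \<Prod>h\<in>X. amplitude (sqrt (tanh \<beta>)) (\<sigma> (fst h)) \<phi>))"
      unfolding sum_distrib_left[symmetric] matching_sum_eq_integral[OF X, of "sqrt (tanh \<beta>)" "\<lambda>h. \<sigma> (fst h)"] K_def ..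
    finally show ?thesis
      unfolding amp config_weight_def by simp
  qed
  have "perfect_matchings X \<noteq> {}"
    unfolding X_def using assms(2) by (rule perfect_matchings_half_edges_nonempty)
  then have "measure_pmf.expectation (configuration_model d w n) (\<lambda>P. exp (- hamiltonian n \<beta> B P \<sigma>))
     = (\<Sum>P\<in>perfect_matchings X. exp (- hamiltonian n \<beta> B P \<sigma>)) / real (card (perfect_matchings X))"
    unfolding configuration_model_def X_def
    by (subst integral_pmf_of_set) (auto intro: finite_perfect_matchings)
  then show ?thesis
    unfolding sum card using K by (simp add: m_def)
qed

lemma finite_spin_configs [simp]: "finite (spin_configs n)"
  by (simp add: spin_configs_def finite_PiE)

text \<open>
  The sum over the spin \<open>\<tau>\<close> of one vertex of degree \<open>D\<close> of \<open>(\<tau> - m) ^ k\<close> times its weight at angle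
  \<open>\<phi>\<close>. For \<open>k = 0\<close> this is the weight of the vertex, whatever \<open>m\<close> is.
\<close>
definition site_moment :: "real \<Rightarrow> real \<Rightarrow> real \<Rightarrow> nat \<Rightarrow> nat \<Rightarrow> real \<Rightarrow> real" where
  "site_moment s B m k D \<phi> =
     (1 - m) ^ k * exp B * amplitude s 1 \<phi> ^ D + (- 1 - m) ^ k * exp (- B) * amplitude s (- 1) \<phi> ^ D"

abbreviation "site_weight s B \<equiv> site_moment s B 0 0"

lemma continuous_on_site_moment [continuous_intros]:
  "continuous_on A (site_moment s B m k D)"
  unfolding site_moment_def[abs_def] by (intro continuous_intros)

text \<open>
  With the angle fixed, the sum over configurations of a product over vertices factorises. The extra
  parameter \<open>b\<close> generates the moments of \<open>total_spin n \<sigma> - real n * m\<close>.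
\<close>
lemma sum_config_weight_tilted:
  assumes "w n \<in> {1..n}"
  shows "(\<Sum>\<sigma>\<in>spin_configs n. exp (b * (total_spin n \<sigma> - real n * m)) * config_weight s B d w n \<sigma> \<phi>) =
    (exp (b * (1 - m)) * exp B * amplitude s 1 \<phi> ^ d +
     exp (b * (- 1 - m)) * exp (- B) * amplitude s (- 1) \<phi> ^ d) ^ (n - 1) *
    (exp (b * (1 - m)) * exp B * amplitude s 1 \<phi> ^ exceptional_degree d n +
     exp (b * (- 1 - m)) * exp (- B) * amplitude s (- 1) \<phi> ^ exceptional_degree d n)"
proof -
  define f where "f = (\<lambda>(\<tau>::real) D. exp (b * (\<tau> - m)) * exp (B * \<tau>) * amplitude s \<tau> \<phi> ^ D)"
  have "exp (b * (total_spin n \<sigma> - real n * m)) * config_weight s B d w n \<sigma> \<phi> =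
      (\<Prod>i=1..n. f (\<sigma> i) (vertex_degree d w n i))" for \<sigma>
  proof -
    have "exp (b * (total_spin n \<sigma> - real n * m)) * exp (B * total_spin n \<sigma>) =
        (\<Prod>i=1..n. exp (b * (\<sigma> i - m)) * exp (B * \<sigma> i))"
      by (simp add: total_spin_def exp_add[symmetric] exp_sum[symmetric] sum_distrib_left
          sum.distrib sum_subtractf right_diff_distrib)
    then show ?thesis
      unfolding f_def config_weight_def by (simp add: prod.distrib)
  qed
  then have "(\<Sum>\<sigma>\<in>spin_configs n. exp (b * (total_spin n \<sigma> - real n * m)) * config_weight s B d w n \<sigma> \<phi>) =
      (\<Sum>\<sigma>\<in>spin_configs n. \<Prod>i=1..n. f (\<sigma> i) (vertex_degree d w n i))"
    by simp
  also have "\<dots> = (\<Prod>i=1..n. \<Sum>\<tau>\<in>{-1, 1}. f \<tau> (vertex_degree d w n i))"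
    unfolding spin_configs_def by (subst prod_sum_PiE) auto
  also have "\<dots> = (\<Sum>\<tau>\<in>{-1, 1}. f \<tau> (exceptional_degree d n)) * (\<Sum>\<tau>\<in>{-1, 1}. f \<tau> d) ^ (n - 1)"
    using assms by (subst prod_vertex_degree[where g = "\<lambda>_ D. \<Sum>\<tau>\<in>{-1, 1}. f \<tau> D"])
      (auto simp: card_Diff_singleton)
  finally show ?thesis
    by (simp add: f_def ac_simps)
qed

lemma sum_config_weight:
  assumes "w n \<in> {1..n}"
  shows "(\<Sum>\<sigma>\<in>spin_configs n. config_weight s B d w n \<sigma> \<phi>) =
    site_weight s B d \<phi> ^ (n - 1) * site_weight s B (exceptional_degree d n) \<phi>"
  using sum_config_weight_tilted[of w n 0 0, OF assms] by (simp add: site_moment_def)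

text \<open>
  The two sums are the first and second derivatives at \<open>b = 0\<close> of the tilted sum, computed from its
  factorised form. Taking them at a fixed angle means that no integral has to be differentiated.
  Writing \<open>n = j + 3\<close> keeps the smallest exponent \<open>n - 3\<close> free of truncated subtraction.
\<close>
lemma sum_config_weight_moments:
  fixes j d :: nat and s B m \<phi> :: real
  assumes "w n \<in> {1..n}" "n = j + 3"
  defines "A \<equiv> \<lambda>k. site_moment s B m k d \<phi>"
    and "Q \<equiv> \<lambda>k. site_moment s B m k (exceptional_degree d n) \<phi>"
  shows "(\<Sum>\<sigma>\<in>spin_configs n. (total_spin n \<sigma> - real n * m) * config_weight s B d w n \<sigma> \<phi>) =
      real (j + 2) * A 0 ^ (j + 1) * A 1 * Q 0 + A 0 ^ (j + 2) * Q 1" (is "?M1 0 = _")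
    and "(\<Sum>\<sigma>\<in>spin_configs n. (total_spin n \<sigma> - real n * m)\<^sup>2 * config_weight s B d w n \<sigma> \<phi>) =
      real (j + 2) * (real (j + 1) * A 0 ^ j * (A 1)\<^sup>2 * Q 0 + A 0 ^ (j + 1) * A 2 * Q 0
        + 2 * A 0 ^ (j + 1) * A 1 * Q 1) + A 0 ^ (j + 2) * Q 2"
proof -
  define T where "T = (\<lambda>k D b. (1 - m) ^ k * exp (b * (1 - m)) * exp B * amplitude s 1 \<phi> ^ D +
     (- 1 - m) ^ k * exp (b * (- 1 - m)) * exp (- B) * amplitude s (- 1) \<phi> ^ D)"
  have dT: "(T k D has_real_derivative T (Suc k) D b) (at b)" for k D b
    unfolding T_def by (auto intro!: derivative_eq_intros simp: algebra_simps)
  define D where "D = exceptional_degree d n"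
  define S where "S = (\<lambda>k b. \<Sum>\<sigma>\<in>spin_configs n. (total_spin n \<sigma> - real n * m) ^ k *
    exp (b * (total_spin n \<sigma> - real n * m)) * config_weight s B d w n \<sigma> \<phi>)"
  have dS: "(S k has_real_derivative S (Suc k) b) (at b)" for k b
    unfolding S_def by (auto intro!: derivative_eq_intros sum.cong simp: algebra_simps)
  have S0: "S 0 = (\<lambda>b. T 0 d b ^ (j + 2) * T 0 D b)"
    using sum_config_weight_tilted[of w n _ m s B d \<phi>, OF assms(1)] assms(2)
    by (simp add: S_def T_def D_def fun_eq_iff)
  have dpow: "((\<lambda>b. T 0 d b ^ (k + 1)) has_real_derivative real (k + 1) * T 0 d b ^ k * T 1 d b) (at b)" for k b
    by (rule DERIV_cong[OF DERIV_power[OF dT]]) simp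
  have dpow2: "((\<lambda>b. T 0 d b ^ (j + 2)) has_real_derivative real (j + 2) * T 0 d b ^ (j + 1) * T 1 d b) (at b)" for b
    using dpow[of "j + 1" b] by (simp add: numeral_2_eq_2)
  have D1: "((\<lambda>b. T 0 d b ^ (j + 2) * T 0 D b) has_real_derivative
      T 0 d b ^ (j + 2) * T 1 D b + real (j + 2) * T 0 d b ^ (j + 1) * T 1 d b * T 0 D b) (at b)" for b
    using DERIV_mult'[OF dpow2[of b] dT[of 0 D b]] by (simp only: One_nat_def)
  have S1: "S 1 = (\<lambda>b. T 0 d b ^ (j + 2) * T 1 D b + real (j + 2) * T 0 d b ^ (j + 1) * T 1 d b * T 0 D b)"
    using DERIV_unique[OF dS[of 0, unfolded S0] D1] by (simp only: One_nat_def fun_eq_iff) simp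
  have D2: "((\<lambda>b. T 0 d b ^ (j + 2) * T 1 D b + real (j + 2) * T 0 d b ^ (j + 1) * T 1 d b * T 0 D b)
      has_real_derivative
      (T 0 d b ^ (j + 2) * T 2 D b + real (j + 2) * T 0 d b ^ (j + 1) * T 1 d b * T 1 D b) +
      (real (j + 2) * T 0 d b ^ (j + 1) * T 1 d b * T 1 D b +
       (real (j + 2) * T 0 d b ^ (j + 1) * T 2 d b
        + real (j + 2) * (real (j + 1) * T 0 d b ^ j * T 1 d b) * T 1 d b) * T 0 D b)) (at b)" for b
    using DERIV_add[OF DERIV_mult'[OF dpow2[of b] dT[of 1 D b]]
       DERIV_mult'[OF DERIV_mult'[OF DERIV_cmult[OF dpow[of j b], of "real (j + 2)"] dT[of 1 d b]] dT[of 0 D b]]]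
    by (simp only: One_nat_def numeral_2_eq_2)
  have S2: "S 2 b = real (j + 2) * (real (j + 1) * T 0 d b ^ j * (T 1 d b)\<^sup>2 * T 0 D b + T 0 d b ^ (j + 1) * T 2 d b * T 0 D b
        + 2 * T 0 d b ^ (j + 1) * T 1 d b * T 1 D b) + T 0 d b ^ (j + 2) * T 2 D b" for b
    using DERIV_unique[OF dS[of 1 b, unfolded S1] D2[of b]]
    by (simp only: Suc_1) (simp add: power2_eq_square distrib_left distrib_right mult.assoc mult.left_commute)
  have T0: "T k d 0 = A k" "T k D 0 = Q k" for k
    by (simp_all add: T_def A_def Q_def D_def site_moment_def)
  show "(\<Sum>\<sigma>\<in>spin_configs n. (total_spin n \<sigma> - real n * m) * config_weight s B d w n \<sigma> \<phi>) =
      real (j + 2) * A 0 ^ (j + 1) * A 1 * Q 0 + A 0 ^ (j + 2) * Q 1"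
    using fun_cong[OF S1, of 0] unfolding T0 by (simp add: S_def)
  show "(\<Sum>\<sigma>\<in>spin_configs n. (total_spin n \<sigma> - real n * m)\<^sup>2 * config_weight s B d w n \<sigma> \<phi>) =
      real (j + 2) * (real (j + 1) * A 0 ^ j * (A 1)\<^sup>2 * Q 0 + A 0 ^ (j + 1) * A 2 * Q 0
        + 2 * A 0 ^ (j + 1) * A 1 * Q 1) + A 0 ^ (j + 2) * Q 2"
    using S2[of 0] unfolding T0 by (simp add: S_def)
qed

text \<open>
  The numerator is the sum over the configurations of their angular integrals, and the sum of the
  integrands factorises.
\<close>
lemma annealed_partition_function_eq:
  fixes d :: nat
  assumes "\<beta> \<ge> 0" "w n \<in> {1..n}"
  defines "D \<equiv> exceptional_degree d n" and "s \<equiv> sqrt (tanh \<beta>)"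
  defines "N \<equiv> d * (n - 1) + D"
  shows "annealed_partition_function d w n \<beta> B = cosh \<beta> ^ (N div 2) / cos_integral N *
    integral {-(pi/2)..pi/2} (\<lambda>\<phi>. site_weight s B d \<phi> ^ (n - 1) * site_weight s B D \<phi>)"
proof -
  have "annealed_partition_function d w n \<beta> B = (\<Sum>\<sigma>\<in>spin_configs n.
      measure_pmf.expectation (configuration_model d w n) (\<lambda>P. exp (- hamiltonian n \<beta> B P \<sigma>)))"
    unfolding annealed_partition_function_def partition_function_def
  proof (rule Bochner_Integration.integral_sum)
    fix \<sigma>
    have "perfect_matchings (half_edges d w n) \<noteq> {}" "finite (perfect_matchings (half_edges d w n))"
      using assms(2) by (simp_all add: perfect_matchings_half_edges_nonempty finite_perfect_matchings)
    then show "integrable (configuration_model d w n) (\<lambda>P. exp (- hamiltonian n \<beta> B P \<sigma>))"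
      unfolding configuration_model_def by (intro integrable_measure_pmf_finite) simp
  qed
  also have "\<dots> = (\<Sum>\<sigma>\<in>spin_configs n. cosh \<beta> ^ (N div 2) / cos_integral N *
      integral {-(pi/2)..pi/2} (config_weight s B d w n \<sigma>))"
    unfolding N_def D_def s_def using assms by (intro sum.cong refl expected_boltzmann_weight)
  also have "\<dots> = cosh \<beta> ^ (N div 2) / cos_integral N *
      integral {-(pi/2)..pi/2} (\<lambda>\<phi>. \<Sum>\<sigma>\<in>spin_configs n. config_weight s B d w n \<sigma> \<phi>)"
    by (subst integral_sum)
      (auto simp: sum_distrib_left intro!: integrable_continuous_interval continuous_on_config_weight)
  finally show ?thesis
    using assms(2) by (simp add: sum_config_weight[of w n] D_def)
qed

lemma annealed_expectation_eq:
  fixes d :: nat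
  assumes "\<beta> \<ge> 0" "w n \<in> {1..n}"
  defines "D \<equiv> exceptional_degree d n" and "s \<equiv> sqrt (tanh \<beta>)"
  shows "annealed_expectation d w n \<beta> B X =
    integral {-(pi/2)..pi/2} (\<lambda>\<phi>. \<Sum>\<sigma>\<in>spin_configs n. X \<sigma> * config_weight s B d w n \<sigma> \<phi>) /
    integral {-(pi/2)..pi/2} (\<lambda>\<phi>. site_weight s B d \<phi> ^ (n - 1) * site_weight s B D \<phi>)"
proof -
  define N where "N = d * (n - 1) + D"
  have pos: "cosh \<beta> ^ (N div 2) / cos_integral N > 0" "cos_integral N \<noteq> 0"
    using cos_integral_pos[of N] by (simp_all add: cosh_real_pos)
  have "annealed_expectation d w n \<beta> B X = (\<Sum>\<sigma>\<in>spin_configs n.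
     X \<sigma> * integral {-(pi/2)..pi/2} (config_weight s B d w n \<sigma>) /
     integral {-(pi/2)..pi/2} (\<lambda>\<phi>. site_weight s B d \<phi> ^ (n - 1) * site_weight s B D \<phi>))"
    unfolding annealed_expectation_def annealed_mass_def
    using pos assms annealed_partition_function_eq[of \<beta> w n d B, OF assms(1,2)]
      expected_boltzmann_weight[of \<beta> w n _ d B, OF assms(1,2)]
    by (intro sum.cong refl) (simp add: N_def)
  also have "\<dots> = (\<Sum>\<sigma>\<in>spin_configs n.
     X \<sigma> * integral {-(pi/2)..pi/2} (config_weight s B d w n \<sigma>)) /
     integral {-(pi/2)..pi/2} (\<lambda>\<phi>. site_weight s B d \<phi> ^ (n - 1) * site_weight s B D \<phi>)"
    by (simp add: sum_divide_distrib)
  also have "(\<Sum>\<sigma>\<in>spin_configs n. X \<sigma> * integral {-(pi/2)..pi/2} (config_weight s B d w n \<sigma>)) =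
     integral {-(pi/2)..pi/2} (\<lambda>\<phi>. \<Sum>\<sigma>\<in>spin_configs n. X \<sigma> * config_weight s B d w n \<sigma> \<phi>)"
    by (subst integral_sum) (auto intro!: integrable_continuous_interval continuous_intros continuous_on_config_weight)
  finally show ?thesis .
qed

section \<open>Laplace's method\<close>

text \<open>
  The integral is at most a constant times the \<open>(n - 1)\<close>st power of the maximum, and at least a
  constant times that of any smaller value, by restricting it to a neighbourhood of the maximizer.
\<close>
lemma log_laplace:
  fixes p g :: "real \<Rightarrow> real"
  assumes cont: "continuous_on {a..b} p" "continuous_on {a..b} g"
    and x0: "a < x0" "x0 < b" "p x0 \<noteq> 0" "g x0 \<noteq> 0"
    and max: "\<And>x. x \<in> {a..b} \<Longrightarrow> \<bar>p x\<bar> \<le> \<bar>p x0\<bar>"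
  shows "(\<lambda>n. 1 / real n * ln (integral {a..b} (\<lambda>x. \<bar>p x\<bar> ^ (n - 1) * \<bar>g x\<bar>))) \<longlonglongrightarrow> ln \<bar>p x0\<bar>"
proof -
  define I where "I = (\<lambda>n. integral {a..b} (\<lambda>x. \<bar>p x\<bar> ^ (n - 1) * \<bar>g x\<bar>))"
  have int: "(\<lambda>x. \<bar>p x\<bar> ^ (n - 1) * \<bar>g x\<bar>) integrable_on {a'..b'}" if "a \<le> a'" "b' \<le> b" for n a' b'
    using that by (intro integrable_continuous_interval continuous_intros continuous_on_subset[OF cont(1)]
        continuous_on_subset[OF cont(2)]) auto
  obtain G where G: "\<And>x. x \<in> {a..b} \<Longrightarrow> \<bar>g x\<bar> \<le> G"
  proof -
    have "bounded (g ` {a..b})"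
      using cont(2) compact_continuous_image compact_imp_bounded compact_Icc by blast
    then obtain G where "\<forall>y\<in>g ` {a..b}. norm y \<le> G"
      unfolding bounded_iff by blast
    then show ?thesis
      using that[of G] by simp
  qed
  have Gpos: "G > 0"
    using G[of x0] x0 by auto
  have upper: "I n \<le> \<bar>p x0\<bar> ^ (n - 1) * G * (b - a)" for n
  proof -
    have "I n \<le> integral {a..b} (\<lambda>x. \<bar>p x0\<bar> ^ (n - 1) * G)"
      unfolding I_def using int[of a b] max G
      by (intro integral_le) (auto intro!: mult_mono power_mono)
    then show ?thesis
      using x0 by (simp add: ac_simps)
  qed
  have lower: "\<exists>\<gamma>>0. \<forall>n. q ^ (n - 1) * \<gamma> \<le> I n" if q: "0 \<le> q" "q < \<bar>p x0\<bar>" for q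
  proof -
    have "isCont p x0" "isCont g x0"
      using cont x0 by (auto intro: continuous_on_interior simp: interior_atLeastAtMost_real)
    then have "(\<lambda>x. \<bar>p x\<bar>) \<midarrow>x0\<rightarrow> \<bar>p x0\<bar>" "(\<lambda>x. \<bar>g x\<bar>) \<midarrow>x0\<rightarrow> \<bar>g x0\<bar>"
      by (auto intro!: tendsto_rabs simp: isCont_def)
    then have "\<forall>\<^sub>F x in at x0. q < \<bar>p x\<bar>" "\<forall>\<^sub>F x in at x0. \<bar>g x0\<bar> / 2 < \<bar>g x\<bar>"
      using q x0 order_tendstoD(1)[of _ "\<bar>g x0\<bar>" _ "\<bar>g x0\<bar> / 2"] by (auto intro: order_tendstoD(1))
    then have "\<forall>\<^sub>F x in at x0. q < \<bar>p x\<bar> \<and> \<bar>g x0\<bar> / 2 < \<bar>g x\<bar>"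
      by eventually_elim auto
    then obtain \<delta> where \<delta>: "\<delta> > 0"
      "\<And>x. x \<noteq> x0 \<Longrightarrow> dist x x0 < \<delta> \<Longrightarrow> q < \<bar>p x\<bar> \<and> \<bar>g x0\<bar> / 2 < \<bar>g x\<bar>"
      by (auto simp: eventually_at)
    define e where "e = x0 + min (\<delta> / 2) (b - x0)"
    have e: "x0 < e" "e \<le> b"
      using \<delta>(1) x0 by (auto simp: e_def)
    have near: "q \<le> \<bar>p x\<bar> \<and> \<bar>g x0\<bar> / 2 \<le> \<bar>g x\<bar>" if "x \<in> {x0..e}" for x
    proof (cases "x = x0")
      case False
      then have "dist x x0 < \<delta>"
        using that \<delta>(1) by (auto simp: e_def dist_real_def)
      then show ?thesis
        using \<delta>(2)[OF False] by force
    qed (use q in auto)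
    have "q ^ (n - 1) * (\<bar>g x0\<bar> / 2 * (e - x0)) \<le> I n" for n
    proof -
      have "q ^ (n - 1) * (\<bar>g x0\<bar> / 2 * (e - x0)) = integral {x0..e} (\<lambda>x. q ^ (n - 1) * (\<bar>g x0\<bar> / 2))"
        using e by simp
      also have "\<dots> \<le> integral {x0..e} (\<lambda>x. \<bar>p x\<bar> ^ (n - 1) * \<bar>g x\<bar>)"
      proof (rule integral_le)
        fix x assume "x \<in> {x0..e}"
        then show "q ^ (n - 1) * (\<bar>g x0\<bar> / 2) \<le> \<bar>p x\<bar> ^ (n - 1) * \<bar>g x\<bar>"
          using near[of x] q by (intro mult_mono power_mono) auto
      qed (use int[of x0 e n] x0 e in auto)
      also have "\<dots> \<le> I n"
        unfolding I_def using int[of x0 e n] int[of a b n] x0 e by (intro integral_subset_le) auto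
      finally show ?thesis .
    qed
    moreover have "\<bar>g x0\<bar> / 2 * (e - x0) > 0"
      using e x0 by simp
    ultimately show ?thesis by blast
  qed
  have pos: "I n > 0" for n
  proof -
    obtain \<gamma> where "\<gamma> > 0" "(\<bar>p x0\<bar> / 2) ^ (n - 1) * \<gamma> \<le> I n"
      using lower[of "\<bar>p x0\<bar> / 2"] x0 by auto
    moreover have "(\<bar>p x0\<bar> / 2) ^ (n - 1) > 0"
      using x0 by simp
    ultimately show ?thesis
      by (meson less_le_trans mult_pos_pos)
  qed
  have lim: "(\<lambda>n. real (n - 1) / real n * r + t / real n) \<longlonglongrightarrow> r" for r t :: real
    by real_asymp
  have ln_bound: "1 / real n * ln (q ^ (n - 1) * \<gamma>) = real (n - 1) / real n * ln q + ln \<gamma> / real n"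
    if "q > 0" "\<gamma> > 0" for q \<gamma> n
    using that by (simp add: ln_mult ln_realpow field_simps add_divide_distrib)
  have "(\<lambda>n. 1 / real n * ln (I n)) \<longlonglongrightarrow> ln \<bar>p x0\<bar>"
  proof (rule order_tendstoI)
    fix y assume y: "y > ln \<bar>p x0\<bar>"
    have "\<forall>\<^sub>F n in sequentially. real (n - 1) / real n * ln \<bar>p x0\<bar> + ln (G * (b - a)) / real n < y"
      by (rule order_tendstoD(2)[OF lim y])
    then show "\<forall>\<^sub>F n in sequentially. 1 / real n * ln (I n) < y"
    proof eventually_elim
      case (elim n)
      have "1 / real n * ln (I n) \<le> 1 / real n * ln (\<bar>p x0\<bar> ^ (n - 1) * (G * (b - a)))"
        using pos[of n] upper[of n] by (intro mult_left_mono) (auto simp: mult.assoc)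
      also have "\<dots> < y"
        using elim ln_bound[of "\<bar>p x0\<bar>" "G * (b - a)" n] x0 Gpos by simp
      finally show ?case .
    qed
  next
    fix y assume y: "y < ln \<bar>p x0\<bar>"
    define z where "z = (y + ln \<bar>p x0\<bar>) / 2"
    have z: "y < z" "z < ln \<bar>p x0\<bar>"
      using y by (auto simp: z_def)
    have "exp z < \<bar>p x0\<bar>"
      using z(2) x0 by (metis exp_less_mono exp_ln zero_less_abs_iff)
    then obtain \<gamma> where \<gamma>: "\<gamma> > 0" "\<And>n. exp z ^ (n - 1) * \<gamma> \<le> I n"
      using lower[of "exp z"] by auto
    have "\<forall>\<^sub>F n in sequentially. real (n - 1) / real n * z + ln \<gamma> / real n > y"
      by (rule order_tendstoD(1)[OF lim z(1)])
    then show "\<forall>\<^sub>F n in sequentially. 1 / real n * ln (I n) > y"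
    proof eventually_elim
      case (elim n)
      have "y < 1 / real n * ln (exp z ^ (n - 1) * \<gamma>)"
        using elim ln_bound[of "exp z" \<gamma> n] \<gamma> by simp
      also have "\<dots> \<le> 1 / real n * ln (I n)"
        using \<gamma> pos[of n] by (intro mult_left_mono) (auto simp: ln_le_cancel_iff)
      finally show ?case .
    qed
  qed
  then show ?thesis
    by (simp add: I_def)
qed

text \<open>
  Near \<open>x0\<close> the bound follows from the quadratic behaviour of \<open>ln (p x / p x0)\<close>. Away from \<open>x0\<close>
  compactness keeps \<open>\<bar>p x\<bar> / p x0\<close> below a constant smaller than \<open>1\<close>, and on a bounded interval such
  a constant is dominated by a sufficiently flat Gaussian.
\<close>
lemma gaussian_domination:
  fixes p :: "real \<Rightarrow> real"
  assumes cont: "continuous_on {a..b} p"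
    and x0: "a < x0" "x0 < b" "p x0 > 0"
    and max: "\<And>x. x \<in> {a..b} \<Longrightarrow> x \<noteq> x0 \<Longrightarrow> \<bar>p x\<bar> < p x0"
    and peano: "((\<lambda>x. ln (p x / p x0) / (x - x0)\<^sup>2) \<longlongrightarrow> - c / 2) (at x0)" and c: "c > 0"
  obtains \<kappa> where "\<kappa> > 0" "\<And>x. x \<in> {a..b} \<Longrightarrow> \<bar>p x / p x0\<bar> \<le> exp (- \<kappa> * (x - x0)\<^sup>2)"
proof -
  have "isCont p x0"
    using cont x0 by (auto intro: continuous_on_interior simp: interior_atLeastAtMost_real)
  then have "\<forall>\<^sub>F x in at x0. p x > 0"
    using x0 by (auto simp: isCont_def intro: order_tendstoD(1))
  moreover have "\<forall>\<^sub>F x in at x0. ln (p x / p x0) / (x - x0)\<^sup>2 < - c / 4"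
    using peano c by (intro order_tendstoD(2)) auto
  ultimately have "\<forall>\<^sub>F x in at x0. p x > 0 \<and> ln (p x / p x0) / (x - x0)\<^sup>2 < - c / 4"
    by eventually_elim auto
  then obtain \<delta> where \<delta>: "\<delta> > 0"
    "\<And>x. x \<noteq> x0 \<Longrightarrow> dist x x0 < \<delta> \<Longrightarrow> p x > 0 \<and> ln (p x / p x0) / (x - x0)\<^sup>2 < - c / 4"
    by (auto simp: eventually_at)
  have near: "\<bar>p x / p x0\<bar> \<le> exp (- (c / 4) * (x - x0)\<^sup>2)" if "dist x x0 < \<delta>" for x
  proof (cases "x = x0")
    case False
    have "p x > 0" and *: "ln (p x / p x0) / (x - x0)\<^sup>2 < - c / 4"
      using \<delta>(2)[OF False that] by auto
    have "ln (p x / p x0) \<le> - (c / 4) * (x - x0)\<^sup>2"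
      using * False by (simp add: divide_less_eq)
    then have "p x / p x0 \<le> exp (- (c / 4) * (x - x0)\<^sup>2)"
      using \<open>p x > 0\<close> x0 by (subst ln_le_cancel_iff[symmetric]) auto
    then show ?thesis
      using \<open>p x > 0\<close> x0 by simp
  qed (use x0 in auto)
  define T where "T = {a..b} - ball x0 \<delta>"
  have T: "compact T"
    unfolding T_def by (intro compact_diff) auto
  obtain r where r: "0 < r" "r < 1" "\<And>x. x \<in> T \<Longrightarrow> \<bar>p x / p x0\<bar> \<le> r"
  proof (cases "T = {}")
    case True
    then show ?thesis using that[of "1/2"] by auto
  next
    case False
    have "continuous_on T (\<lambda>x. \<bar>p x / p x0\<bar>)"
      using x0 by (intro continuous_intros continuous_on_subset[OF cont]) (auto simp: T_def)
    then obtain x1 where x1: "x1 \<in> T" "\<And>x. x \<in> T \<Longrightarrow> \<bar>p x / p x0\<bar> \<le> \<bar>p x1 / p x0\<bar>"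
      using continuous_attains_sup[OF T False] by blast
    have "x1 \<noteq> x0" "x1 \<in> {a..b}"
      using x1(1) \<delta>(1) by (auto simp: T_def)
    then have "\<bar>p x1 / p x0\<bar> < 1"
      using max[of x1] x0 by (simp add: abs_divide)
    then show ?thesis
      using that[of "max (1 / 2) \<bar>p x1 / p x0\<bar>"] x1(2) by (simp only: max_less_iff_conj le_max_iff_disj less_max_iff_disj) auto
  qed
  define \<kappa> where "\<kappa> = min (c / 4) (- ln r / (b - a)\<^sup>2)"
  have \<kappa>: "\<kappa> > 0"
    using c r x0 by (simp add: \<kappa>_def divide_less_0_iff)
  have "\<bar>p x / p x0\<bar> \<le> exp (- \<kappa> * (x - x0)\<^sup>2)" if x: "x \<in> {a..b}" for x
  proof (cases "dist x x0 < \<delta>")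
    case True
    have "exp (- (c / 4) * (x - x0)\<^sup>2) \<le> exp (- \<kappa> * (x - x0)\<^sup>2)"
    proof -
      have "\<kappa> \<le> c / 4"
        unfolding \<kappa>_def by (rule min.cobounded1)
      then have "\<kappa> * (x - x0)\<^sup>2 \<le> (c / 4) * (x - x0)\<^sup>2"
        by (rule mult_right_mono) simp
      then show ?thesis by simp
    qed
    then show ?thesis
      using near[OF True] by linarith
  next
    case False
    then have "x \<in> T"
      using x by (auto simp: T_def dist_commute)
    then have "\<bar>p x / p x0\<bar> \<le> exp (ln r)"
      using r by simp
    also have "\<dots> \<le> exp (- \<kappa> * (x - x0)\<^sup>2)"
    proof -
      have "(x - x0)\<^sup>2 \<le> (b - a)\<^sup>2"
        using x x0 by (intro power2_le_iff_abs_le[THEN iffD2]) auto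
      then have "\<kappa> * (x - x0)\<^sup>2 \<le> \<kappa> * (b - a)\<^sup>2"
        using \<kappa> by (intro mult_left_mono) auto
      also have "\<dots> \<le> (- ln r / (b - a)\<^sup>2) * (b - a)\<^sup>2"
        by (intro mult_right_mono) (auto simp: \<kappa>_def)
      also have "\<dots> = - ln r"
        using x0 by simp
      finally show ?thesis by simp
    qed
    finally show ?thesis .
  qed
  then show ?thesis
    using \<kappa> that by blast
qed

definition gaussian_moment :: "real \<Rightarrow> nat \<Rightarrow> real" where
  "gaussian_moment c k = (\<integral>z. z ^ k * exp (- c / 2 * z\<^sup>2) \<partial>lborel)"

lemma gaussian_eq_normal_density:
  assumes "c > 0"
  shows "exp (- c / 2 * z\<^sup>2) = sqrt (2 * pi / c) * normal_density 0 (1 / sqrt c) z"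
  using assms by (simp add: normal_density_def real_sqrt_divide power_divide field_simps)

lemma gaussian_moment_values:
  assumes "c > 0"
  shows "gaussian_moment c 0 = sqrt (2 * pi / c)"
    and "gaussian_moment c 1 = 0"
    and "gaussian_moment c 2 = sqrt (2 * pi / c) / c"
proof -
  have eq: "gaussian_moment c k = sqrt (2 * pi / c) * (\<integral>z. normal_density 0 (1 / sqrt c) z * (z - 0) ^ k \<partial>lborel)" for k
    unfolding gaussian_moment_def gaussian_eq_normal_density[OF assms]
    by (subst integral_mult_right_zero[symmetric]) (simp add: ac_simps)
  have \<sigma>: "1 / sqrt c > 0" using assms by simp
  show "gaussian_moment c 0 = sqrt (2 * pi / c)"
    using integral_normal_moment_even[OF \<sigma>, of 0 0] unfolding eq by simp
  show "gaussian_moment c 1 = 0"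
    using integral_normal_moment_odd[OF \<sigma>, of 0 0] unfolding eq by simp
  show "gaussian_moment c 2 = sqrt (2 * pi / c) / c"
    using integral_normal_moment_even[OF \<sigma>, of 0 1] assms unfolding eq by (simp add: power_divide)
qed

text \<open>
  After the substitution \<open>x = x0 + z / sqrt n\<close> the factor \<open>(p x / p x0) ^ n\<close> is
  \<open>exp (z\<^sup>2 * (ln (p x / p x0) / (x - x0)\<^sup>2))\<close>, which tends to a Gaussian pointwise and is dominated by a
  Gaussian, so dominated convergence applies. The function \<open>p\<close> may be negative far from \<open>x0\<close>; the
  domination takes care of that.
\<close>
lemma laplace_moment:
  fixes p g :: "real \<Rightarrow> real"
  assumes cont: "continuous_on {a..b} p" "continuous_on {a..b} g"
    and x0: "a < x0" "x0 < b" "p x0 > 0"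
    and max: "\<And>x. x \<in> {a..b} \<Longrightarrow> x \<noteq> x0 \<Longrightarrow> \<bar>p x\<bar> < p x0"
    and peano: "((\<lambda>x. ln (p x / p x0) / (x - x0)\<^sup>2) \<longlongrightarrow> - c / 2) (at x0)" and c: "c > 0"
  shows "(\<lambda>n. sqrt (real n) ^ (k + 1) * integral {a..b} (\<lambda>x. (x - x0) ^ k * g x * (p x / p x0) ^ n))
      \<longlonglongrightarrow> g x0 * gaussian_moment c k"
proof -
  obtain \<kappa> where \<kappa>: "\<kappa> > 0" "\<And>x. x \<in> {a..b} \<Longrightarrow> \<bar>p x / p x0\<bar> \<le> exp (- \<kappa> * (x - x0)\<^sup>2)"
    using gaussian_domination[OF cont(1) x0 max peano c] by blast
  obtain G where G: "\<And>x. x \<in> {a..b} \<Longrightarrow> \<bar>g x\<bar> \<le> G"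
  proof -
    have "bounded (g ` {a..b})"
      using cont(2) compact_continuous_image compact_imp_bounded compact_Icc by blast
    then obtain G where "\<forall>y\<in>g ` {a..b}. norm y \<le> G"
      unfolding bounded_iff by blast
    then show ?thesis
      using that[of G] by simp
  qed
  have isCont: "isCont p x0" "isCont g x0"
    using cont x0 by (auto intro: continuous_on_interior simp: interior_atLeastAtMost_real)
  define H where "H = (\<lambda>n x. indicator {a..b} x * (g x * (p x / p x0) ^ n))"
  define F where "F = (\<lambda>n z. z ^ k * H n (x0 + 1 / sqrt (real n) * z))"
  define f where "f = (\<lambda>z. g x0 * (z ^ k * exp (- c / 2 * z\<^sup>2)))"
  have contH: "continuous_on {a..b} (\<lambda>x. g x * (p x / p x0) ^ n)" for n
    using cont x0 by (intro continuous_intros) auto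
  have meas [measurable]: "H n \<in> borel_measurable borel" for n
    using borel_measurable_continuous_on_indicator[OF _ contH[of n]] unfolding H_def by simp
  have eq: "sqrt (real n) ^ (k + 1) * integral {a..b} (\<lambda>x. (x - x0) ^ k * g x * (p x / p x0) ^ n)
      = (\<integral>z. F n z \<partial>lborel)" if n: "n > 0" for n
  proof -
    have "continuous_on {a..b} (\<lambda>x. (x - x0) ^ k * g x * (p x / p x0) ^ n)"
      using cont x0 by (intro continuous_intros) auto
    then have "integral {a..b} (\<lambda>x. (x - x0) ^ k * g x * (p x / p x0) ^ n) =
        (LINT x:{a..b}|lborel. (x - x0) ^ k * g x * (p x / p x0) ^ n)"
      by (intro set_borel_integral_eq_integral(2)[symmetric] borel_integrable_atLeastAtMost')
    also have "\<dots> = (\<integral>x. (x - x0) ^ k * H n x \<partial>lborel)"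
      unfolding set_lebesgue_integral_def H_def by (intro Bochner_Integration.integral_cong) auto
    also have "\<dots> = 1 / sqrt (real n) * (\<integral>z. (1 / sqrt (real n) * z) ^ k * H n (x0 + 1 / sqrt (real n) * z) \<partial>lborel)"
      using n by (subst lborel_integral_real_affine[where c = "1 / sqrt (real n)" and t = x0]) auto
    also have "(\<integral>z. (1 / sqrt (real n) * z) ^ k * H n (x0 + 1 / sqrt (real n) * z) \<partial>lborel)
        = (1 / sqrt (real n)) ^ k * (\<integral>z. F n z \<partial>lborel)"
      by (subst integral_mult_right_zero[symmetric])
        (simp add: F_def power_mult_distrib power_divide mult.assoc)
    finally show ?thesis
      using n by (simp add: power_divide)
  qed
  have "(\<lambda>n. \<integral>z. F (Suc n) z \<partial>lborel) \<longlonglongrightarrow> (\<integral>z. f z \<partial>lborel)"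
  proof (rule integral_dominated_convergence[where w = "\<lambda>z. G * (\<bar>z\<bar> ^ k * exp (- \<kappa> * z\<^sup>2))"])
    show "integrable lborel (\<lambda>z. G * (\<bar>z\<bar> ^ k * exp (- \<kappa> * z\<^sup>2)))"
    proof -
      have "integrable lborel (\<lambda>z. normal_density 0 (1 / sqrt (2 * \<kappa>)) z * \<bar>z - 0\<bar> ^ k)"
        using \<kappa> by (intro integrable_normal_moment_abs) simp
      then have "integrable lborel (\<lambda>z. (G * sqrt (2 * pi / (2 * \<kappa>))) * (normal_density 0 (1 / sqrt (2 * \<kappa>)) z * \<bar>z - 0\<bar> ^ k))"
        by (rule integrable_mult_right)
      moreover have *: "(G * sqrt (2 * pi / (2 * \<kappa>))) * (normal_density 0 (1 / sqrt (2 * \<kappa>)) z * \<bar>z - 0\<bar> ^ k)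
          = G * (\<bar>z\<bar> ^ k * exp (- \<kappa> * z\<^sup>2))" for z
        using gaussian_eq_normal_density[of "2 * \<kappa>" z] \<kappa> by simp
      ultimately show ?thesis by (simp only: *)
    qed
    show "f \<in> borel_measurable lborel"
      unfolding f_def by measurable
    show "F (Suc n) \<in> borel_measurable lborel" for n
      unfolding F_def by measurable
    show "AE z in lborel. (\<lambda>n. F (Suc n) z) \<longlonglongrightarrow> f z"
    proof (rule AE_I2, rule LIMSEQ_Suc)
      fix z :: real
      define X where "X = (\<lambda>n. x0 + 1 / sqrt (real n) * z)"
      show "(\<lambda>n. F n z) \<longlonglongrightarrow> f z"
      proof (cases "z = 0")
        case True
        have "(\<lambda>n. F n z) = (\<lambda>n. f z)"
          using True x0 by (auto simp: F_def f_def H_def fun_eq_iff)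
        then show ?thesis by simp
      next
        case False
        have X: "X \<longlonglongrightarrow> x0"
          unfolding X_def by real_asymp
        have ne: "\<forall>\<^sub>F n in sequentially. X n \<noteq> x0"
          using eventually_gt_at_top[of 0] by eventually_elim (use False in \<open>auto simp: X_def\<close>)
        have Xat: "filterlim X (at x0) sequentially"
          using X ne by (auto simp: filterlim_at)
        have quot: "(\<lambda>n. ln (p (X n) / p x0) / (X n - x0)\<^sup>2) \<longlonglongrightarrow> - c / 2"
          by (rule filterlim_compose[OF peano Xat])
        have gX: "(\<lambda>n. g (X n)) \<longlonglongrightarrow> g x0" and pX: "(\<lambda>n. p (X n)) \<longlonglongrightarrow> p x0"
          using isCont X by (auto intro: isCont_tendsto_compose)
        have "(\<lambda>n. z ^ k * (g (X n) * exp (z\<^sup>2 * (ln (p (X n) / p x0) / (X n - x0)\<^sup>2))))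
            \<longlonglongrightarrow> z ^ k * (g x0 * exp (z\<^sup>2 * (- c / 2)))"
          by (intro tendsto_intros gX quot)
        moreover have "\<forall>\<^sub>F n in sequentially.
            z ^ k * (g (X n) * exp (z\<^sup>2 * (ln (p (X n) / p x0) / (X n - x0)\<^sup>2))) = F n z"
          using order_tendstoD(1)[OF pX x0(3)] order_tendstoD(1)[OF X x0(1)] order_tendstoD(2)[OF X x0(2)]
            eventually_gt_at_top[of 0]
        proof eventually_elim
          case (elim n)
          have "z\<^sup>2 * (ln (p (X n) / p x0) / (X n - x0)\<^sup>2) = real n * ln (p (X n) / p x0)"
            using elim False by (simp add: X_def power_mult_distrib power_divide)
          also have "exp \<dots> = (p (X n) / p x0) ^ n"
            using elim x0 by (simp add: exp_of_nat_mult)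
          finally show ?case
            using elim by (simp add: F_def H_def X_def)
        qed
        ultimately have "(\<lambda>n. F n z) \<longlonglongrightarrow> z ^ k * (g x0 * exp (z\<^sup>2 * (- c / 2)))"
          by (rule Lim_transform_eventually)
        then show ?thesis
          by (simp add: f_def ac_simps)
      qed
    qed
    show "AE z in lborel. norm (F (Suc n') z) \<le> G * (\<bar>z\<bar> ^ k * exp (- \<kappa> * z\<^sup>2))" for n'
    proof (rule AE_I2)
      fix z :: real
      define n where "n = Suc n'"
      define x where "x = x0 + 1 / sqrt (real n) * z"
      have G0: "G \<ge> 0" using G[of x0] x0 by auto
      show "norm (F (Suc n') z) \<le> G * (\<bar>z\<bar> ^ k * exp (- \<kappa> * z\<^sup>2))"
      proof (cases "x \<in> {a..b}")
        case False
        then show ?thesis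
          using G0 by (simp add: F_def H_def x_def n_def)
      next
        case True
        have "\<bar>p x / p x0\<bar> ^ n \<le> exp (- \<kappa> * (x - x0)\<^sup>2) ^ n"
          using \<kappa>(2)[OF True] by (intro power_mono) auto
        also have "\<dots> = exp (- \<kappa> * z\<^sup>2)"
          unfolding exp_of_nat_mult[symmetric] by (simp add: x_def power_divide n_def del: of_nat_Suc power_Suc)
        finally have "\<bar>p x / p x0\<bar> ^ n \<le> exp (- \<kappa> * z\<^sup>2)" .
        then have "\<bar>g x\<bar> * \<bar>p x / p x0\<bar> ^ n \<le> G * exp (- \<kappa> * z\<^sup>2)"
          using G[OF True] G0 by (intro mult_mono) auto
        then have "\<bar>z\<bar> ^ k * (\<bar>g x\<bar> * \<bar>p x / p x0\<bar> ^ n) \<le> \<bar>z\<bar> ^ k * (G * exp (- \<kappa> * z\<^sup>2))"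
          by (intro mult_left_mono) auto
        moreover have "norm (F n z) = \<bar>z\<bar> ^ k * (\<bar>g x\<bar> * \<bar>p x / p x0\<bar> ^ n)"
          using True by (simp add: F_def H_def x_def abs_mult power_abs)
        moreover have "\<bar>z\<bar> ^ k * (G * exp (- \<kappa> * z\<^sup>2)) = G * (\<bar>z\<bar> ^ k * exp (- \<kappa> * z\<^sup>2))"
          by (rule mult.left_commute)
        ultimately have "norm (F n z) \<le> G * (\<bar>z\<bar> ^ k * exp (- \<kappa> * z\<^sup>2))"
          by linarith
        then show ?thesis
          by (simp only: n_def)
      qed
    qed
  qed
  moreover have "(\<integral>z. f z \<partial>lborel) = g x0 * gaussian_moment c k"
    by (simp add: f_def gaussian_moment_def)
  ultimately have "(\<lambda>n. \<integral>z. F n z \<partial>lborel) \<longlonglongrightarrow> g x0 * gaussian_moment c k"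
    by (simp add: LIMSEQ_imp_Suc)
  moreover have "\<forall>\<^sub>F n in sequentially. (\<integral>z. F n z \<partial>lborel) =
      sqrt (real n) ^ (k + 1) * integral {a..b} (\<lambda>x. (x - x0) ^ k * g x * (p x / p x0) ^ n)"
    using eventually_gt_at_top[of 0] by eventually_elim (rule eq[symmetric])
  ultimately show ?thesis
    by (rule Lim_transform_eventually)
qed

text \<open>
  At a critical point the logarithm has no linear term; the rule of l'Hopital yields the quadratic
  coefficient.
\<close>
lemma log_quotient_tendsto:
  fixes p :: "real \<Rightarrow> real"
  assumes p': "\<And>x. (p has_real_derivative p' x) (at x)"
    and p'': "(p' has_real_derivative p2) (at x0)"
    and x0: "p' x0 = 0" "p x0 > 0"
  shows "((\<lambda>x. ln (p x / p x0) / (x - x0)\<^sup>2) \<longlongrightarrow> p2 / (2 * p x0)) (at x0)"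
proof -
  have cont: "p \<midarrow>x0\<rightarrow> p x0"
    using DERIV_isCont[OF p'] by (simp add: isCont_def)
  then have pos: "\<forall>\<^sub>F x in at x0. p x > 0"
    using x0(2) by (rule order_tendstoD(1))
  have ne: "\<forall>\<^sub>F x in at x0. x \<noteq> x0"
    by (simp add: eventually_at_filter)
  show ?thesis
  proof (rule lhopital[where f' = "\<lambda>x. p' x / p x" and g' = "\<lambda>x. 2 * (x - x0)"])
    have "((\<lambda>x. ln (p x / p x0)) \<longlongrightarrow> ln (p x0 / p x0)) (at x0)"
      using x0 by (intro tendsto_intros cont) auto
    then show "((\<lambda>x. ln (p x / p x0)) \<longlongrightarrow> 0) (at x0)"
      using x0 by simp
    have "((\<lambda>x. (x - x0)\<^sup>2) \<longlongrightarrow> (x0 - x0)\<^sup>2) (at x0)"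
      by (intro tendsto_intros)
    then show "((\<lambda>x. (x - x0)\<^sup>2) \<longlongrightarrow> 0) (at x0)"
      by simp
    show "\<forall>\<^sub>F x in at x0. (x - x0)\<^sup>2 \<noteq> 0" "\<forall>\<^sub>F x in at x0. 2 * (x - x0) \<noteq> 0"
      using ne by (auto elim: eventually_mono)
    show "\<forall>\<^sub>F x in at x0. ((\<lambda>x. ln (p x / p x0)) has_real_derivative p' x / p x) (at x)"
      using pos
    proof eventually_elim
      case (elim x)
      have "((\<lambda>x. ln (p x / p x0)) has_real_derivative 1 / (p x / p x0) * (p' x / p x0)) (at x)"
        using elim x0 by (intro DERIV_chain2[OF DERIV_ln_divide] DERIV_cdivide p') auto
      then show ?case
        using x0 by simp
    qed
    show "\<forall>\<^sub>F x in at x0. ((\<lambda>x. (x - x0)\<^sup>2) has_real_derivative 2 * (x - x0)) (at x)"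
      by (intro always_eventually allI) (auto intro!: derivative_eq_intros)
    have "((\<lambda>x. ((p' x - p' x0) / (x - x0)) / (2 * p x)) \<longlongrightarrow> p2 / (2 * p x0)) (at x0)"
      using p'' x0 by (intro tendsto_intros cont) (auto simp: has_field_derivative_iff)
    then show "((\<lambda>x. p' x / p x / (2 * (x - x0))) \<longlongrightarrow> p2 / (2 * p x0)) (at x0)"
      using x0 by (simp add: ac_simps)
  qed
qed

lemma continuous_on_difference_quotient:
  fixes u :: "real \<Rightarrow> real"
  assumes "continuous_on S u" "(u has_real_derivative u') (at x0)" "u x0 = 0"
  shows "continuous_on S (\<lambda>x. if x = x0 then u' else u x / (x - x0))"
proof -
  have "((\<lambda>x. if x = x0 then u' else u x / (x - x0)) \<longlongrightarrow> (if x = x0 then u' else u x / (x - x0))) (at x within S)"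
    if x: "x \<in> S" for x
  proof (cases "x = x0")
    case True
    have "((\<lambda>x. (u x - u x0) / (x - x0)) \<longlongrightarrow> u') (at x0)"
      using assms(2) by (simp add: has_field_derivative_iff)
    then have "((\<lambda>x. if x = x0 then u' else u x / (x - x0)) \<longlongrightarrow> u') (at x0)"
      by (rule Lim_transform_eventually) (auto simp: eventually_at_filter assms(3))
    then show ?thesis
      using True by (auto intro: tendsto_within_subset)
  next
    case False
    have "((\<lambda>x. u x / (x - x0)) \<longlongrightarrow> u x / (x - x0)) (at x within S)"
      using False assms(1) x by (intro tendsto_intros) (auto simp: continuous_on_def)
    moreover have "\<forall>\<^sub>F x in at x within S. x \<noteq> x0"
      using tendsto_imp_eventually_ne[OF tendsto_ident_at False, of S] .
    then have "\<forall>\<^sub>F z in at x within S. u z / (z - x0) = (if z = x0 then u' else u z / (z - x0))"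
      by (rule eventually_mono) simp
    ultimately show ?thesis
      using False by (simp add: Lim_transform_eventually)
  qed
  then show ?thesis
    by (simp add: continuous_on_def)
qed

text \<open>
  The two quotients are the normalised mean and second moment of the centred total spin when
  \<open>n = j + 3\<close>, see \<open>sum_config_weight_moments\<close>. Since \<open>A 1\<close> vanishes at the maximizer, each factor
  \<open>A 1\<close> costs a factor \<open>x - x0\<close>, of order \<open>1 / sqrt j\<close>. Thus the square of \<open>A 1\<close> compensates its
  coefficient of order \<open>j\<^sup>2\<close> down to order \<open>j\<close> and gives the term with \<open>1 / c\<close>, while a single factor
  is an odd Gaussian moment in the limit and disappears.
\<close>
lemma laplace_mean_variance:
  fixes A Q :: "nat \<Rightarrow> real \<Rightarrow> real"
  assumes cont: "\<And>k. continuous_on {a..b} (A k)" "\<And>k. continuous_on {a..b} (Q k)"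
    and x0: "a < x0" "x0 < b" "A 0 x0 > 0" "Q 0 x0 \<noteq> 0"
    and max: "\<And>x. x \<in> {a..b} \<Longrightarrow> x \<noteq> x0 \<Longrightarrow> \<bar>A 0 x\<bar> < A 0 x0"
    and peano: "((\<lambda>x. ln (A 0 x / A 0 x0) / (x - x0)\<^sup>2) \<longlongrightarrow> - c / 2) (at x0)" and c: "c > 0"
    and A1: "(A 1 has_real_derivative A1') (at x0)" "A 1 x0 = 0"
  defines "I \<equiv> \<lambda>f. integral {a..b} f"
  shows "(\<lambda>j. (real (j + 2) * I (\<lambda>x. A 0 x ^ (j + 1) * A 1 x * Q 0 x) + I (\<lambda>x. A 0 x ^ (j + 2) * Q 1 x))
      / (sqrt (real (j + 3)) * I (\<lambda>x. A 0 x ^ (j + 2) * Q 0 x))) \<longlonglongrightarrow> 0"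
    and "(\<lambda>j. (real (j + 2) * (real (j + 1) * I (\<lambda>x. A 0 x ^ j * (A 1 x)\<^sup>2 * Q 0 x)
        + I (\<lambda>x. A 0 x ^ (j + 1) * A 2 x * Q 0 x) + 2 * I (\<lambda>x. A 0 x ^ (j + 1) * A 1 x * Q 1 x))
        + I (\<lambda>x. A 0 x ^ (j + 2) * Q 2 x))
      / (real (j + 3) * I (\<lambda>x. A 0 x ^ (j + 2) * Q 0 x)))
      \<longlonglongrightarrow> A 2 x0 / A 0 x0 + (A1' / A 0 x0)\<^sup>2 / c"
proof -
  \<comment> \<open>the continuous cofactor of \<open>x - x0\<close> in \<open>A 1\<close>\<close>
  define u where "u = (\<lambda>x. if x = x0 then A1' else A 1 x / (x - x0))"
  have u: "continuous_on {a..b} u" "A 1 x = (x - x0) * u x" "u x0 = A1'" for x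
    unfolding u_def using continuous_on_difference_quotient[OF cont(1) A1] A1(2) by auto
  define p0 where "p0 = A 0 x0"
  have p0: "p0 > 0" using x0 by (simp add: p0_def)
  define L where "L = (\<lambda>k g j. sqrt (real j) ^ (k + 1) * I (\<lambda>x. (x - x0) ^ k * g x * (A 0 x / p0) ^ j))"
  have lim: "(\<lambda>j. L k g j) \<longlonglongrightarrow> g x0 * gaussian_moment c k" if "continuous_on {a..b} g" for k g
    unfolding L_def I_def p0_def
    by (rule laplace_moment[OF cont(1) that x0(1,2,3) max peano c])
  have I_eq: "I f = p0 ^ j * L k g j / sqrt (real j) ^ (k + 1)"
    if "\<And>x. f x = A 0 x ^ j * ((x - x0) ^ k * g x)" "j > 0" for f g k j
  proof -
    have "f = (\<lambda>x. p0 ^ j * ((x - x0) ^ k * g x * (A 0 x / p0) ^ j))"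
      using p0 by (auto simp: that(1) power_divide fun_eq_iff)
    then have "I f = p0 ^ j * I (\<lambda>x. (x - x0) ^ k * g x * (A 0 x / p0) ^ j)"
      by (simp add: I_def)
    then show ?thesis
      using that(2) by (simp add: L_def)
  qed
  let ?G = "sqrt (2 * pi / c)"
  note mom = gaussian_moment_values[OF c]
  define a0 where "a0 = L 0 (\<lambda>x. A 0 x ^ 2 * Q 0 x)"
  define a1 where "a1 = L 1 (\<lambda>x. A 0 x * u x * Q 0 x)"
  define b0 where "b0 = L 0 (\<lambda>x. A 0 x ^ 2 * Q 1 x)"
  define a2 where "a2 = L 2 (\<lambda>x. u x ^ 2 * Q 0 x)"
  define r0 where "r0 = L 0 (\<lambda>x. A 0 x * A 2 x * Q 0 x)"
  define b1 where "b1 = L 1 (\<lambda>x. A 0 x * u x * Q 1 x)"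
  define q0 where "q0 = L 0 (\<lambda>x. A 0 x ^ 2 * Q 2 x)"
  have la0: "a0 \<longlonglongrightarrow> p0\<^sup>2 * Q 0 x0 * ?G"
    using lim[of "\<lambda>x. A 0 x ^ 2 * Q 0 x" 0] cont unfolding a0_def p0_def mom by (simp add: continuous_intros)
  have la1: "a1 \<longlonglongrightarrow> 0"
    using lim[of "\<lambda>x. A 0 x * u x * Q 0 x" 1] cont u(1) unfolding a1_def mom by (simp add: continuous_intros)
  have lb0: "b0 \<longlonglongrightarrow> p0\<^sup>2 * Q 1 x0 * ?G"
    using lim[of "\<lambda>x. A 0 x ^ 2 * Q 1 x" 0] cont unfolding b0_def p0_def mom by (simp add: continuous_intros)
  have la2: "a2 \<longlonglongrightarrow> A1'\<^sup>2 * Q 0 x0 * (?G / c)"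
    using lim[of "\<lambda>x. u x ^ 2 * Q 0 x" 2] cont u unfolding a2_def mom by (simp add: continuous_intros)
  have lr0: "r0 \<longlonglongrightarrow> p0 * A 2 x0 * Q 0 x0 * ?G"
    using lim[of "\<lambda>x. A 0 x * A 2 x * Q 0 x" 0] cont unfolding r0_def p0_def mom by (simp add: continuous_intros)
  have lb1: "b1 \<longlonglongrightarrow> 0"
    using lim[of "\<lambda>x. A 0 x * u x * Q 1 x" 1] cont u(1) unfolding b1_def mom by (simp add: continuous_intros)
  have lq0: "q0 \<longlonglongrightarrow> p0\<^sup>2 * Q 2 x0 * ?G"
    using lim[of "\<lambda>x. A 0 x ^ 2 * Q 2 x" 0] cont unfolding q0_def p0_def mom by (simp add: continuous_intros)
  have Gpos: "p0\<^sup>2 * Q 0 x0 * ?G \<noteq> 0"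
    using p0 x0 c by simp
  have Ia0: "I (\<lambda>x. A 0 x ^ (j + 2) * Q 0 x) = p0 ^ j * a0 j / sqrt (real j)" if "j > 0" for j
  proof -
    have "I (\<lambda>x. A 0 x ^ (j + 2) * Q 0 x) = p0 ^ j * L 0 (\<lambda>x. A 0 x ^ 2 * Q 0 x) j / sqrt (real j) ^ (0 + 1)"
      by (rule I_eq) (use that in \<open>simp_all add: u(2)[unfolded One_nat_def] power_add power2_eq_square power_mult_distrib mult_ac\<close>)
    then show ?thesis
      using that by (simp add: a0_def numeral_3_eq_3)
  qed
  have Ia1: "I (\<lambda>x. A 0 x ^ (j + 1) * A 1 x * Q 0 x) = p0 ^ j * a1 j / real j" if "j > 0" for j
  proof -
    have "I (\<lambda>x. A 0 x ^ (j + 1) * A 1 x * Q 0 x) = p0 ^ j * L 1 (\<lambda>x. A 0 x * u x * Q 0 x) j / sqrt (real j) ^ (1 + 1)"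
      by (rule I_eq) (use that in \<open>simp_all add: u(2)[unfolded One_nat_def] power_add power2_eq_square power_mult_distrib mult_ac\<close>)
    then show ?thesis
      using that by (simp add: a1_def numeral_3_eq_3)
  qed
  have Ib0: "I (\<lambda>x. A 0 x ^ (j + 2) * Q 1 x) = p0 ^ j * b0 j / sqrt (real j)" if "j > 0" for j
  proof -
    have "I (\<lambda>x. A 0 x ^ (j + 2) * Q 1 x) = p0 ^ j * L 0 (\<lambda>x. A 0 x ^ 2 * Q 1 x) j / sqrt (real j) ^ (0 + 1)"
      by (rule I_eq) (use that in \<open>simp_all add: u(2)[unfolded One_nat_def] power_add power2_eq_square power_mult_distrib mult_ac\<close>)
    then show ?thesis
      using that by (simp add: b0_def numeral_3_eq_3)
  qed
  have Ia2: "I (\<lambda>x. A 0 x ^ j * (A 1 x)\<^sup>2 * Q 0 x) = p0 ^ j * a2 j / (real j * sqrt (real j))" if "j > 0" for j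
  proof -
    have "I (\<lambda>x. A 0 x ^ j * (A 1 x)\<^sup>2 * Q 0 x) = p0 ^ j * L 2 (\<lambda>x. u x ^ 2 * Q 0 x) j / sqrt (real j) ^ (2 + 1)"
      by (rule I_eq) (use that in \<open>simp_all add: u(2)[unfolded One_nat_def] power_add power2_eq_square power_mult_distrib mult_ac\<close>)
    then show ?thesis
      using that by (simp add: a2_def numeral_3_eq_3)
  qed
  have Ir0: "I (\<lambda>x. A 0 x ^ (j + 1) * A 2 x * Q 0 x) = p0 ^ j * r0 j / sqrt (real j)" if "j > 0" for j
  proof -
    have "I (\<lambda>x. A 0 x ^ (j + 1) * A 2 x * Q 0 x) = p0 ^ j * L 0 (\<lambda>x. A 0 x * A 2 x * Q 0 x) j / sqrt (real j) ^ (0 + 1)"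
      by (rule I_eq) (use that in \<open>simp_all add: u(2)[unfolded One_nat_def] power_add power2_eq_square power_mult_distrib mult_ac\<close>)
    then show ?thesis
      using that by (simp add: r0_def numeral_3_eq_3)
  qed
  have Ib1: "I (\<lambda>x. A 0 x ^ (j + 1) * A 1 x * Q 1 x) = p0 ^ j * b1 j / real j" if "j > 0" for j
  proof -
    have "I (\<lambda>x. A 0 x ^ (j + 1) * A 1 x * Q 1 x) = p0 ^ j * L 1 (\<lambda>x. A 0 x * u x * Q 1 x) j / sqrt (real j) ^ (1 + 1)"
      by (rule I_eq) (use that in \<open>simp_all add: u(2)[unfolded One_nat_def] power_add power2_eq_square power_mult_distrib mult_ac\<close>)
    then show ?thesis
      using that by (simp add: b1_def numeral_3_eq_3)
  qed
  have Iq0: "I (\<lambda>x. A 0 x ^ (j + 2) * Q 2 x) = p0 ^ j * q0 j / sqrt (real j)" if "j > 0" for j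
  proof -
    have "I (\<lambda>x. A 0 x ^ (j + 2) * Q 2 x) = p0 ^ j * L 0 (\<lambda>x. A 0 x ^ 2 * Q 2 x) j / sqrt (real j) ^ (0 + 1)"
      by (rule I_eq) (use that in \<open>simp_all add: u(2)[unfolded One_nat_def] power_add power2_eq_square power_mult_distrib mult_ac\<close>)
    then show ?thesis
      using that by (simp add: q0_def numeral_3_eq_3)
  qed
  have "(\<lambda>j. (real (j + 2) / real j * a1 j + b0 j / sqrt (real j)) / (sqrt (real (j + 3)) / sqrt (real j) * a0 j))
      \<longlonglongrightarrow> (1 * 0 + (p0\<^sup>2 * Q 1 x0 * ?G) * 0) / (1 * (p0\<^sup>2 * Q 0 x0 * ?G))"
    unfolding divide_inverse[of "b0 _"]
    by (intro tendsto_intros la1 lb0 la0) (use Gpos in \<open>simp_all, real_asymp+\<close>)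
  moreover have "\<forall>\<^sub>F j in sequentially.
      (real (j + 2) / real j * a1 j + b0 j / sqrt (real j)) / (sqrt (real (j + 3)) / sqrt (real j) * a0 j) =
      (real (j + 2) * I (\<lambda>x. A 0 x ^ (j + 1) * A 1 x * Q 0 x) + I (\<lambda>x. A 0 x ^ (j + 2) * Q 1 x))
      / (sqrt (real (j + 3)) * I (\<lambda>x. A 0 x ^ (j + 2) * Q 0 x))"
    using eventually_gt_at_top[of 0]
  proof eventually_elim
    case (elim j)
    have "(real (j + 2) * I (\<lambda>x. A 0 x ^ (j + 1) * A 1 x * Q 0 x) + I (\<lambda>x. A 0 x ^ (j + 2) * Q 1 x))
      / (sqrt (real (j + 3)) * I (\<lambda>x. A 0 x ^ (j + 2) * Q 0 x)) =
      (p0 ^ j * (real (j + 2) / real j * a1 j + b0 j / sqrt (real j))) /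
      (p0 ^ j * (sqrt (real (j + 3)) / sqrt (real j) * a0 j))"
      unfolding Ia0[OF elim] Ia1[OF elim] Ib0[OF elim] by (simp add: algebra_simps)
    then show ?case
      using p0 by simp
  qed
  ultimately show "(\<lambda>j. (real (j + 2) * I (\<lambda>x. A 0 x ^ (j + 1) * A 1 x * Q 0 x) + I (\<lambda>x. A 0 x ^ (j + 2) * Q 1 x))
      / (sqrt (real (j + 3)) * I (\<lambda>x. A 0 x ^ (j + 2) * Q 0 x))) \<longlonglongrightarrow> 0"
    by (simp add: Lim_transform_eventually)
  have "(\<lambda>j. (real (j + 2) * real (j + 1) / (real j * real (j + 3)) * a2 j + real (j + 2) / real (j + 3) * r0 j
        + 2 * real (j + 2) / (sqrt (real j) * real (j + 3)) * b1 j + 1 / real (j + 3) * q0 j) / a0 j)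
      \<longlonglongrightarrow> (1 * (A1'\<^sup>2 * Q 0 x0 * (?G / c)) + 1 * (p0 * A 2 x0 * Q 0 x0 * ?G) + 0 * 0
          + 0 * (p0\<^sup>2 * Q 2 x0 * ?G)) / (p0\<^sup>2 * Q 0 x0 * ?G)"
    by (intro tendsto_divide tendsto_add tendsto_mult la2 lr0 lb1 lq0 la0 Gpos) real_asymp+
  moreover have "\<forall>\<^sub>F j in sequentially.
     (real (j + 2) * real (j + 1) / (real j * real (j + 3)) * a2 j + real (j + 2) / real (j + 3) * r0 j
        + 2 * real (j + 2) / (sqrt (real j) * real (j + 3)) * b1 j + 1 / real (j + 3) * q0 j) / a0 j =
     (real (j + 2) * (real (j + 1) * I (\<lambda>x. A 0 x ^ j * (A 1 x)\<^sup>2 * Q 0 x)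
        + I (\<lambda>x. A 0 x ^ (j + 1) * A 2 x * Q 0 x) + 2 * I (\<lambda>x. A 0 x ^ (j + 1) * A 1 x * Q 1 x))
        + I (\<lambda>x. A 0 x ^ (j + 2) * Q 2 x))
      / (real (j + 3) * I (\<lambda>x. A 0 x ^ (j + 2) * Q 0 x))"
    using eventually_gt_at_top[of 0]
  proof eventually_elim
    case (elim j)
    define \<rho> where "\<rho> = sqrt (real j)"
    have \<rho>: "\<rho> > 0" "real j = \<rho> * \<rho>"
      using elim by (simp_all add: \<rho>_def)
    define k where "k = real (j + 3)"
    have k: "k > 0" by (simp add: k_def)
    have "(real (j + 2) * (real (j + 1) * I (\<lambda>x. A 0 x ^ j * (A 1 x)\<^sup>2 * Q 0 x)
        + I (\<lambda>x. A 0 x ^ (j + 1) * A 2 x * Q 0 x) + 2 * I (\<lambda>x. A 0 x ^ (j + 1) * A 1 x * Q 1 x))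
        + I (\<lambda>x. A 0 x ^ (j + 2) * Q 2 x)) = (p0 ^ j * k / \<rho>) *
        (real (j + 2) * real (j + 1) / (real j * k) * a2 j + real (j + 2) / k * r0 j
        + 2 * real (j + 2) / (\<rho> * k) * b1 j + 1 / k * q0 j)"
      unfolding Ia2[OF elim] Ir0[OF elim] Ib1[OF elim] Iq0[OF elim] \<rho>_def[symmetric] distrib_left
      unfolding \<rho>(2)
      using \<rho>(1) k by (simp add: field_simps)
    moreover have "real (j + 3) * I (\<lambda>x. A 0 x ^ (j + 2) * Q 0 x) = (p0 ^ j * k / \<rho>) * a0 j"
      unfolding Ia0[OF elim] by (simp add: k_def \<rho>_def)
    moreover have ne: "p0 ^ j * k / \<rho> \<noteq> 0"
      using p0 k \<rho> by simp
    ultimately show ?case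
      unfolding k_def[symmetric] \<rho>_def[symmetric] by (simp only: mult_divide_mult_cancel_left[OF ne])
  qed
  moreover have "(1 * (A1'\<^sup>2 * Q 0 x0 * (?G / c)) + 1 * (p0 * A 2 x0 * Q 0 x0 * ?G) + 0 * 0
          + 0 * (p0\<^sup>2 * Q 2 x0 * ?G)) / (p0\<^sup>2 * Q 0 x0 * ?G) = A 2 x0 / A 0 x0 + (A1' / A 0 x0)\<^sup>2 / c"
  proof -
    have "?G > 0" using c by simp
    then show ?thesis
      unfolding p0_def[symmetric] using p0 x0(4) c by (simp add: field_simps power2_eq_square)
  qed
  ultimately show "(\<lambda>j. (real (j + 2) * (real (j + 1) * I (\<lambda>x. A 0 x ^ j * (A 1 x)\<^sup>2 * Q 0 x)
        + I (\<lambda>x. A 0 x ^ (j + 1) * A 2 x * Q 0 x) + 2 * I (\<lambda>x. A 0 x ^ (j + 1) * A 1 x * Q 1 x))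
        + I (\<lambda>x. A 0 x ^ (j + 2) * Q 2 x))
      / (real (j + 3) * I (\<lambda>x. A 0 x ^ (j + 2) * Q 0 x)))
      \<longlonglongrightarrow> A 2 x0 / A 0 x0 + (A1' / A 0 x0)\<^sup>2 / c"
    by (simp only:) (rule Lim_transform_eventually)
qed

section \<open>The variational formula for the pressure\<close>

lemma site_weight_eq:
  "site_weight s B d \<phi> = exp B * amplitude s 1 \<phi> ^ d + exp (- B) * amplitude s (- 1) \<phi> ^ d"
  by (simp add: site_moment_def)

lemma site_weight_pos:
  "amplitude s 1 \<phi> > 0 \<Longrightarrow> amplitude s (- 1) \<phi> > 0 \<Longrightarrow> site_weight s B d \<phi> > 0"
  unfolding site_weight_eq by (intro add_pos_pos mult_pos_pos) auto

text \<open>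
  Exchanging the sine and the cosine up to sign, which is the reflection of \<open>\<phi>\<close> in a diagonal,
  increases both amplitudes in absolute value when their signs differ: then the sine is the larger
  of the two coordinates, and the swap gives it the weight \<open>1\<close> instead of \<open>s\<close>.
\<close>
lemma amplitude_swap:
  assumes "0 \<le> s" "s < 1" "\<phi> \<in> {-(pi/2)..pi/2}"
    and mixed: "amplitude s 1 \<phi> * amplitude s (- 1) \<phi> \<le> 0"
  obtains \<phi>' where "\<phi>' \<in> {-(pi/2)..pi/2}"
    "\<bar>amplitude s 1 \<phi>\<bar> < amplitude s 1 \<phi>'" "\<bar>amplitude s (- 1) \<phi>\<bar> < amplitude s (- 1) \<phi>'"
proof -
  define c S where "c = cos \<phi>" and "S = sin \<phi>"
  have c: "c \<ge> 0"
    using assms(3) unfolding c_def by (intro cos_ge_zero) auto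
  have "c\<^sup>2 \<le> (s * \<bar>S\<bar>)\<^sup>2"
    using mixed by (simp add: amplitude_def c_def S_def power2_eq_square algebra_simps)
  then have le: "c \<le> s * \<bar>S\<bar>"
    by (rule power2_le_imp_le) (simp add: assms(1))
  have S0: "S \<noteq> 0"
  proof
    assume "S = 0"
    with le c have "c = 0" by simp
    then show False
      using \<open>S = 0\<close> sin_cos_squared_add[of \<phi>] by (simp add: c_def S_def)
  qed
  have lt: "c < \<bar>S\<bar>"
  proof -
    have "s * \<bar>S\<bar> < 1 * \<bar>S\<bar>"
      using S0 assms(2) by (intro mult_strict_right_mono) auto
    then show ?thesis using le by simp
  qed
  have key: "\<bar>c + s * \<tau> * S\<bar> < \<bar>S\<bar> + s * (\<tau> * sgn S) * c" if tau: "\<tau> \<in> {-1, 1}" for \<tau>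
  proof -
    have "(\<bar>S\<bar> - c) * (1 - s) > 0" "(\<bar>S\<bar> + c) * (1 - s) > 0"
      using lt c assms(2) by (auto intro!: mult_pos_pos)
    then have 1: "c + s * \<bar>S\<bar> < \<bar>S\<bar> + s * c" "s * \<bar>S\<bar> - c < \<bar>S\<bar> - s * c"
      by (simp_all add: algebra_simps)
    have 2: "s * c \<ge> 0" "c + s * \<bar>S\<bar> \<ge> 0"
      using c assms(1) by simp_all
    consider "\<tau> * sgn S = 1" "\<tau> * S = \<bar>S\<bar>" | "\<tau> * sgn S = - 1" "\<tau> * S = - \<bar>S\<bar>"
      using tau S0 by (cases "S > 0") auto
    then show ?thesis
    proof cases
      case 1
      then show ?thesis using \<open>c + s * \<bar>S\<bar> < \<bar>S\<bar> + s * c\<close> 2 by (simp add: mult.assoc)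
    next
      case 2
      then show ?thesis using \<open>s * \<bar>S\<bar> - c < \<bar>S\<bar> - s * c\<close> le by (simp add: mult.assoc)
    qed
  qed
  define \<phi>' where "\<phi>' = (if S > 0 then pi/2 - \<phi> else - (pi/2) - \<phi>)"
  have amp: "amplitude s \<tau> \<phi>' = \<bar>S\<bar> + s * (\<tau> * sgn S) * c" for \<tau>
  proof (cases "S > 0")
    case True
    then show ?thesis by (simp add: \<phi>'_def amplitude_def cos_diff sin_diff c_def S_def)
  next
    case False
    then show ?thesis using S0 by (simp add: \<phi>'_def amplitude_def cos_diff sin_diff c_def S_def)
  qed
  have "\<phi>' \<in> {-(pi/2)..pi/2}"
  proof (cases "S > 0")
    case True
    then have "\<phi> > 0"
      using assms(3) sin_ge_zero[of "- \<phi>"] pi_gt_zero unfolding S_def by (cases "\<phi> > 0") auto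
    then show ?thesis
      using True assms(3) by (auto simp: \<phi>'_def)
  next
    case False
    then have "\<phi> < 0"
      using assms(3) sin_ge_zero[of "\<phi>"] S0 pi_gt_zero unfolding S_def by (cases "\<phi> < 0") auto
    then show ?thesis
      using False assms(3) by (auto simp: \<phi>'_def)
  qed
  moreover have "\<bar>amplitude s 1 \<phi>\<bar> < amplitude s 1 \<phi>'" "\<bar>amplitude s (- 1) \<phi>\<bar> < amplitude s (- 1) \<phi>'"
    using key[of 1] key[of "- 1"] unfolding amp by (simp_all add: amplitude_def c_def S_def)
  ultimately show ?thesis ..
qed

text \<open>
  At an angle where the amplitudes do not have the same strict sign the swapped angle has a larger
  weight, so such an angle is not a maximizer of the absolute value. On the half circle the sum of
  the amplitudes is nonnegative, hence both are positive.
\<close>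
lemma maximizer_amplitudes_pos:
  assumes "0 \<le> s" "s < 1" "d \<ge> 1" "\<phi> \<in> {-(pi/2)..pi/2}"
    and max: "\<And>\<phi>'. \<phi>' \<in> {-(pi/2)..pi/2} \<Longrightarrow> \<bar>site_weight s B d \<phi>'\<bar> \<le> \<bar>site_weight s B d \<phi>\<bar>"
  shows "amplitude s 1 \<phi> > 0" "amplitude s (- 1) \<phi> > 0" "\<phi> \<in> {-(pi/2)<..<pi/2}"
proof -
  have pos: "amplitude s 1 \<phi> * amplitude s (- 1) \<phi> > 0"
  proof (rule ccontr)
    assume "\<not> ?thesis"
    then have "amplitude s 1 \<phi> * amplitude s (- 1) \<phi> \<le> 0"
      by simp
    then obtain \<phi>' where \<phi>': "\<phi>' \<in> {-(pi/2)..pi/2}"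
      "\<bar>amplitude s 1 \<phi>\<bar> < amplitude s 1 \<phi>'" "\<bar>amplitude s (- 1) \<phi>\<bar> < amplitude s (- 1) \<phi>'"
      using amplitude_swap[OF assms(1,2,4)] by blast
    have "\<bar>site_weight s B d \<phi>\<bar> \<le> exp B * \<bar>amplitude s 1 \<phi>\<bar> ^ d + exp (- B) * \<bar>amplitude s (- 1) \<phi>\<bar> ^ d"
      unfolding site_weight_eq by (rule order_trans[OF abs_triangle_ineq]) (simp add: abs_mult power_abs)
    also have "\<dots> < exp B * amplitude s 1 \<phi>' ^ d + exp (- B) * amplitude s (- 1) \<phi>' ^ d"
      using \<phi>' assms(3) by (intro add_strict_mono mult_strict_left_mono power_strict_mono) auto
    also have "\<dots> \<le> \<bar>site_weight s B d \<phi>'\<bar>"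
      unfolding site_weight_eq by simp
    finally show False
      using max[OF \<phi>'(1)] by simp
  qed
  have "amplitude s 1 \<phi> + amplitude s (- 1) \<phi> \<ge> 0"
    using assms(4) cos_ge_zero[of \<phi>] by (simp add: amplitude_def)
  then show *: "amplitude s 1 \<phi> > 0" "amplitude s (- 1) \<phi> > 0"
    using pos by (auto simp: zero_less_mult_iff)
  have "cos \<phi> \<noteq> 0"
    using * by (auto simp: amplitude_def)
  then have "\<phi> \<noteq> pi/2" "\<phi> \<noteq> -(pi/2)"
    using cos_pi_half cos_minus[of "pi/2"] by metis+
  then show "\<phi> \<in> {-(pi/2)<..<pi/2}"
    using assms(4) by auto
qed

lemma exists_maximizer:
  obtains \<phi> where "\<phi> \<in> {-(pi/2)..pi/2}"
    "\<And>\<phi>'. \<phi>' \<in> {-(pi/2)..pi/2} \<Longrightarrow> \<bar>site_weight s B d \<phi>'\<bar> \<le> \<bar>site_weight s B d \<phi>\<bar>"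
proof -
  have "continuous_on {-(pi/2)..pi/2} (\<lambda>\<phi>. \<bar>site_weight s B d \<phi>\<bar>)"
    by (intro continuous_intros continuous_on_site_moment)
  then show ?thesis
    using continuous_attains_sup[of "{-(pi/2)..pi/2}" "\<lambda>\<phi>. \<bar>site_weight s B d \<phi>\<bar>"] that
    by (auto)
qed

lemma f_fun_discriminant_pos:
  fixes \<beta> t :: real
  assumes "\<beta> \<ge> 0" "t \<in> {0..1}"
  shows "1 + (exp (-4 * \<beta>) - 1) * (1 - 2 * t)\<^sup>2 > 0"
proof -
  have "(1 - 2 * t)\<^sup>2 \<le> 1"
    using assms(2) by (auto simp: abs_le_square_iff[of _ 1, simplified, symmetric])
  moreover have "exp (-4 * \<beta>) \<le> 1"
    using assms(1) by simp
  ultimately have "(1 - exp (-4 * \<beta>)) * (1 - 2 * t)\<^sup>2 \<le> (1 - exp (-4 * \<beta>)) * 1"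
    by (intro mult_left_mono) auto
  then have "1 + (exp (-4 * \<beta>) - 1) * (1 - 2 * t)\<^sup>2 \<ge> exp (-4 * \<beta>)"
    by (simp add: algebra_simps)
  then show ?thesis
    by (meson exp_gt_zero less_le_trans)
qed

lemma f_fun_pos:
  assumes "\<beta> \<ge> 0" "t \<in> {0..1/2}"
  shows "f_fun \<beta> t > 0"
  unfolding f_fun_def using assms f_fun_discriminant_pos[of \<beta> t]
  by (intro divide_pos_pos add_nonneg_pos) auto

text \<open>
  The number \<open>f_fun \<beta> t\<close> is the positive root of a quadratic equation, the stationarity condition in
  \<open>r\<close> of the function \<open>ratio_rate a t r\<close> below.
\<close>
lemma f_fun_quadratic:
  assumes "\<beta> \<ge> 0" "t \<in> {0..1/2}"
  defines "a \<equiv> exp (- 2 * \<beta>)" and "f \<equiv> f_fun \<beta> t"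
  shows "t * (1 - 2 * a * f + f\<^sup>2) = f * (f - a)"
proof -
  define R where "R = sqrt (1 + (exp (-4 * \<beta>) - 1) * (1 - 2 * t)\<^sup>2)"
  have a2: "exp (-4 * \<beta>) = a\<^sup>2"
    unfolding a_def by (simp add: power2_eq_square exp_add[symmetric])
  have R: "R\<^sup>2 = 1 + (a\<^sup>2 - 1) * (1 - 2 * t)\<^sup>2"
    unfolding R_def a2[symmetric] using f_fun_discriminant_pos[of \<beta> t] assms by simp
  have t: "1 - t > 0" using assms by auto
  have "2 * (1 - t) * f = a * (1 - 2 * t) + R"
    using t by (simp add: f_def f_fun_def R_def a_def)
  then have "(2 * (1 - t) * f - a * (1 - 2 * t))\<^sup>2 = 1 + (a\<^sup>2 - 1) * (1 - 2 * t)\<^sup>2"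
    using R by simp
  then have "4 * (1 - t) * ((1 - t) * f\<^sup>2 - a * (1 - 2 * t) * f - t) = 0"
    by (simp add: power2_eq_square algebra_simps)
  then have "(1 - t) * f\<^sup>2 - a * (1 - 2 * t) * f - t = 0"
    using t by simp
  then show ?thesis
    by (simp add: power2_eq_square algebra_simps)
qed

lemma quadratic_form_pos:
  fixes a r :: real
  assumes "0 < a" "a < 1"
  shows "1 - 2 * a * r + r\<^sup>2 > 0"
proof -
  have "1 - 2 * a * r + r\<^sup>2 = (r - a)\<^sup>2 + (1 - a) * (1 + a)"
    by (simp add: power2_eq_square algebra_simps)
  moreover have "(1 - a) * (1 + a) > 0"
    using assms by simp
  ultimately show ?thesis
    by (simp add: add_nonneg_pos)
qed

text \<open>
  The value \<open>t * ln x + (1 - t) * ln y\<close>, normalised, as a function of the ratio \<open>r = x / y\<close> of the two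
  amplitudes. They lie on an ellipse with a quadratic form proportional to
  \<open>x\<^sup>2 - 2 * a * x * y + y\<^sup>2\<close>, so the ratio determines both.
\<close>
definition ratio_rate :: "real \<Rightarrow> real \<Rightarrow> real \<Rightarrow> real" where
  "ratio_rate a t r = t * ln r - (ln (1 - 2 * a * r + r\<^sup>2) - ln (1 - a\<^sup>2)) / 2"

lemma f_fun_differentiable:
  assumes "\<beta> \<ge> 0" "t \<in> {0..1/2}"
  obtains f' where "(f_fun \<beta> has_real_derivative f') (at t)"
proof -
  have "1 + (exp (-4 * \<beta>) - 1) * (1 - 2 * t)\<^sup>2 > 0" "2 * (1 - t) \<noteq> 0"
    using f_fun_discriminant_pos[of \<beta> t] assms by auto
  then have "\<exists>f'. ((\<lambda>t. f_fun \<beta> t) has_real_derivative f') (at t)"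
    unfolding f_fun_def by (intro exI) (rule derivative_intros DERIV_real_sqrt_generic refl | simp)+
  then show ?thesis using that by auto
qed

text \<open>
  Envelope argument: because \<open>f_fun \<beta> u\<close> is stationary for \<open>ratio_rate a u\<close>, the derivative in \<open>u\<close> of
  the stationary value is the partial derivative \<open>ln (f_fun \<beta> u)\<close>, which is the integrand of \<open>F_fun\<close>.
  Both sides vanish at \<open>u = 0\<close>.
\<close>
lemma F_fun_eq_ratio_rate:
  assumes "\<beta> > 0" "t \<in> {0..1/2}"
  shows "F_fun \<beta> t = ratio_rate (exp (- 2 * \<beta>)) t (f_fun \<beta> t)"
proof -
  define a where "a = exp (- 2 * \<beta>)"
  have a: "0 < a" "a < 1"
    using assms by (auto simp: a_def)
  have a2: "1 - a\<^sup>2 > 0"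
    using a by (simp add: power_less_one_iff abs_square_less_1)
  have deriv: "((\<lambda>u. ratio_rate a u (f_fun \<beta> u)) has_real_derivative ln (f_fun \<beta> u)) (at u)"
    if u: "u \<in> {0..1/2}" for u
  proof -
    obtain f' where f': "(f_fun \<beta> has_real_derivative f') (at u)"
      using f_fun_differentiable[of \<beta> u] u assms by auto
    define f where "f = f_fun \<beta> u"
    have f: "f > 0"
      using f_fun_pos[of \<beta> u] u assms by (simp add: f_def)
    have Q: "1 - 2 * a * f + f\<^sup>2 > 0"
      using quadratic_form_pos[OF a] .
    have "u * (1 - 2 * a * f + f\<^sup>2) = f * (f - a)"
      using f_fun_quadratic[of \<beta> u] u assms by (simp add: f_def a_def)
    then have stat: "u / f = (f - a) / (1 - 2 * a * f + f\<^sup>2)"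
      using f Q by (simp add: field_simps)
    have "((\<lambda>u. ratio_rate a u (f_fun \<beta> u)) has_real_derivative
        (u * (f' / f) + 1 * ln f - (((2 * f - 2 * a) * f') / (1 - 2 * a * f + f\<^sup>2)) / 2)) (at u)"
    proof -
      have dQ: "((\<lambda>u. 1 - 2 * a * f_fun \<beta> u + (f_fun \<beta> u)\<^sup>2) has_real_derivative (2 * f - 2 * a) * f') (at u)"
        using f' by (auto intro!: derivative_eq_intros simp: f_def algebra_simps)
      have 1: "((\<lambda>u. ln (1 - 2 * a * f_fun \<beta> u + (f_fun \<beta> u)\<^sup>2)) has_real_derivative
          1 / (1 - 2 * a * f + f\<^sup>2) * ((2 * f - 2 * a) * f')) (at u)"
        using Q unfolding f_def by (intro DERIV_chain2[OF DERIV_ln_divide] dQ[unfolded f_def])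
      have 2: "((\<lambda>u. ln (f_fun \<beta> u)) has_real_derivative 1 / f * f') (at u)"
        using f unfolding f_def by (intro DERIV_chain2[OF DERIV_ln_divide] f')
      show ?thesis
        unfolding ratio_rate_def
        by (rule DERIV_cong[OF DERIV_diff[OF DERIV_mult[OF DERIV_ident 2]
          DERIV_cdivide[OF DERIV_diff[OF 1 DERIV_const]]]]) (simp add: f_def)
    qed
    also have "u * (f' / f) + 1 * ln f - (((2 * f - 2 * a) * f') / (1 - 2 * a * f + f\<^sup>2)) / 2
        = ln f + f' * (u / f - (f - a) / (1 - 2 * a * f + f\<^sup>2))"
    proof -
      have "((2 * f - 2 * a) * f') / (1 - 2 * a * f + f\<^sup>2) / 2 = f' * ((f - a) / (1 - 2 * a * f + f\<^sup>2))"
      proof -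
        have "(2 * f - 2 * a) * f' = f' * (f - a) * 2"
          by (simp add: algebra_simps)
        moreover have "(x * 2) / q / 2 = x / q" for x q :: real
          by simp
        ultimately show ?thesis
          by (simp only: times_divide_eq_right)
      qed
      then show ?thesis
        by (simp add: right_diff_distrib)
    qed
    finally show ?thesis
      using stat by (simp add: f_def)
  qed
  have "((\<lambda>u. ln (f_fun \<beta> u)) has_integral
      (ratio_rate a t (f_fun \<beta> t) - ratio_rate a 0 (f_fun \<beta> 0))) {0..t}"
  proof (intro fundamental_theorem_of_calculus)
    fix u assume "u \<in> {0..t}"
    then have "u \<in> {0..1/2}"
      using assms(2) by auto
    with deriv show "((\<lambda>u. ratio_rate a u (f_fun \<beta> u)) has_vector_derivative ln (f_fun \<beta> u)) (at u within {0..t})"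
      by (simp add: has_real_derivative_iff_has_vector_derivative[symmetric] has_field_derivative_at_within)
  qed (use assms(2) in auto)
  moreover have "f_fun \<beta> 0 = a"
  proof -
    have "exp (-4 * \<beta>) = a\<^sup>2"
      unfolding a_def by (simp add: power2_eq_square exp_add[symmetric])
    then show ?thesis
      using a by (simp add: f_fun_def a_def)
  qed
  moreover have "ratio_rate a 0 a = 0"
  proof -
    have "1 - 2 * a * a + a\<^sup>2 = 1 - a\<^sup>2"
      by (simp add: power2_eq_square)
    then show ?thesis
      using a2 by (simp add: ratio_rate_def)
  qed
  moreover have "min t (1 - t) = t"
    using assms(2) by auto
  ultimately show ?thesis
    unfolding F_fun_def a_def[symmetric] by (simp add: integral_unique)
qed

lemma weighted_exp_mean:
  fixes t x y :: real
  assumes "t \<in> {0..1}"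
  shows "exp (t * x + (1 - t) * y) \<le> t * exp x + (1 - t) * exp y"
  using convex_onD[OF exp_convex, of t y x] assms by (simp add: add.commute)

text \<open>
  With \<open>r = f * x\<close>, the stationarity of \<open>f\<close> rewrites the quadratic form at \<open>r\<close>, relative to that at
  \<open>f\<close>, as \<open>(1 - t) + t * x\<^sup>2\<close> plus a nonnegative remainder, and the weighted mean \<open>(1 - t) + t * x\<^sup>2\<close>
  is at least the geometric mean \<open>x powr (2 * t)\<close>.
\<close>
lemma ratio_rate_le_f_fun:
  assumes "\<beta> > 0" "t \<in> {0..1/2}" "r > 0"
  shows "ratio_rate (exp (- 2 * \<beta>)) t r \<le> ratio_rate (exp (- 2 * \<beta>)) t (f_fun \<beta> t)"
proof -
  define a f where "a = exp (- 2 * \<beta>)" and "f = f_fun \<beta> t"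
  define Q where "Q = (\<lambda>r. 1 - 2 * a * r + r\<^sup>2)"
  have a: "0 < a" "a < 1"
    using assms by (auto simp: a_def)
  have a2: "1 - a\<^sup>2 > 0"
    using a by (simp add: power_less_one_iff abs_square_less_1)
  have f: "f > 0"
    using f_fun_pos[of \<beta> t] assms by (simp add: f_def)
  have Q_eq: "1 - 2 * a * r + r\<^sup>2 = Q r" for r
    by (simp add: Q_def)
  have Q: "Q r > 0" for r
    unfolding Q_def by (rule quadratic_form_pos[OF a])
  have quad: "t * Q f = f * (f - a)"
    using f_fun_quadratic[of \<beta> t] assms by (simp add: f_def a_def Q_def)
  define x where "x = r / f"
  have x: "x > 0" "r = f * x"
    using f assms by (auto simp: x_def)
  have "Q r = ((1 - t) + t * x\<^sup>2) * Q f + a * f * (1 - x)\<^sup>2"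
  proof -
    have "((1 - t) + t * x\<^sup>2) * Q f = Q f + (x\<^sup>2 - 1) * (t * Q f)"
      by (simp add: algebra_simps)
    also have "\<dots> + a * f * (1 - x)\<^sup>2 = Q r"
      unfolding quad x(2) by (simp add: Q_def power2_eq_square algebra_simps)
    finally show ?thesis by simp
  qed
  then have "((1 - t) + t * x\<^sup>2) * Q f \<le> Q r"
    using a f by simp
  moreover have "exp (t * (2 * ln x)) \<le> (1 - t) + t * x\<^sup>2"
    using weighted_exp_mean[of t "2 * ln x" 0] assms(2) x
    by (simp add: exp_double)
  ultimately have "exp (t * (2 * ln x)) * Q f \<le> Q r"
    using Q[of f] by (meson mult_right_mono less_imp_le order_trans)
  then have "ln (exp (t * (2 * ln x)) * Q f) \<le> ln (Q r)"
    using Q[of f] Q[of r] by (subst ln_le_cancel_iff) auto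
  then have "2 * (t * ln x) + ln (Q f) \<le> ln (Q r)"
    using Q[of f] by (simp add: ln_mult)
  moreover have "ln r = ln f + ln x"
    using x f by (simp add: ln_mult)
  ultimately show ?thesis
    unfolding ratio_rate_def a_def[symmetric] f_def[symmetric] Q_eq
    by (simp add: distrib_left diff_divide_distrib)
qed

lemma amplitude_reflect: "amplitude s \<tau> (- \<phi>) = amplitude s (- \<tau>) \<phi>"
  by (simp add: amplitude_def)

text \<open>
  The relation \<open>tanh \<beta> * (1 + a) = 1 - a\<close> with \<open>a = exp (- 2 * \<beta>)\<close> turns the identity
  \<open>cos\<^sup>2 + sin\<^sup>2 = 1\<close> into the equation of the ellipse on which the two amplitudes lie.
\<close>
lemma log_amplitude_mean:
  assumes "\<beta> > 0" "amplitude (sqrt (tanh \<beta>)) 1 \<phi> > 0" "amplitude (sqrt (tanh \<beta>)) (- 1) \<phi> > 0"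
  defines "x \<equiv> amplitude (sqrt (tanh \<beta>)) 1 \<phi>" and "y \<equiv> amplitude (sqrt (tanh \<beta>)) (- 1) \<phi>"
  shows "t * ln x + (1 - t) * ln y + (ln (cosh \<beta>) - \<beta>) / 2 = ratio_rate (exp (- 2 * \<beta>)) t (x / y)"
proof -
  define a where "a = exp (- 2 * \<beta>)"
  have a: "0 < a" "a < 1"
    using assms(1) by (auto simp: a_def)
  have a2: "1 - a\<^sup>2 > 0"
    using a by (simp add: power_less_one_iff abs_square_less_1)
  have th: "tanh \<beta> * (1 + a) = 1 - a" "tanh \<beta> \<ge> 0"
    using a assms(1) unfolding tanh_real_altdef[of \<beta>] a_def[symmetric] by simp_all
  define s where "s = sqrt (tanh \<beta>)"
  have s2: "s * s = tanh \<beta>"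
    using th by (simp add: s_def)
  have xy: "x > 0" "y > 0"
    using assms by auto
  have "x\<^sup>2 - 2 * a * x * y + y\<^sup>2 = 2 * (1 - a) * (cos \<phi>)\<^sup>2 + 2 * (s * s) * (1 + a) * (sin \<phi>)\<^sup>2"
    unfolding x_def y_def amplitude_def s_def[symmetric] by (simp add: power2_eq_square algebra_simps)
  also have "\<dots> = 2 * (1 - a) * ((cos \<phi>)\<^sup>2 + (sin \<phi>)\<^sup>2)"
  proof -
    have "tanh \<beta> * (1 + a) * (sin \<phi>)\<^sup>2 = (1 - a) * (sin \<phi>)\<^sup>2"
      unfolding th(1) ..
    then show ?thesis
      unfolding s2 by (simp add: algebra_simps del: sin_cos_squared_add sin_cos_squared_add2)
  qed
  finally have form: "x\<^sup>2 - 2 * a * x * y + y\<^sup>2 = 2 * (1 - a)"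
    by simp
  have "1 - 2 * a * (x / y) + (x / y)\<^sup>2 = (x\<^sup>2 - 2 * a * x * y + y\<^sup>2) / y\<^sup>2"
    using xy by (simp add: field_simps power2_eq_square)
  then have "ln (1 - 2 * a * (x / y) + (x / y)\<^sup>2) = ln (2 * (1 - a)) - ln (y\<^sup>2)"
    unfolding form using a xy by (subst ln_divide_pos[symmetric]) simp_all
  also have "\<dots> = ln 2 + ln (1 - a) - 2 * ln y"
    using a xy ln_mult_pos[of 2 "1 - a"] by (simp only: ln_realpow of_nat_numeral)
  finally have "ln (1 - 2 * a * (x / y) + (x / y)\<^sup>2) = ln 2 + ln (1 - a) - 2 * ln y" .
  moreover have "ln (1 - a\<^sup>2) = ln (1 - a) + ln (1 + a)"
    using a by (subst ln_mult_pos[symmetric]) (auto simp: power2_eq_square algebra_simps)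
  moreover have "ln (cosh \<beta>) - \<beta> = ln (1 + a) - ln 2"
  proof -
    have "cosh \<beta> = exp \<beta> * (1 + a) / 2"
      by (simp add: cosh_def a_def distrib_left exp_add[symmetric])
    then have "ln (cosh \<beta>) = ln (exp \<beta> * (1 + a) / 2)"
      by (rule arg_cong)
    also have "\<dots> = ln (exp \<beta> * (1 + a)) - ln 2"
      using a by (intro ln_divide_pos mult_pos_pos) auto
    also have "ln (exp \<beta> * (1 + a)) = \<beta> + ln (1 + a)"
      using a ln_mult_pos[of "exp \<beta>" "1 + a"] by simp
    finally show ?thesis by simp
  qed
  moreover have "ln (x / y) = ln x - ln y"
    using xy by (simp add: ln_div)
  ultimately show ?thesis
    unfolding ratio_rate_def a_def[symmetric] by (simp only:) (simp add: field_simps)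
qed

lemma F_fun_symmetric: "F_fun \<beta> (1 - t) = F_fun \<beta> t"
  by (simp add: F_fun_def min.commute)

text \<open>
  For \<open>t \<le> 1/2\<close> and \<open>\<beta> > 0\<close> this is the optimality of \<open>f_fun \<beta> t\<close> among the ratios of amplitudes; the
  angle with tangent \<open>y / s\<close>, \<open>y = (f - 1) / (f + 1)\<close>, has amplitudes proportional to \<open>1 + y\<close> and
  \<open>1 - y\<close> and thus realises this ratio. For \<open>\<beta> = 0\<close> both amplitudes equal the cosine and the angle
  \<open>0\<close> is optimal. Reflecting \<open>\<phi>\<close> exchanges \<open>t\<close> and \<open>1 - t\<close>.
\<close>
lemma F_fun_variational:
  assumes "\<beta> \<ge> 0" "t \<in> {0..1}"
  defines "s \<equiv> sqrt (tanh \<beta>)"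
  shows "\<And>\<phi>. amplitude s 1 \<phi> > 0 \<Longrightarrow> amplitude s (- 1) \<phi> > 0 \<Longrightarrow>
      t * ln (amplitude s 1 \<phi>) + (1 - t) * ln (amplitude s (- 1) \<phi>) + (ln (cosh \<beta>) - \<beta>) / 2 \<le> F_fun \<beta> t"
    and "\<exists>\<phi>\<in>{-(pi/2)..pi/2}. amplitude s 1 \<phi> > 0 \<and> amplitude s (- 1) \<phi> > 0 \<and>
      t * ln (amplitude s 1 \<phi>) + (1 - t) * ln (amplitude s (- 1) \<phi>) + (ln (cosh \<beta>) - \<beta>) / 2 = F_fun \<beta> t"
proof -
  define V where "V = (\<lambda>t \<phi>. t * ln (amplitude s 1 \<phi>) + (1 - t) * ln (amplitude s (- 1) \<phi>) + (ln (cosh \<beta>) - \<beta>) / 2)"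
  define pos where "pos = (\<lambda>\<phi>. amplitude s 1 \<phi> > 0 \<and> amplitude s (- 1) \<phi> > 0)"
  have half: "(\<forall>\<phi>. pos \<phi> \<longrightarrow> V t \<phi> \<le> F_fun \<beta> t) \<and> (\<exists>\<phi>\<in>{-(pi/2)..pi/2}. pos \<phi> \<and> V t \<phi> = F_fun \<beta> t)"
    if t: "t \<in> {0..1/2}" for t
  proof (cases "\<beta> = 0")
    case True
    have "f_fun 0 u = 1" if "u \<in> {0..1/2}" for u
      using that by (simp add: f_fun_def divide_simps)
    then have "integral {0..min t (1 - t)} (\<lambda>u. ln (f_fun 0 u)) = integral {0..min t (1 - t)} (\<lambda>u. 0)"
      using t by (intro integral_cong) auto
    then have F0: "F_fun \<beta> t = 0"
      using True by (simp add: F_fun_def)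
    have V: "V t \<phi> = ln (cos \<phi>)" for \<phi>
      using True by (simp add: V_def amplitude_def s_def algebra_simps)
    have "V t \<phi> \<le> 0" if "pos \<phi>" for \<phi>
      using that True unfolding V by (simp add: pos_def amplitude_def s_def)
    moreover have "pos 0" "V t 0 = 0"
      using V by (simp_all add: pos_def amplitude_def)
    ultimately show ?thesis
      unfolding F0 by (intro conjI allI impI bexI[of _ 0]) auto
  next
    case False
    then have \<beta>: "\<beta> > 0" using assms by simp
    then have s: "s > 0" by (simp add: s_def)
    define f where "f = f_fun \<beta> t"
    have f: "f > 0"
      using f_fun_pos[of \<beta> t] t \<beta> by (simp add: f_def)
    have V: "V t \<phi> = ratio_rate (exp (- 2 * \<beta>)) t (amplitude s 1 \<phi> / amplitude s (- 1) \<phi>)" if "pos \<phi>" for \<phi>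
      using log_amplitude_mean[OF \<beta>, of \<phi> t] that by (simp add: V_def pos_def s_def)
    have "V t \<phi> \<le> F_fun \<beta> t" if "pos \<phi>" for \<phi>
      unfolding V[OF that] F_fun_eq_ratio_rate[OF \<beta> t]
      by (rule ratio_rate_le_f_fun[OF \<beta> t]) (use that in \<open>simp add: pos_def\<close>)
    moreover define y where "y = (f - 1) / (f + 1)"
    define \<phi> where "\<phi> = arctan (y / s)"
    have y: "1 + y = 2 * f / (f + 1)" "1 - y = 2 / (f + 1)"
      using f by (auto simp: y_def field_simps)
    have amp: "amplitude s \<tau> \<phi> = cos \<phi> * (1 + \<tau> * y)" for \<tau>
    proof -
      have "cos \<phi> \<noteq> 0"
        by (simp add: \<phi>_def)
      then have "sin \<phi> = cos \<phi> * (y / s)"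
        using tan_arctan[of "y / s"] by (simp add: \<phi>_def[symmetric] tan_def field_simps)
      then show ?thesis
        using s by (simp add: amplitude_def algebra_simps)
    qed
    have c: "cos \<phi> > 0"
      using arctan_bounded[of "y / s"] unfolding \<phi>_def[symmetric] by (intro cos_gt_zero_pi) auto
    have p: "pos \<phi>"
      using f c y by (simp add: pos_def amp)
    moreover have "amplitude s 1 \<phi> / amplitude s (- 1) \<phi> = f"
      using f c y by (simp add: amp)
    then have "V t \<phi> = F_fun \<beta> t"
      unfolding V[OF p] F_fun_eq_ratio_rate[OF \<beta> t] by (simp add: f_def)
    moreover have "\<phi> \<in> {-(pi/2)..pi/2}"
      using arctan_bounded[of "y / s"] unfolding \<phi>_def[symmetric] by auto
    ultimately show ?thesis by blast
  qed
  have all: "(\<forall>\<phi>. pos \<phi> \<longrightarrow> V t \<phi> \<le> F_fun \<beta> t) \<and> (\<exists>\<phi>\<in>{-(pi/2)..pi/2}. pos \<phi> \<and> V t \<phi> = F_fun \<beta> t)"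
  proof (cases "t \<le> 1/2")
    case True
    then show ?thesis using half assms(2) by auto
  next
    case False
    then have *: "(\<forall>\<phi>. pos \<phi> \<longrightarrow> V (1 - t) \<phi> \<le> F_fun \<beta> t) \<and>
        (\<exists>\<phi>\<in>{-(pi/2)..pi/2}. pos \<phi> \<and> V (1 - t) \<phi> = F_fun \<beta> t)"
      using half[of "1 - t"] assms(2) by (simp add: F_fun_symmetric)
    have refl: "V (1 - t) (- \<phi>) = V t \<phi>" "pos (- \<phi>) \<longleftrightarrow> pos \<phi>" for \<phi>
      by (auto simp: V_def pos_def amplitude_reflect)
    show ?thesis
    proof (intro conjI allI impI)
      fix \<phi> assume "pos \<phi>"
      then show "V t \<phi> \<le> F_fun \<beta> t"
        using *[THEN conjunct1, rule_format, of "- \<phi>"] refl by simp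
    next
      obtain \<phi> where "\<phi> \<in> {-(pi/2)..pi/2}" "pos \<phi>" "V (1 - t) \<phi> = F_fun \<beta> t"
        using * by blast
      then show "\<exists>\<phi>\<in>{-(pi/2)..pi/2}. pos \<phi> \<and> V t \<phi> = F_fun \<beta> t"
        using refl[of "- \<phi>"] by (intro bexI[of _ "- \<phi>"]) auto
    qed
  qed
  show "t * ln (amplitude s 1 \<phi>) + (1 - t) * ln (amplitude s (- 1) \<phi>) + (ln (cosh \<beta>) - \<beta>) / 2 \<le> F_fun \<beta> t"
    if "amplitude s 1 \<phi> > 0" "amplitude s (- 1) \<phi> > 0" for \<phi>
    using all that by (simp add: V_def pos_def)
  show "\<exists>\<phi>\<in>{-(pi/2)..pi/2}. amplitude s 1 \<phi> > 0 \<and> amplitude s (- 1) \<phi> > 0 \<and>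
      t * ln (amplitude s 1 \<phi>) + (1 - t) * ln (amplitude s (- 1) \<phi>) + (ln (cosh \<beta>) - \<beta>) / 2 = F_fun \<beta> t"
    using all by (auto simp: V_def pos_def)
qed

lemma gibbs_variational:
  fixes t x y :: real
  assumes "t \<in> {0..1}"
  shows "(t - 1) * ln (1 - t) - t * ln t + t * x + (1 - t) * y \<le> ln (exp x + exp y)"
proof -
  consider "t = 0" | "t = 1" | "0 < t" "t < 1"
    using assms by fastforce
  then show ?thesis
  proof cases
    case 3
    have "exp (t * (x - ln t) + (1 - t) * (y - ln (1 - t))) \<le> t * exp (x - ln t) + (1 - t) * exp (y - ln (1 - t))"
      using assms by (rule weighted_exp_mean)
    also have "\<dots> = exp x + exp y"
      using 3 by (simp add: exp_diff)
    finally have "t * (x - ln t) + (1 - t) * (y - ln (1 - t)) \<le> ln (exp x + exp y)"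
      by (subst ln_ge_iff) (auto intro: add_pos_pos)
    then show ?thesis by (simp add: algebra_simps)
  qed (auto simp: ln_ge_iff add_pos_pos)
qed

lemma gibbs_variational_eq:
  fixes x y :: real
  defines "t \<equiv> exp x / (exp x + exp y)"
  shows "t \<in> {0..1}" "(t - 1) * ln (1 - t) - t * ln t + t * x + (1 - t) * y = ln (exp x + exp y)"
proof -
  have pos: "exp x + exp y > 0" by (intro add_pos_pos) auto
  show "t \<in> {0..1}"
    using pos by (simp add: t_def)
  have t: "1 - t = exp y / (exp x + exp y)"
    using pos by (simp add: t_def field_simps)
  have lt: "ln t = x - ln (exp x + exp y)" "ln (1 - t) = y - ln (exp x + exp y)"
    unfolding t using pos by (simp_all add: t_def ln_div)
  show "(t - 1) * ln (1 - t) - t * ln t + t * x + (1 - t) * y = ln (exp x + exp y)"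
    unfolding lt by (simp add: algebra_simps)
qed

text \<open>
  Exchange of two maxima. For a fixed angle, the maximum over \<open>t\<close> of the entropy plus the linear
  function of \<open>t\<close> is the logarithm of the site weight (Gibbs). For a fixed \<open>t\<close>, the maximum over the
  angle is \<open>F_fun\<close>. The optimal \<open>t\<close> is the probability of a plus spin at the maximizing angle.
\<close>
lemma pressure_eq_log_max:
  assumes "\<beta> \<ge> 0" "d \<ge> 1" "\<phi> \<in> {-(pi/2)..pi/2}"
  defines "s \<equiv> sqrt (tanh \<beta>)"
  assumes max: "\<And>\<phi>'. \<phi>' \<in> {-(pi/2)..pi/2} \<Longrightarrow> \<bar>site_weight s B d \<phi>'\<bar> \<le> \<bar>site_weight s B d \<phi>\<bar>"
  shows "pressure d \<beta> B = real d / 2 * ln (cosh \<beta>) + ln (site_weight s B d \<phi>)"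
    and "\<exists>t\<in>{0..1}. \<forall>u\<in>{0..1}. pressure_objective d \<beta> B u \<le> pressure_objective d \<beta> B t"
proof -
  define C where "C = (ln (cosh \<beta>) - \<beta>) / 2"
  have s: "0 \<le> s" "s < 1"
    using assms(1) tanh_real_lt_1[of \<beta>] by (auto simp: s_def)
  have amp: "amplitude s 1 \<phi> > 0" "amplitude s (- 1) \<phi> > 0"
    using maximizer_amplitudes_pos[OF s assms(2,3) max] by auto
  have weight: "site_weight s B d \<phi> = exp (B + d * ln (amplitude s 1 \<phi>)) + exp (- B + d * ln (amplitude s (- 1) \<phi>))"
    if "amplitude s 1 \<phi> > 0" "amplitude s (- 1) \<phi> > 0" for \<phi>
    using that unfolding site_weight_eq exp_add by (simp add: exp_of_nat_mult)
  have upper: "pressure_objective d \<beta> B u \<le> ln (site_weight s B d \<phi>) + B + d * C" if u: "u \<in> {0..1}" for u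
  proof -
    obtain \<phi>' where \<phi>': "\<phi>' \<in> {-(pi/2)..pi/2}" "amplitude s 1 \<phi>' > 0" "amplitude s (- 1) \<phi>' > 0"
      "u * ln (amplitude s 1 \<phi>') + (1 - u) * ln (amplitude s (- 1) \<phi>') + C = F_fun \<beta> u"
      using F_fun_variational(2)[OF assms(1) u] by (auto simp: s_def C_def)
    have "pressure_objective d \<beta> B u - B - d * C =
      (u - 1) * ln (1 - u) - u * ln u + u * (B + d * ln (amplitude s 1 \<phi>'))
        + (1 - u) * (- B + d * ln (amplitude s (- 1) \<phi>'))"
      unfolding pressure_objective_def \<phi>'(4)[symmetric] by (simp add: algebra_simps)
    also have "\<dots> \<le> ln (site_weight s B d \<phi>')"
      unfolding weight[OF \<phi>'(2,3)] by (rule gibbs_variational[OF u])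
    also have "\<dots> \<le> ln (site_weight s B d \<phi>)"
      using max[OF \<phi>'(1)] site_weight_pos[OF amp, of B d] site_weight_pos[OF \<phi>'(2,3), of B d] by simp
    finally show ?thesis by simp
  qed
  define x y where "x = B + d * ln (amplitude s 1 \<phi>)" and "y = - B + d * ln (amplitude s (- 1) \<phi>)"
  define t where "t = exp x / (exp x + exp y)"
  have t: "t \<in> {0..1}"
    unfolding t_def by (rule gibbs_variational_eq(1))
  have "ln (site_weight s B d \<phi>) = (t - 1) * ln (1 - t) - t * ln t + t * x + (1 - t) * y"
    unfolding weight[OF amp] x_def[symmetric] y_def[symmetric] t_def gibbs_variational_eq(2) ..
  also have "\<dots> = (t - 1) * ln (1 - t) - t * ln t + 2 * B * t - B - d * C +
      d * (t * ln (amplitude s 1 \<phi>) + (1 - t) * ln (amplitude s (- 1) \<phi>) + C)"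
    by (simp add: x_def y_def algebra_simps)
  also have "\<dots> \<le> (t - 1) * ln (1 - t) - t * ln t + 2 * B * t - B - d * C + d * F_fun \<beta> t"
    using F_fun_variational(1)[OF assms(1) t, of \<phi>] amp
    by (intro add_left_mono mult_left_mono) (auto simp: s_def C_def)
  finally have lower: "ln (site_weight s B d \<phi>) + B + d * C \<le> pressure_objective d \<beta> B t"
    by (simp add: pressure_objective_def)
  then have eq: "pressure_objective d \<beta> B t = ln (site_weight s B d \<phi>) + B + d * C"
    using upper[OF t] by simp
  show "\<exists>t\<in>{0..1}. \<forall>u\<in>{0..1}. pressure_objective d \<beta> B u \<le> pressure_objective d \<beta> B t"
    using upper eq t by (intro bexI[of _ t]) auto
  have "(SUP t\<in>{0..1}. pressure_objective d \<beta> B t) = ln (site_weight s B d \<phi>) + B + d * C"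
    using t eq upper by (intro cSup_eq_maximum) (auto simp: image_iff intro!: bexI[of _ t])
  then show "pressure d \<beta> B = real d / 2 * ln (cosh \<beta>) + ln (site_weight s B d \<phi>)"
    unfolding pressure_def by (simp add: C_def field_simps)
qed

section \<open>Critical points of the site weight\<close>

text \<open>
  This is \<open>artanh (y / \<theta>) - (d - 1) * artanh y\<close>: the external field for which \<open>y\<close> is a critical point
  of the site weight.
\<close>
definition field_of :: "real \<Rightarrow> nat \<Rightarrow> real \<Rightarrow> real" where
  "field_of \<theta> d y = (ln (\<theta> + y) - ln (\<theta> - y)) / 2 - (real d - 1) * (ln (1 + y) - ln (1 - y)) / 2"

text \<open>
  Up to positive factors, the derivative of \<open>field_of \<theta> d\<close> and the negative second derivative of the
  logarithm of the site weight at the critical point \<open>y\<close>.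
\<close>
definition stability :: "real \<Rightarrow> nat \<Rightarrow> real \<Rightarrow> real" where
  "stability \<theta> d y = \<theta> * (1 - y\<^sup>2) - (real d - 1) * (\<theta>\<^sup>2 - y\<^sup>2)"

text \<open>
  The mean of the spin of a vertex when the angle is at the critical point \<open>y\<close>.
\<close>
definition mag_of :: "real \<Rightarrow> real \<Rightarrow> real" where
  "mag_of \<theta> y = y * (1 + \<theta>) / (\<theta> + y\<^sup>2)"

text \<open>
  Selects the critical points that can be maxima: those on the side of the field, or all of them when
  \<open>(d - 1) * \<theta> < 1\<close> makes \<open>field_of \<theta> d\<close> strictly increasing.
\<close>
definition stable :: "real \<Rightarrow> nat \<Rightarrow> real \<Rightarrow> bool" where
  "stable \<theta> d y \<longleftrightarrow> \<bar>y\<bar> < \<theta> \<and> (0 < y * field_of \<theta> d y \<or> (real d - 1) * \<theta> < 1)"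

lemma field_of_minus: "field_of \<theta> d (- y) = - field_of \<theta> d y"
  by (simp add: field_of_def field_simps)

lemma field_of_0 [simp]: "field_of \<theta> d 0 = 0"
  by (simp add: field_of_def)

lemma has_real_derivative_field_of:
  assumes "\<bar>y\<bar> < \<theta>" "\<theta> < 1"
  shows "(field_of \<theta> d has_real_derivative stability \<theta> d y / ((\<theta>\<^sup>2 - y\<^sup>2) * (1 - y\<^sup>2))) (at y)"
proof -
  have pos: "\<theta> + y > 0" "\<theta> - y > 0" "1 + y > 0" "1 - y > 0"
    using assms by auto
  have "(field_of \<theta> d has_real_derivative
      (1 / (\<theta> + y) + 1 / (\<theta> - y)) / 2 - (real d - 1) * (1 / (1 + y) + 1 / (1 - y)) / 2) (at y)"
    unfolding field_of_def[abs_def] using pos by (auto intro!: derivative_eq_intros)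
  also have "1 / (\<theta> + y) + 1 / (\<theta> - y) = 2 * \<theta> / ((\<theta> + y) * (\<theta> - y))"
    using pos by (simp add: field_simps)
  also have "1 / (1 + y) + 1 / (1 - y) = 2 / ((1 + y) * (1 - y))"
    using pos by (simp add: field_simps)
  also have "2 * \<theta> / ((\<theta> + y) * (\<theta> - y)) / 2 - (real d - 1) * (2 / ((1 + y) * (1 - y))) / 2
      = stability \<theta> d y / (((\<theta> + y) * (\<theta> - y)) * ((1 + y) * (1 - y)))"
  proof -
    have "2 * \<theta> / ((\<theta> + y) * (\<theta> - y)) / 2 - (real d - 1) * (2 / ((1 + y) * (1 - y))) / 2
        = \<theta> / ((\<theta> + y) * (\<theta> - y)) - (real d - 1) / ((1 + y) * (1 - y))"
    proof -
      have "2 * u / v / 2 = u / v" "u * (2 / v) / 2 = u / v" for u v :: real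
        by simp_all
      then show ?thesis by (simp only:)
    qed
    also have "\<dots> = (\<theta> * ((1 + y) * (1 - y)) - (real d - 1) * ((\<theta> + y) * (\<theta> - y)))
        / (((\<theta> + y) * (\<theta> - y)) * ((1 + y) * (1 - y)))"
      using pos by (subst diff_frac_eq) auto
    also have "\<theta> * ((1 + y) * (1 - y)) - (real d - 1) * ((\<theta> + y) * (\<theta> - y)) = stability \<theta> d y"
      by (simp add: stability_def power2_eq_square algebra_simps)
    finally show ?thesis .
  qed
  also have "((\<theta> + y) * (\<theta> - y)) * ((1 + y) * (1 - y)) = (\<theta>\<^sup>2 - y\<^sup>2) * (1 - y\<^sup>2)"
    by (simp add: power2_eq_square algebra_simps)
  finally show ?thesis .
qed

lemma field_of_denom_pos:
  fixes y \<theta> :: real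
  assumes "\<bar>y\<bar> < \<theta>" "\<theta> < 1"
  shows "(\<theta>\<^sup>2 - y\<^sup>2) * (1 - y\<^sup>2) > 0"
proof -
  have "y\<^sup>2 < \<theta>\<^sup>2"
    using assms power_strict_mono[of "\<bar>y\<bar>" \<theta> 2] by simp
  moreover have "\<theta>\<^sup>2 < 1"
    using assms by (simp add: power_less_one_iff abs_square_less_1)
  ultimately show ?thesis by simp
qed

text \<open>
  \<open>stability \<theta> d y\<close> is affine in \<open>y\<^sup>2\<close> with slope \<open>d - 1 - \<theta>\<close>, which is positive.
\<close>
lemma stability_mono:
  assumes "d \<ge> 2" "\<theta> < 1" "\<bar>y\<bar> \<le> \<bar>z\<bar>"
  shows "stability \<theta> d y \<le> stability \<theta> d z"
proof -
  have "y\<^sup>2 \<le> z\<^sup>2"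
    using assms(3) by (simp add: abs_le_square_iff)
  then have "(real d - 1 - \<theta>) * y\<^sup>2 \<le> (real d - 1 - \<theta>) * z\<^sup>2"
    using assms by (intro mult_left_mono) auto
  then show ?thesis
    by (simp add: stability_def algebra_simps)
qed

lemma field_of_strict_mono:
  assumes "d \<ge> 2" "\<theta> < 1" "- \<theta> < y" "y < z" "z < \<theta>"
    and pos: "\<And>x. y < x \<Longrightarrow> x < z \<Longrightarrow> stability \<theta> d x > 0"
  shows "field_of \<theta> d y < field_of \<theta> d z"
proof (rule DERIV_pos_imp_increasing_open[OF assms(4)])
  fix x assume x: "y < x" "x < z"
  then have ax: "\<bar>x\<bar> < \<theta>" using assms by auto
  show "\<exists>D. (field_of \<theta> d has_real_derivative D) (at x) \<and> D > 0"
    using has_real_derivative_field_of[OF ax assms(2)] field_of_denom_pos[OF ax assms(2)] pos[OF x]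
    by (intro exI conjI) (assumption, simp)
next
  show "continuous_on {y..z} (field_of \<theta> d)"
  proof (rule continuous_at_imp_continuous_on, rule ballI)
    fix x assume "x \<in> {y..z}"
    then have "\<bar>x\<bar> < \<theta>" using assms by auto
    then show "isCont (field_of \<theta> d) x"
      using has_real_derivative_field_of[OF _ assms(2)] DERIV_isCont by blast
  qed
qed

text \<open>
  \<open>field_of \<theta> d\<close> vanishes at \<open>0\<close>; if it is positive at \<open>y > 0\<close>, then its derivative is positive
  somewhere in between.
\<close>
lemma stability_pos_of_field_pos:
  assumes "d \<ge> 2" "0 < \<theta>" "\<theta> < 1" "0 < y" "y < \<theta>" "0 < field_of \<theta> d y"
  obtains z where "0 < z" "z < y" "stability \<theta> d z > 0"
proof -
  obtain z where z: "0 < z" "z < y"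
    "field_of \<theta> d y - field_of \<theta> d 0 = (y - 0) * (stability \<theta> d z / ((\<theta>\<^sup>2 - z\<^sup>2) * (1 - z\<^sup>2)))"
    using MVT2[of 0 y "field_of \<theta> d" "\<lambda>z. stability \<theta> d z / ((\<theta>\<^sup>2 - z\<^sup>2) * (1 - z\<^sup>2))"]
      has_real_derivative_field_of[of _ \<theta> d] assms by auto
  have "0 < (y - 0) * (stability \<theta> d z / ((\<theta>\<^sup>2 - z\<^sup>2) * (1 - z\<^sup>2)))"
    using z(3) assms(6) by (simp only: field_of_0 diff_zero)
  then have "stability \<theta> d z / ((\<theta>\<^sup>2 - z\<^sup>2) * (1 - z\<^sup>2)) > 0"
    by (rule zero_less_mult_pos) (use assms(4) in simp)
  then have "stability \<theta> d z > 0"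
    using field_of_denom_pos[of z \<theta>] z assms by (simp add: zero_less_divide_iff)
  then show ?thesis using that z by blast
qed

text \<open>
  A positive field at \<open>y > 0\<close> forces \<open>stability\<close> to be positive at some smaller point, hence at \<open>y\<close> by
  monotonicity. The case of a negative field is the mirror image.
\<close>
lemma stable_stability_pos:
  assumes "d \<ge> 2" "0 < \<theta>" "\<theta> < 1" "stable \<theta> d y"
  shows "stability \<theta> d y > 0"
proof (cases "(real d - 1) * \<theta> < 1")
  case True
  have "stability \<theta> d 0 = \<theta> * (1 - (real d - 1) * \<theta>)"
    by (simp add: stability_def power2_eq_square algebra_simps)
  then have "stability \<theta> d 0 > 0"
    using True assms by simp
  then show ?thesis
    using stability_mono[OF assms(1,3), of 0 y] by simp
next
  case False
  then have y: "\<bar>y\<bar> < \<theta>" "0 < y * field_of \<theta> d y"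
    using assms(4) by (auto simp: stable_def)
  then have "0 < \<bar>y\<bar>" "0 < field_of \<theta> d \<bar>y\<bar>"
    by (auto simp: abs_if field_of_minus zero_less_mult_iff)
  then obtain z where "0 < z" "z < \<bar>y\<bar>" "stability \<theta> d z > 0"
    using stability_pos_of_field_pos[OF assms(1,2,3), of "\<bar>y\<bar>"] y by auto
  then show ?thesis
    using stability_mono[OF assms(1,3), of z y] by simp
qed

text \<open>
  Beyond a point where \<open>stability\<close> is positive, \<open>field_of \<theta> d\<close> is strictly increasing, so it takes a
  given positive value only once among the positive arguments.
\<close>
lemma stable_unique:
  assumes "d \<ge> 2" "0 < \<theta>" "\<theta> < 1" "stable \<theta> d y" "stable \<theta> d z" "field_of \<theta> d y = field_of \<theta> d z"
  shows "y = z"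
proof -
  have main: "\<not> y < z" if h: "0 < y" "z < \<theta>" "0 < field_of \<theta> d y" "field_of \<theta> d y = field_of \<theta> d z" for y z
  proof
    assume "y < z"
    obtain x where x: "0 < x" "x < y" "stability \<theta> d x > 0"
      using stability_pos_of_field_pos[OF assms(1,2,3), of y] h \<open>y < z\<close> by auto
    have "field_of \<theta> d y < field_of \<theta> d z"
    proof (rule field_of_strict_mono[OF assms(1,3) _ \<open>y < z\<close>])
      fix u assume "y < u" "u < z"
      then show "stability \<theta> d u > 0"
        using x stability_mono[OF assms(1,3), of x u] by simp
    qed (use h assms in auto)
    then show False using h by simp
  qed
  show ?thesis
  proof (cases "(real d - 1) * \<theta> < 1")
    case True
    have st: "stability \<theta> d x > 0" if "\<bar>x\<bar> < \<theta>" for x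
      using True that by (intro stable_stability_pos[OF assms(1,2,3)]) (simp add: stable_def)
    have yz: "\<bar>y\<bar> < \<theta>" "\<bar>z\<bar> < \<theta>"
      using assms by (auto simp: stable_def)
    show ?thesis
    proof (rule linorder_cases[of y z])
      assume "y < z"
      then have "field_of \<theta> d y < field_of \<theta> d z"
        using yz by (intro field_of_strict_mono[OF assms(1,3)] st) auto
      then show ?thesis using assms by simp
    next
      assume "z < y"
      then have "field_of \<theta> d z < field_of \<theta> d y"
        using yz by (intro field_of_strict_mono[OF assms(1,3)] st) auto
      then show ?thesis using assms by simp
    qed
  next
    case False
    then have yz: "\<bar>y\<bar> < \<theta>" "\<bar>z\<bar> < \<theta>" "0 < y * field_of \<theta> d y" "0 < z * field_of \<theta> d y"
      using assms by (auto simp: stable_def)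
    then consider "0 < y" "0 < z" "0 < field_of \<theta> d y" | "y < 0" "z < 0" "field_of \<theta> d y < 0"
      by (auto simp: zero_less_mult_iff)
    then show ?thesis
    proof cases
      case 1
      then show ?thesis using main[of y z] main[of z y] yz assms(6) by linarith
    next
      case 2
      then show ?thesis
        using main[of "- y" "- z"] main[of "- z" "- y"] yz assms(6) unfolding field_of_minus by linarith
    qed
  qed
qed

lemma mag_of_bound_identity:
  fixes y \<theta> :: real
  assumes "0 < \<theta>"
  shows "1 - (mag_of \<theta> y)\<^sup>2 = (\<theta>\<^sup>2 - y\<^sup>2) * (1 - y\<^sup>2) / (\<theta> + y\<^sup>2)\<^sup>2"
proof -
  have "\<theta> + y\<^sup>2 > 0" using assms by (simp add: add_pos_nonneg)
  then have "1 - (mag_of \<theta> y)\<^sup>2 = ((\<theta> + y\<^sup>2)\<^sup>2 - (y * (1 + \<theta>))\<^sup>2) / (\<theta> + y\<^sup>2)\<^sup>2"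
    by (simp add: mag_of_def power_divide diff_divide_distrib)
  also have "(\<theta> + y\<^sup>2)\<^sup>2 - (y * (1 + \<theta>))\<^sup>2 = (\<theta>\<^sup>2 - y\<^sup>2) * (1 - y\<^sup>2)"
    by algebra
  finally show ?thesis .
qed

lemma has_real_derivative_mag_of:
  assumes "0 < \<theta>"
  shows "(mag_of \<theta> has_real_derivative (1 + \<theta>) * (\<theta> - y\<^sup>2) / (\<theta> + y\<^sup>2)\<^sup>2) (at y)"
proof -
  have "\<theta> + y\<^sup>2 > 0" using assms by (simp add: add_pos_nonneg)
  then show ?thesis
    unfolding mag_of_def[abs_def]
    by (auto intro!: derivative_eq_intros simp: power2_eq_square) (simp add: algebra_simps)
qed

text \<open>
  The left-hand side is the limit variance from Laplace's method: the variance of one spin at the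
  critical point plus the squared rate at which its mean changes with the angle, divided by the
  curvature \<open>c\<close> at the maximum. The right-hand side is the derivative of \<open>mag_of\<close> along the inverse
  function of \<open>field_of\<close>. The identity rests on
  \<open>stability \<theta> d y + d * (\<theta>\<^sup>2 - y\<^sup>2) = (1 + \<theta>) * (\<theta> - y\<^sup>2)\<close>.
\<close>
lemma susceptibility_identity:
  fixes y \<theta> :: real
  assumes "0 < \<theta>" "\<theta> < 1" "\<bar>y\<bar> < \<theta>" "stability \<theta> d y > 0" "d \<ge> 2"
  shows "(1 - (mag_of \<theta> y)\<^sup>2) + (real d * (\<theta>\<^sup>2 - y\<^sup>2) / (sqrt \<theta> * (\<theta> + y\<^sup>2)))\<^sup>2
      / (real d * stability \<theta> d y / (\<theta> * (1 - y\<^sup>2))) =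
    ((1 + \<theta>) * (\<theta> - y\<^sup>2) / (\<theta> + y\<^sup>2)\<^sup>2) / (stability \<theta> d y / ((\<theta>\<^sup>2 - y\<^sup>2) * (1 - y\<^sup>2)))"
proof -
  define E where "E = stability \<theta> d y"
  define P where "P = \<theta>\<^sup>2 - y\<^sup>2"
  define R where "R = 1 - y\<^sup>2"
  define T where "T = \<theta> + y\<^sup>2"
  have "P * R > 0"
    using field_of_denom_pos[OF assms(3,2)] by (simp add: P_def R_def)
  have "y\<^sup>2 < 1"
    using assms by (simp add: abs_square_less_1)
  then have R: "R > 0" by (simp add: R_def)
  have T: "T > 0" using assms by (simp add: T_def add_pos_nonneg)
  have E: "E > 0" using assms by (simp add: E_def)
  have d: "real d > 0" using assms by simp
  have id: "E + real d * P = (1 + \<theta>) * (\<theta> - y\<^sup>2)"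
    by (simp add: E_def P_def stability_def power2_eq_square algebra_simps)
  have "(real d * P / (sqrt \<theta> * T))\<^sup>2 / (real d * E / (\<theta> * R)) = real d * P\<^sup>2 * R / (T\<^sup>2 * E)"
    using R T E d assms(1) by (simp add: power_divide power_mult_distrib) (simp add: field_simps power2_eq_square)
  then have "P * R / T\<^sup>2 + (real d * P / (sqrt \<theta> * T))\<^sup>2 / (real d * E / (\<theta> * R)) =
     (E + real d * P) * (P * R) / (T\<^sup>2 * E)"
    using T E by (simp add: field_simps power2_eq_square)
  then show ?thesis
    unfolding mag_of_bound_identity[OF assms(1)] E_def[symmetric] P_def[symmetric] R_def[symmetric]
      T_def[symmetric] id[symmetric] by simp
qed

lemma field_of_eq_iff:
  assumes "\<bar>y\<bar> < \<theta>" "\<theta> < 1" "d \<ge> 1"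
  shows "field_of \<theta> d y = B \<longleftrightarrow>
    exp B * (1 + y) ^ (d - 1) * (\<theta> - y) = exp (- B) * (1 - y) ^ (d - 1) * (\<theta> + y)" (is "_ \<longleftrightarrow> ?L = ?R")
proof -
  have pos: "\<theta> + y > 0" "\<theta> - y > 0" "1 + y > 0" "1 - y > 0"
    using assms by auto
  have d: "real (d - 1) = real d - 1"
    using assms by simp
  have "?L > 0" "?R > 0"
    using pos by simp_all
  then have "?L = ?R \<longleftrightarrow> ln ?L = ln ?R"
    by (simp add: ln_inj_iff)
  also have "ln ?L = B + (real d - 1) * ln (1 + y) + ln (\<theta> - y)"
    using pos d by (simp add: ln_mult ln_realpow)
  also have "ln ?R = - B + (real d - 1) * ln (1 - y) + ln (\<theta> + y)"
    using pos d by (simp add: ln_mult ln_realpow)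
  also have "B + (real d - 1) * ln (1 + y) + ln (\<theta> - y) = - B + (real d - 1) * ln (1 - y) + ln (\<theta> + y)
      \<longleftrightarrow> field_of \<theta> d y = B"
    unfolding field_of_def right_diff_distrib by (auto simp: field_simps)
  finally show ?thesis by simp
qed

definition amplitude' :: "real \<Rightarrow> real \<Rightarrow> real \<Rightarrow> real" where
  "amplitude' s \<tau> \<phi> = s * \<tau> * cos \<phi> - sin \<phi>"

lemma has_real_derivative_amplitude:
  "(amplitude s \<tau> has_real_derivative amplitude' s \<tau> \<phi>) (at \<phi>)"
  "(amplitude' s \<tau> has_real_derivative - amplitude s \<tau> \<phi>) (at \<phi>)"
  unfolding amplitude_def[abs_def] amplitude'_def[abs_def] by (auto intro!: derivative_eq_intros)

definition site_moment' :: "real \<Rightarrow> real \<Rightarrow> real \<Rightarrow> nat \<Rightarrow> nat \<Rightarrow> real \<Rightarrow> real" where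
  "site_moment' s B m k D \<phi> = real D *
     ((1 - m) ^ k * exp B * amplitude s 1 \<phi> ^ (D - 1) * amplitude' s 1 \<phi> +
      (- 1 - m) ^ k * exp (- B) * amplitude s (- 1) \<phi> ^ (D - 1) * amplitude' s (- 1) \<phi>)"

lemma has_real_derivative_site_moment:
  "(site_moment s B m k D has_real_derivative site_moment' s B m k D \<phi>) (at \<phi>)"
  unfolding site_moment_def[abs_def]
  by (rule DERIV_cong[OF DERIV_add[OF DERIV_cmult[OF DERIV_power[OF has_real_derivative_amplitude(1)]]
    DERIV_cmult[OF DERIV_power[OF has_real_derivative_amplitude(1)]]]])
    (simp add: site_moment'_def algebra_simps)

lemma has_real_derivative_site_moment':
  "(site_moment' s B m k D has_real_derivative real D *
     ((1 - m) ^ k * exp B * (real (D - 1) * amplitude s 1 \<phi> ^ (D - 2) * (amplitude' s 1 \<phi>)\<^sup>2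
        - amplitude s 1 \<phi> ^ (D - 1) * amplitude s 1 \<phi>) +
      (- 1 - m) ^ k * exp (- B) * (real (D - 1) * amplitude s (- 1) \<phi> ^ (D - 2) * (amplitude' s (- 1) \<phi>)\<^sup>2
        - amplitude s (- 1) \<phi> ^ (D - 1) * amplitude s (- 1) \<phi>))) (at \<phi>)"
  unfolding site_moment'_def[abs_def] mult.assoc
  by (rule DERIV_cong[OF DERIV_cmult[OF DERIV_add[OF
     DERIV_cmult[OF DERIV_cmult[OF DERIV_mult[OF DERIV_power[OF has_real_derivative_amplitude(1)]
       has_real_derivative_amplitude(2)]]]
     DERIV_cmult[OF DERIV_cmult[OF DERIV_mult[OF DERIV_power[OF has_real_derivative_amplitude(1)]
       has_real_derivative_amplitude(2)]]]]]])
    (simp add: algebra_simps power2_eq_square numeral_2_eq_2)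

text \<open>
  The absolute value is maximised because the site weight may be negative when \<open>d\<close> is odd, and the
  Laplace estimates need domination there too.
\<close>
definition maximizer :: "real \<Rightarrow> real \<Rightarrow> nat \<Rightarrow> real \<Rightarrow> bool" where
  "maximizer s B d \<phi> \<longleftrightarrow> \<phi> \<in> {-(pi/2)..pi/2} \<and>
     (\<forall>\<phi>'\<in>{-(pi/2)..pi/2}. \<bar>site_weight s B d \<phi>'\<bar> \<le> \<bar>site_weight s B d \<phi>\<bar>)"

lemma maximizer_exists: "\<exists>\<phi>. maximizer s B d \<phi>"
  by (rule exists_maximizer[of s B d]) (auto simp: maximizer_def)

lemma amplitude_tan:
  assumes "s > 0" "\<phi> \<in> {-(pi/2)<..<pi/2}"
  defines "y \<equiv> s * tan \<phi>"
  shows "amplitude s \<tau> \<phi> = cos \<phi> * (1 + \<tau> * y)"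
    and "amplitude' s \<tau> \<phi> = cos \<phi> / s * (s\<^sup>2 * \<tau> - y)"
    and "cos \<phi> > 0" "(cos \<phi>)\<^sup>2 = s\<^sup>2 / (s\<^sup>2 + y\<^sup>2)"
proof -
  show c: "cos \<phi> > 0"
    using assms(2) by (intro cos_gt_zero_pi) auto
  have sin: "sin \<phi> = cos \<phi> * y / s"
    using c assms(1) by (simp add: y_def tan_def)
  show "amplitude s \<tau> \<phi> = cos \<phi> * (1 + \<tau> * y)"
    using assms(1) by (simp add: amplitude_def sin algebra_simps)
  show "amplitude' s \<tau> \<phi> = cos \<phi> / s * (s\<^sup>2 * \<tau> - y)"
    using assms(1) by (simp add: amplitude'_def sin field_simps power2_eq_square)
  have "1 = (cos \<phi>)\<^sup>2 + (cos \<phi> * y / s)\<^sup>2"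
    using sin_cos_squared_add2[of \<phi>] unfolding sin by simp
  also have "\<dots> = (cos \<phi>)\<^sup>2 * (s\<^sup>2 + y\<^sup>2) / s\<^sup>2"
    using assms(1) by (simp add: field_simps power_divide power_mult_distrib)
  finally have "(cos \<phi>)\<^sup>2 * (s\<^sup>2 + y\<^sup>2) = s\<^sup>2"
    using assms(1) by (simp add: field_simps)
  moreover have "s\<^sup>2 + y\<^sup>2 > 0"
    using assms(1) by (simp add: add_pos_nonneg)
  ultimately show "(cos \<phi>)\<^sup>2 = s\<^sup>2 / (s\<^sup>2 + y\<^sup>2)"
    using assms(1) by (simp add: eq_divide_eq)
qed

text \<open>
  Dividing the vanishing derivative by a power of the cosine gives the exponential form of
  \<open>field_of \<theta> d y = B\<close>. The sign of \<open>y\<close> follows by comparison with the reflected angle, at which the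
  two amplitudes are exchanged: at a maximum the amplitude favoured by the field is the larger one.
\<close>
lemma maximizer_stationary:
  assumes s: "0 < s" "s < 1" and d: "d \<ge> 2" and max: "maximizer s B d \<phi>"
  defines "y \<equiv> s * tan \<phi>"
  shows "\<phi> \<in> {-(pi/2)<..<pi/2}" "\<bar>y\<bar> < s\<^sup>2" "field_of (s\<^sup>2) d y = B"
    "site_weight s B d \<phi> > 0" "site_moment' s B m 0 d \<phi> = 0"
    "B > 0 \<Longrightarrow> y > 0" "B < 0 \<Longrightarrow> y < 0"
proof -
  let ?\<theta> = "s\<^sup>2"
  have max': "\<And>\<phi>'. \<phi>' \<in> {-(pi/2)..pi/2} \<Longrightarrow> \<bar>site_weight s B d \<phi>'\<bar> \<le> \<bar>site_weight s B d \<phi>\<bar>"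
    and \<phi>: "\<phi> \<in> {-(pi/2)..pi/2}"
    using max by (auto simp: maximizer_def)
  have d1: "d \<ge> 1" using d by simp
  have amp: "amplitude s 1 \<phi> > 0" "amplitude s (- 1) \<phi> > 0" "\<phi> \<in> {-(pi/2)<..<pi/2}"
    using maximizer_amplitudes_pos[OF _ s(2) d1 \<phi> max'] s by auto
  show "\<phi> \<in> {-(pi/2)<..<pi/2}" by fact
  show P: "site_weight s B d \<phi> > 0"
    using site_weight_pos amp by auto
  note tan = amplitude_tan[OF s(1) amp(3), folded y_def]
  have y1: "1 + y > 0" "1 - y > 0"
    using amp(1,2) tan(3) unfolding tan(1) by (auto simp: zero_less_mult_iff)
  show D0: "site_moment' s B m 0 d \<phi> = 0"
  proof -
    have "site_moment' s B 0 0 d \<phi> = 0"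
    proof (rule DERIV_local_max[OF has_real_derivative_site_moment])
      show "0 < min (\<phi> + pi/2) (pi/2 - \<phi>)"
        using amp(3) by auto
      show "\<forall>\<psi>. \<bar>\<phi> - \<psi>\<bar> < min (\<phi> + pi/2) (pi/2 - \<phi>) \<longrightarrow> site_weight s B d \<psi> \<le> site_weight s B d \<phi>"
      proof (intro allI impI)
        fix \<psi> assume "\<bar>\<phi> - \<psi>\<bar> < min (\<phi> + pi/2) (pi/2 - \<phi>)"
        then have "\<psi> \<in> {-(pi/2)..pi/2}" by (auto simp: abs_less_iff)
        then show "site_weight s B d \<psi> \<le> site_weight s B d \<phi>"
          using max'[of \<psi>] P by simp
      qed
    qed
    then show ?thesis
      by (simp add: site_moment'_def)
  qed
  have eq: "exp B * (1 + y) ^ (d - 1) * (?\<theta> - y) = exp (- B) * (1 - y) ^ (d - 1) * (?\<theta> + y)"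
  proof -
    have "0 = real d * (cos \<phi> ^ (d - 1) * (cos \<phi> / s)) *
       (exp B * (1 + y) ^ (d - 1) * (?\<theta> - y) - exp (- B) * (1 - y) ^ (d - 1) * (?\<theta> + y))"
      using D0 unfolding site_moment'_def tan(1,2) power_mult_distrib by (simp add: algebra_simps)
    moreover have "real d * (cos \<phi> ^ (d - 1) * (cos \<phi> / s)) \<noteq> 0"
      using d tan(3) s by simp
    ultimately show ?thesis by simp
  qed
  show y: "\<bar>y\<bar> < ?\<theta>"
  proof -
    define a b where "a = exp B * (1 + y) ^ (d - 1)" and "b = exp (- B) * (1 - y) ^ (d - 1)"
    have ab: "a > 0" "b > 0" "a * (?\<theta> - y) = b * (?\<theta> + y)"
      using y1 eq by (simp_all add: a_def b_def)
    have th: "?\<theta> > 0" using s by simp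
    have "?\<theta> - y > 0"
    proof (rule ccontr)
      assume "\<not> ?thesis"
      then have "?\<theta> + y > 0" "?\<theta> - y \<le> 0" using th by linarith+
      then have "a * (?\<theta> - y) \<le> 0" "b * (?\<theta> + y) > 0"
        using mult_nonneg_nonpos[of a "?\<theta> - y"] mult_pos_pos[of b "?\<theta> + y"] ab(1,2) by linarith+
      then show False using ab by simp
    qed
    moreover from this have "b * (?\<theta> + y) > 0"
      using ab by (metis mult_pos_pos)
    then have "?\<theta> + y > 0"
      using ab by (simp add: zero_less_mult_iff)
    ultimately show ?thesis by auto
  qed
  have th1: "?\<theta> < 1"
    using s by (simp add: abs_square_less_1)
  show f: "field_of ?\<theta> d y = B"
    using field_of_eq_iff[OF y th1 d1] eq by blast
  have "B * (amplitude s 1 \<phi> - amplitude s (- 1) \<phi>) \<ge> 0"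
  proof -
    have "-\<phi> \<in> {-(pi/2)..pi/2}" using \<phi> by auto
    then have "site_weight s B d (-\<phi>) \<le> site_weight s B d \<phi>"
      using max'[of "-\<phi>"] P by simp
    then have le: "(exp B - exp (- B)) * amplitude s (- 1) \<phi> ^ d \<le> (exp B - exp (- B)) * amplitude s 1 \<phi> ^ d"
      unfolding site_weight_eq amplitude_reflect by (simp add: algebra_simps)
    consider "B = 0" | "B > 0" | "B < 0" by linarith
    then show ?thesis
    proof cases
      case 2
      then have "exp B - exp (- B) > 0" by simp
      then have "amplitude s (- 1) \<phi> ^ d \<le> amplitude s 1 \<phi> ^ d"
        using le by (simp add: mult_le_cancel_left)
      then have "amplitude s (- 1) \<phi> \<le> amplitude s 1 \<phi>"
        using amp d by (simp add: power_mono_iff)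
      then show ?thesis using 2 by simp
    next
      case 3
      then have "exp B - exp (- B) < 0" by simp
      then have "amplitude s 1 \<phi> ^ d \<le> amplitude s (- 1) \<phi> ^ d"
        using le by (simp add: mult_le_cancel_left)
      then have "amplitude s 1 \<phi> \<le> amplitude s (- 1) \<phi>"
        using amp d by (simp add: power_mono_iff)
      then show ?thesis using 3 by (simp add: mult_nonpos_nonpos)
    qed simp
  qed
  then have By: "B * y \<ge> 0"
  proof -
    assume "B * (amplitude s 1 \<phi> - amplitude s (- 1) \<phi>) \<ge> 0"
    moreover have "B * (amplitude s 1 \<phi> - amplitude s (- 1) \<phi>) = (2 * cos \<phi>) * (B * y)"
      unfolding tan(1) by (simp add: algebra_simps)
    ultimately show ?thesis
      using tan(3) by (simp add: zero_le_mult_iff)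
  qed
  have "y \<noteq> 0" if "B \<noteq> 0"
    using f that by auto
  then show "B > 0 \<Longrightarrow> y > 0" "B < 0 \<Longrightarrow> y < 0"
    using By by (auto simp: zero_le_mult_iff less_le)
qed

text \<open>
  The field is nonzero or the temperature is above criticality: there is a single dominant angle.
\<close>
definition regular :: "real \<Rightarrow> nat \<Rightarrow> real \<Rightarrow> bool" where
  "regular \<theta> d B \<longleftrightarrow> B \<noteq> 0 \<or> (real d - 1) * \<theta> < 1"

text \<open>
  The value of \<open>s * tan \<phi>\<close> at the dominant angle, described without reference to the angle so that it
  can be studied as an inverse function of \<open>field_of\<close>.
\<close>
definition bias :: "real \<Rightarrow> nat \<Rightarrow> real \<Rightarrow> real" where
  "bias \<theta> d B = (THE y. stable \<theta> d y \<and> field_of \<theta> d y = B)"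

lemma maximizer_stable:
  assumes "0 < s" "s < 1" "d \<ge> 2" "maximizer s B d \<phi>" "regular (s\<^sup>2) d B"
  shows "stable (s\<^sup>2) d (s * tan \<phi>)"
  using maximizer_stationary[OF assms(1-4)] assms(5)
  by (auto simp: stable_def regular_def zero_less_mult_iff linorder_neq_iff)

lemma bias_eqI:
  assumes "d \<ge> 2" "0 < \<theta>" "\<theta> < 1" "stable \<theta> d y" "field_of \<theta> d y = B"
  shows "bias \<theta> d B = y"
  unfolding bias_def using assms stable_unique[OF assms(1-3)] by (intro the_equality) auto

lemma bias_maximizer:
  assumes "0 < s" "s < 1" "d \<ge> 2" "maximizer s B d \<phi>" "regular (s\<^sup>2) d B"
  shows "bias (s\<^sup>2) d B = s * tan \<phi>"
  using assms maximizer_stable[OF assms] maximizer_stationary[OF assms(1-4)]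
  by (intro bias_eqI) (auto simp: abs_square_less_1)

lemma bias_props:
  assumes "0 < \<theta>" "\<theta> < 1" "d \<ge> 2" "regular \<theta> d B"
  shows "stable \<theta> d (bias \<theta> d B)" "field_of \<theta> d (bias \<theta> d B) = B" "\<bar>bias \<theta> d B\<bar> < \<theta>"
    "B > 0 \<Longrightarrow> bias \<theta> d B > 0"
proof -
  define s where "s = sqrt \<theta>"
  have s: "0 < s" "s < 1" "\<theta> = s\<^sup>2"
    using assms by (auto simp: s_def)
  obtain \<phi> where \<phi>: "maximizer s B d \<phi>"
    using maximizer_exists by blast
  have b: "bias \<theta> d B = s * tan \<phi>"
    using bias_maximizer[OF s(1,2) assms(3) \<phi>] assms(4) s(3) by simp
  show "stable \<theta> d (bias \<theta> d B)" "field_of \<theta> d (bias \<theta> d B) = B" "\<bar>bias \<theta> d B\<bar> < \<theta>"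
    "B > 0 \<Longrightarrow> bias \<theta> d B > 0"
    unfolding b using maximizer_stable[OF s(1,2) assms(3) \<phi>] maximizer_stationary[OF s(1,2) assms(3) \<phi>]
      assms(4) s(3) by auto
qed

lemma maximizer_unique:
  assumes s: "0 < s" "s < 1" and d: "d \<ge> 2" and reg: "regular (s\<^sup>2) d B"
    and max: "maximizer s B d \<phi>" and \<psi>: "\<psi> \<in> {-(pi/2)..pi/2}" "\<psi> \<noteq> \<phi>"
  shows "\<bar>site_weight s B d \<psi>\<bar> < site_weight s B d \<phi>"
proof (rule ccontr)
  assume "\<not> ?thesis"
  moreover have "site_weight s B d \<phi> > 0"
    using maximizer_stationary[OF s d max] by simp
  ultimately have "\<bar>site_weight s B d \<phi>\<bar> \<le> \<bar>site_weight s B d \<psi>\<bar>"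
    by simp
  then have max': "maximizer s B d \<psi>"
    using max \<psi>(1) unfolding maximizer_def by (meson order_trans)
  have "s * tan \<phi> = s * tan \<psi>"
    by (rule trans[OF bias_maximizer[OF s d max reg, symmetric] bias_maximizer[OF s d max' reg]])
  then have tan_eq: "tan \<phi> = tan \<psi>"
    using s by simp
  have "arctan (tan \<phi>) = \<phi>" "arctan (tan \<psi>) = \<psi>"
    using maximizer_stationary(1)[OF s d max] maximizer_stationary(1)[OF s d max']
    by (auto intro: arctan_tan)
  then have "\<phi> = \<psi>"
    unfolding tan_eq by simp
  then show False using \<psi>(2) by simp
qed

text \<open>
  At a critical point the weights \<open>exp B * (amplitude s 1 \<phi>) ^ (d - 1)\<close> and
  \<open>exp (- B) * (amplitude s (- 1) \<phi>) ^ (d - 1)\<close> are in the ratio \<open>\<theta> + y\<close> to \<open>\<theta> - y\<close>. With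
  \<open>\<kappa>\<close> as the common factor every quantity becomes a rational function of \<open>y\<close>.
\<close>
lemma maximizer_local_data:
  assumes s: "0 < s" "s < 1" and d: "d \<ge> 2" and max: "maximizer s B d \<phi>"
  defines "y \<equiv> s * tan \<phi>" and "\<theta> \<equiv> s\<^sup>2"
  defines "m \<equiv> mag_of \<theta> y" and "P \<equiv> site_weight s B d \<phi>"
  shows "site_moment s B m 1 d \<phi> = 0"
    and "site_moment s B m 2 d \<phi> = (1 - m\<^sup>2) * P"
    and "site_moment' s B m 1 d \<phi> = real d * (\<theta>\<^sup>2 - y\<^sup>2) / (s * (\<theta> + y\<^sup>2)) * P"
    and "(site_moment' s B 0 0 d has_real_derivative - (real d * stability \<theta> d y / (\<theta> * (1 - y\<^sup>2))) * P) (at \<phi>)"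
    and "ln P = real d / 2 * ln (\<theta> / (\<theta> + y\<^sup>2)) + ln (exp B * (1 + y) ^ d + exp (- B) * (1 - y) ^ d)"
proof -
  note st = maximizer_stationary[OF s d max, folded y_def \<theta>_def]
  note tan = amplitude_tan[OF s(1) st(1), folded y_def \<theta>_def]
  have th: "\<theta> > 0" "\<theta> < 1"
    using s by (auto simp: \<theta>_def abs_square_less_1)
  define c where "c = cos \<phi>"
  have c: "c > 0" using tan(3) by (simp add: c_def)
  have y: "\<theta> + y > 0" "\<theta> - y > 0" "1 + y > 0" "1 - y > 0"
    using st(2) th by auto
  have T: "\<theta> + y\<^sup>2 > 0" using th by (simp add: add_pos_nonneg)
  define \<kappa> where "\<kappa> = exp B * amplitude s 1 \<phi> ^ (d - 1) / (\<theta> + y)"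
  have Ep: "exp B * amplitude s 1 \<phi> ^ (d - 1) = \<kappa> * (\<theta> + y)"
    using y by (simp add: \<kappa>_def)
  have "exp B * (1 + y) ^ (d - 1) * (\<theta> - y) = exp (- B) * (1 - y) ^ (d - 1) * (\<theta> + y)"
    using field_of_eq_iff[OF st(2) th(2), of d B] st(3) d by simp
  then have "c ^ (d - 1) * (exp B * (1 + y) ^ (d - 1) * (\<theta> - y)) = c ^ (d - 1) * (exp (- B) * (1 - y) ^ (d - 1) * (\<theta> + y))"
    by simp
  then have "exp B * amplitude s 1 \<phi> ^ (d - 1) * (\<theta> - y) = exp (- B) * amplitude s (- 1) \<phi> ^ (d - 1) * (\<theta> + y)"
    unfolding tan(1) c_def by (simp add: power_mult_distrib mult_ac)
  then have Em: "exp (- B) * amplitude s (- 1) \<phi> ^ (d - 1) = \<kappa> * (\<theta> - y)"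
  proof -
    assume "exp B * amplitude s 1 \<phi> ^ (d - 1) * (\<theta> - y) = exp (- B) * amplitude s (- 1) \<phi> ^ (d - 1) * (\<theta> + y)"
    then have "exp (- B) * amplitude s (- 1) \<phi> ^ (d - 1) * (\<theta> + y) = \<kappa> * (\<theta> - y) * (\<theta> + y)"
      unfolding Ep by (simp only: mult_ac)
    then show ?thesis
      using y(1) mult_right_cancel[of "\<theta> + y"] by auto
  qed
  have pow: "x ^ d = x ^ (d - 1) * x" "x ^ (d - 1) = x ^ (d - 2) * x" for x :: real
    using d by (simp_all add: power_Suc2[symmetric] Suc_diff_Suc numeral_2_eq_2)
  have site: "site_moment s B m' k d \<phi> = \<kappa> * c * ((1 - m') ^ k * ((\<theta> + y) * (1 + y)) + (- 1 - m') ^ k * ((\<theta> - y) * (1 - y)))" for m' k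
  proof -
    have "site_moment s B m' k d \<phi> = (1 - m') ^ k * (exp B * amplitude s 1 \<phi> ^ (d - 1)) * amplitude s 1 \<phi> +
       (- 1 - m') ^ k * (exp (- B) * amplitude s (- 1) \<phi> ^ (d - 1)) * amplitude s (- 1) \<phi>"
      unfolding site_moment_def by (simp add: pow(1)[of "amplitude s _ \<phi>"] mult.assoc)
    then show ?thesis
      unfolding Ep Em by (simp add: tan(1) c_def algebra_simps)
  qed
  have P: "P = 2 * \<kappa> * c * (\<theta> + y\<^sup>2)"
    unfolding P_def site by (simp add: power2_eq_square algebra_simps)
  have mT: "m * (\<theta> + y\<^sup>2) = y * (1 + \<theta>)"
    using T by (simp add: m_def mag_of_def)
  show "site_moment s B m 1 d \<phi> = 0"
  proof -
    have "site_moment s B m 1 d \<phi> = 2 * \<kappa> * c * (y * (1 + \<theta>) - m * (\<theta> + y\<^sup>2))"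
      unfolding site by (simp add: power2_eq_square algebra_simps)
    then show ?thesis using mT by simp
  qed
  show "site_moment s B m 2 d \<phi> = (1 - m\<^sup>2) * P"
  proof -
    have "site_moment s B m 2 d \<phi> = 2 * \<kappa> * c * ((1 + m\<^sup>2) * (\<theta> + y\<^sup>2) - 2 * m * (y * (1 + \<theta>)))"
      unfolding site by (simp add: power2_eq_square algebra_simps)
    also have "\<dots> = (1 - m\<^sup>2) * P"
      unfolding mT[symmetric] P by (simp add: power2_eq_square algebra_simps)
    finally show ?thesis .
  qed
  have site': "site_moment' s B m' k d \<phi> = real d * (\<kappa> * (c / s) * (\<theta>\<^sup>2 - y\<^sup>2) * ((1 - m') ^ k - (- 1 - m') ^ k))" for m' k
  proof -
    have "site_moment' s B m' k d \<phi> = real d * ((1 - m') ^ k * (\<kappa> * (\<theta> + y)) * amplitude' s 1 \<phi> +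
       (- 1 - m') ^ k * (\<kappa> * (\<theta> - y)) * amplitude' s (- 1) \<phi>)"
      unfolding site_moment'_def Ep[symmetric] Em[symmetric] by (simp add: mult.assoc)
    moreover have "\<kappa> * (\<theta> + y) * amplitude' s 1 \<phi> = \<kappa> * (c / s) * (\<theta>\<^sup>2 - y\<^sup>2)"
      unfolding tan(2) c_def[symmetric] by algebra
    moreover have "\<kappa> * (\<theta> - y) * amplitude' s (- 1) \<phi> = - (\<kappa> * (c / s) * (\<theta>\<^sup>2 - y\<^sup>2))"
      unfolding tan(2) c_def[symmetric] by algebra
    ultimately have "site_moment' s B m' k d \<phi> = real d * ((1 - m') ^ k * (\<kappa> * (c / s) * (\<theta>\<^sup>2 - y\<^sup>2)) +
        (- 1 - m') ^ k * - (\<kappa> * (c / s) * (\<theta>\<^sup>2 - y\<^sup>2)))"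
      by (simp only: mult.assoc)
    moreover have "r * (u * W + v * - W) = r * (W * (u - v))" for r u v W :: real
      by (simp add: algebra_simps)
    ultimately show ?thesis
      by (simp only:)
  qed
  show "site_moment' s B m 1 d \<phi> = real d * (\<theta>\<^sup>2 - y\<^sup>2) / (s * (\<theta> + y\<^sup>2)) * P"
  proof -
    have "r * (\<kappa> * (c / s) * X * ((1 - m) ^ 1 - (- 1 - m) ^ 1)) = r * X / (s * T) * (2 * \<kappa> * c * T)"
      if "T > 0" for r X T
      using that s by (simp add: field_simps)
    then show ?thesis
      unfolding site' P using T by blast
  qed
  show "(site_moment' s B 0 0 d has_real_derivative - (real d * stability \<theta> d y / (\<theta> * (1 - y\<^sup>2))) * P) (at \<phi>)"
  proof (rule DERIV_cong[OF has_real_derivative_site_moment'])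
    have ap: "amplitude s 1 \<phi> > 0" "amplitude s (- 1) \<phi> > 0"
      unfolding tan(1) using y c by (simp_all add: c_def)
    have 1: "exp B * amplitude s 1 \<phi> ^ (d - 2) * (amplitude' s 1 \<phi>)\<^sup>2
        = \<kappa> * c / \<theta> * (\<theta>\<^sup>2 - y\<^sup>2) * ((\<theta> - y) / (1 + y))"
    proof -
      have "exp B * amplitude s 1 \<phi> ^ (d - 2) = \<kappa> * (\<theta> + y) / (c * (1 + y))"
      proof -
        have "exp B * amplitude s 1 \<phi> ^ (d - 2) = \<kappa> * (\<theta> + y) / amplitude s 1 \<phi>"
          using Ep[unfolded pow(2)[of "amplitude s 1 \<phi>"]] ap by (simp add: eq_divide_eq mult.assoc)
        then show ?thesis by (simp add: tan(1) c_def)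
      qed
      moreover have "(amplitude' s 1 \<phi>)\<^sup>2 = c\<^sup>2 / \<theta> * (\<theta> - y)\<^sup>2"
        unfolding tan(2) c_def \<theta>_def by (simp add: power_mult_distrib power_divide)
      ultimately have "exp B * amplitude s 1 \<phi> ^ (d - 2) * (amplitude' s 1 \<phi>)\<^sup>2
        = \<kappa> * (\<theta> + y) / (c * (1 + y)) * (c\<^sup>2 / \<theta> * (\<theta> - y)\<^sup>2)" by simp
      also have "\<dots> = \<kappa> * c / \<theta> * ((\<theta> + y) * (\<theta> - y)) * ((\<theta> - y) / (1 + y))"
        using c y th by (simp add: power2_eq_square mult_ac)
      also have "(\<theta> + y) * (\<theta> - y) = \<theta>\<^sup>2 - y\<^sup>2" by (simp add: power2_eq_square algebra_simps)
      finally show ?thesis .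
    qed
    have 2: "exp (- B) * amplitude s (- 1) \<phi> ^ (d - 2) * (amplitude' s (- 1) \<phi>)\<^sup>2
        = \<kappa> * c / \<theta> * (\<theta>\<^sup>2 - y\<^sup>2) * ((\<theta> + y) / (1 - y))"
    proof -
      have "exp (- B) * amplitude s (- 1) \<phi> ^ (d - 2) = \<kappa> * (\<theta> - y) / (c * (1 - y))"
      proof -
        have "exp (- B) * amplitude s (- 1) \<phi> ^ (d - 2) = \<kappa> * (\<theta> - y) / amplitude s (- 1) \<phi>"
          using Em[unfolded pow(2)[of "amplitude s (- 1) \<phi>"]] ap by (simp add: eq_divide_eq mult.assoc)
        then show ?thesis by (simp add: tan(1) c_def)
      qed
      moreover have "(amplitude' s (- 1) \<phi>)\<^sup>2 = c\<^sup>2 / \<theta> * (\<theta> + y)\<^sup>2"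
        unfolding tan(2) c_def \<theta>_def by (simp add: power_mult_distrib power_divide power2_eq_square algebra_simps)
      ultimately have "exp (- B) * amplitude s (- 1) \<phi> ^ (d - 2) * (amplitude' s (- 1) \<phi>)\<^sup>2
        = \<kappa> * (\<theta> - y) / (c * (1 - y)) * (c\<^sup>2 / \<theta> * (\<theta> + y)\<^sup>2)" by simp
      also have "\<dots> = \<kappa> * c / \<theta> * ((\<theta> + y) * (\<theta> - y)) * ((\<theta> + y) / (1 - y))"
        using c y th by (simp add: power2_eq_square mult_ac)
      also have "(\<theta> + y) * (\<theta> - y) = \<theta>\<^sup>2 - y\<^sup>2" by (simp add: power2_eq_square algebra_simps)
      finally show ?thesis .
    qed
    have frac: "(\<theta> - y) / (1 + y) + (\<theta> + y) / (1 - y) = 2 * (\<theta> + y\<^sup>2) / (1 - y\<^sup>2)"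
    proof -
      have "(\<theta> - y) / (1 + y) + (\<theta> + y) / (1 - y) = ((\<theta> - y) * (1 - y) + (\<theta> + y) * (1 + y)) / ((1 + y) * (1 - y))"
        using y by (subst add_frac_eq) auto
      also have "\<dots> = 2 * (\<theta> + y\<^sup>2) / (1 - y\<^sup>2)"
        by (simp add: power2_eq_square algebra_simps)
      finally show ?thesis .
    qed
    have sum: "exp B * amplitude s 1 \<phi> ^ (d - 2) * (amplitude' s 1 \<phi>)\<^sup>2 +
        exp (- B) * amplitude s (- 1) \<phi> ^ (d - 2) * (amplitude' s (- 1) \<phi>)\<^sup>2 = P * ((\<theta>\<^sup>2 - y\<^sup>2) / (\<theta> * (1 - y\<^sup>2)))"
    proof -
      have "exp B * amplitude s 1 \<phi> ^ (d - 2) * (amplitude' s 1 \<phi>)\<^sup>2 +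
        exp (- B) * amplitude s (- 1) \<phi> ^ (d - 2) * (amplitude' s (- 1) \<phi>)\<^sup>2 =
        \<kappa> * c / \<theta> * (\<theta>\<^sup>2 - y\<^sup>2) * (2 * (\<theta> + y\<^sup>2) / (1 - y\<^sup>2))"
        unfolding 1 2 frac[symmetric] by (rule distrib_left[symmetric])
      then show ?thesis
        unfolding P by simp
    qed
    have P2: "exp B * (amplitude s 1 \<phi> ^ (d - 1) * amplitude s 1 \<phi>) +
        exp (- B) * (amplitude s (- 1) \<phi> ^ (d - 1) * amplitude s (- 1) \<phi>) = P"
      unfolding P_def site_weight_eq by (simp only: pow(1)[of "amplitude s _ \<phi>", symmetric])
    have "1 - y\<^sup>2 > 0"
      using st(2) th by (simp add: abs_square_less_1)
    then have "(real d - 1) * (P * ((\<theta>\<^sup>2 - y\<^sup>2) / (\<theta> * (1 - y\<^sup>2)))) - P = - (stability \<theta> d y / (\<theta> * (1 - y\<^sup>2))) * P"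
      using th by (simp add: stability_def divide_simps) (simp add: algebra_simps)
    then show "real d * ((1 - 0) ^ 0 * exp B * (real (d - 1) * amplitude s 1 \<phi> ^ (d - 2) * (amplitude' s 1 \<phi>)\<^sup>2
        - amplitude s 1 \<phi> ^ (d - 1) * amplitude s 1 \<phi>) +
      (- 1 - 0) ^ 0 * exp (- B) * (real (d - 1) * amplitude s (- 1) \<phi> ^ (d - 2) * (amplitude' s (- 1) \<phi>)\<^sup>2
        - amplitude s (- 1) \<phi> ^ (d - 1) * amplitude s (- 1) \<phi>)) =
      - (real d * stability \<theta> d y / (\<theta> * (1 - y\<^sup>2))) * P" (is "?lhs = ?rhs")
    proof -
      assume *: "(real d - 1) * (P * ((\<theta>\<^sup>2 - y\<^sup>2) / (\<theta> * (1 - y\<^sup>2)))) - P = - (stability \<theta> d y / (\<theta> * (1 - y\<^sup>2))) * P"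
      have "real (d - 1) = real d - 1" using d by simp
      then have "?lhs = real d * ((real d - 1) * (P * ((\<theta>\<^sup>2 - y\<^sup>2) / (\<theta> * (1 - y\<^sup>2)))) - P)"
        unfolding sum[symmetric] unfolding P2[symmetric] by (simp only: power_0 mult_1 right_diff_distrib distrib_left mult.assoc mult.left_commute)
      then show ?thesis unfolding * by simp
    qed
  qed
  show "ln P = real d / 2 * ln (\<theta> / (\<theta> + y\<^sup>2)) + ln (exp B * (1 + y) ^ d + exp (- B) * (1 - y) ^ d)"
  proof -
    have pos: "exp B * (1 + y) ^ d + exp (- B) * (1 - y) ^ d > 0"
      using y by (intro add_pos_pos) auto
    have "P = c ^ d * (exp B * (1 + y) ^ d + exp (- B) * (1 - y) ^ d)"
      unfolding P_def site_weight_eq tan(1) c_def power_mult_distrib by (simp add: algebra_simps)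
    then have "ln P = real d * ln c + ln (exp B * (1 + y) ^ d + exp (- B) * (1 - y) ^ d)"
      using c pos by (simp add: ln_mult ln_realpow)
    moreover have "2 * ln c = ln (\<theta> / (\<theta> + y\<^sup>2))"
      using c tan(4) ln_realpow[of c 2] by (simp add: c_def)
    ultimately show ?thesis by simp
  qed
qed

section \<open>Derivatives of the pressure in the field\<close>

lemma regular_open:
  assumes "regular \<theta> d B"
  obtains \<epsilon> where "\<epsilon> > 0" "\<And>b. \<bar>b - B\<bar> < \<epsilon> \<Longrightarrow> regular \<theta> d b"
proof (cases "(real d - 1) * \<theta> < 1")
  case True
  then show ?thesis using that[of 1] by (simp add: regular_def)
next
  case False
  then have "B \<noteq> 0" using assms by (simp add: regular_def)
  moreover have "regular \<theta> d b" if "\<bar>b - B\<bar> < \<bar>B\<bar>" for b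
    using that by (cases "b = 0") (auto simp: regular_def)
  ultimately show ?thesis using that[of "\<bar>B\<bar>"] by simp
qed

text \<open>
  Near \<open>y\<close> all points are stable, so \<open>bias \<theta> d\<close> inverts \<open>field_of \<theta> d\<close> there, and the derivative of
  \<open>field_of \<theta> d\<close> at \<open>y\<close> is positive.
\<close>
lemma has_real_derivative_bias:
  assumes "0 < \<theta>" "\<theta> < 1" "d \<ge> 2" "regular \<theta> d B"
  defines "y \<equiv> bias \<theta> d B"
  shows "(bias \<theta> d has_real_derivative inverse (stability \<theta> d y / ((\<theta>\<^sup>2 - y\<^sup>2) * (1 - y\<^sup>2)))) (at B)"
proof -
  note y = bias_props[OF assms(1-4), folded y_def]
  have deriv: "(field_of \<theta> d has_real_derivative stability \<theta> d z / ((\<theta>\<^sup>2 - z\<^sup>2) * (1 - z\<^sup>2))) (at z)"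
    if "\<bar>z\<bar> < \<theta>" for z
    using has_real_derivative_field_of[OF that assms(2)] .
  have "stability \<theta> d y > 0"
    using stable_stability_pos[OF assms(3,1,2) y(1)] .
  then have "stability \<theta> d y / ((\<theta>\<^sup>2 - y\<^sup>2) * (1 - y\<^sup>2)) > 0"
    using field_of_denom_pos[OF y(3) assms(2)] by (rule divide_pos_pos)
  then have D: "stability \<theta> d y / ((\<theta>\<^sup>2 - y\<^sup>2) * (1 - y\<^sup>2)) \<noteq> 0"
    by (rule less_imp_neq[symmetric])
  have "\<forall>\<^sub>F z in at y. stable \<theta> d z"
  proof -
    have "((\<lambda>z. \<bar>z\<bar>) \<longlongrightarrow> \<bar>y\<bar>) (at y)"
      by (intro tendsto_intros)
    then have 1: "\<forall>\<^sub>F z in at y. \<bar>z\<bar> < \<theta>"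
      using y(3) by (rule order_tendstoD(2))
    show ?thesis
    proof (cases "(real d - 1) * \<theta> < 1")
      case True
      show ?thesis using 1 by eventually_elim (simp add: stable_def True)
    next
      case False
      then have "0 < y * field_of \<theta> d y"
        using y(1) by (simp add: stable_def)
      moreover have "((\<lambda>z. z * field_of \<theta> d z) \<longlongrightarrow> y * field_of \<theta> d y) (at y)"
        using DERIV_isCont[OF deriv[OF y(3)]] by (intro tendsto_intros) (simp add: isCont_def)
      ultimately have "\<forall>\<^sub>F z in at y. 0 < z * field_of \<theta> d z"
        by (simp add: order_tendstoD(1))
      with 1 show ?thesis by eventually_elim (simp add: stable_def)
    qed
  qed
  then obtain \<delta> where \<delta>: "\<delta> > 0" "\<And>z. z \<noteq> y \<Longrightarrow> dist z y < \<delta> \<Longrightarrow> stable \<theta> d z"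
    by (auto simp: eventually_at)
  have st: "stable \<theta> d z" if "\<bar>z - y\<bar> \<le> \<delta> / 2" for z
    using \<delta> that y(1) by (cases "z = y") (auto simp: dist_real_def)
  have "isCont (bias \<theta> d) (field_of \<theta> d y)"
  proof (rule isCont_inverse_function[where d = "\<delta> / 2" and x = y and f = "field_of \<theta> d"])
    show "bias \<theta> d (field_of \<theta> d z) = z" if "\<bar>z - y\<bar> \<le> \<delta> / 2" for z
      using bias_eqI[OF assms(3,1,2) st[OF that]] by simp
    show "isCont (field_of \<theta> d) z" if "\<bar>z - y\<bar> \<le> \<delta> / 2" for z
      using st[OF that] DERIV_isCont[OF deriv] by (auto simp: stable_def)
  qed (use \<delta> in simp)
  then have cont: "isCont (bias \<theta> d) B"
    by (simp add: y(2))
  obtain \<epsilon> where \<epsilon>: "\<epsilon> > 0" "\<And>b. \<bar>b - B\<bar> < \<epsilon> \<Longrightarrow> regular \<theta> d b"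
    using regular_open[OF assms(4)] by blast
  show ?thesis
  proof (rule DERIV_inverse_function[of "field_of \<theta> d" _ _ _ "B - \<epsilon>" "B + \<epsilon>"])
    show "(field_of \<theta> d has_real_derivative stability \<theta> d y / ((\<theta>\<^sup>2 - y\<^sup>2) * (1 - y\<^sup>2))) (at (bias \<theta> d B))"
      using deriv[OF y(3)] by (simp add: y_def)
    show "field_of \<theta> d (bias \<theta> d b) = b" if "B - \<epsilon> < b" "b < B + \<epsilon>" for b
      using that by (intro bias_props(2)[OF assms(1-3)] \<epsilon>(2)) auto
  qed (use D \<epsilon> cont in auto)
qed

lemma has_real_derivative_mag_bias:
  assumes "0 < \<theta>" "\<theta> < 1" "d \<ge> 2" "regular \<theta> d B"
  defines "y \<equiv> bias \<theta> d B"
  shows "((\<lambda>B. mag_of \<theta> (bias \<theta> d B)) has_real_derivative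
    ((1 + \<theta>) * (\<theta> - y\<^sup>2) / (\<theta> + y\<^sup>2)\<^sup>2) / (stability \<theta> d y / ((\<theta>\<^sup>2 - y\<^sup>2) * (1 - y\<^sup>2)))) (at B)"
  using DERIV_chain2[OF has_real_derivative_mag_of[OF assms(1)] has_real_derivative_bias[OF assms(1-4)]]
  unfolding y_def by (simp add: divide_inverse)

definition free_energy :: "real \<Rightarrow> nat \<Rightarrow> real \<Rightarrow> real" where
  "free_energy \<theta> d B = (let y = bias \<theta> d B in
     real d / 2 * ln (\<theta> / (\<theta> + y\<^sup>2)) + ln (exp B * (1 + y) ^ d + exp (- B) * (1 - y) ^ d))"

text \<open>
  Envelope argument: the terms with the derivative of \<open>bias\<close> cancel by stationarity, and only the
  explicit dependence on the field remains.
\<close>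
lemma has_real_derivative_free_energy:
  assumes "0 < \<theta>" "\<theta> < 1" "d \<ge> 2" "regular \<theta> d B"
  shows "(free_energy \<theta> d has_real_derivative mag_of \<theta> (bias \<theta> d B)) (at B)"
proof -
  define y where "y = bias \<theta> d B"
  obtain y' where y': "(bias \<theta> d has_real_derivative y') (at B)"
    using has_real_derivative_bias[OF assms] by blast
  note b = bias_props[OF assms, folded y_def]
  have pos: "\<theta> + y > 0" "\<theta> - y > 0" "1 + y > 0" "1 - y > 0" and T: "\<theta> + y\<^sup>2 > 0"
    using b(3) assms by (auto simp: add_pos_nonneg)
  define \<kappa> where "\<kappa> = exp B * (1 + y) ^ (d - 1) / (\<theta> + y)"
  have \<kappa>: "\<kappa> > 0" using pos by (simp add: \<kappa>_def)
  have Ep: "exp B * (1 + y) ^ (d - 1) = \<kappa> * (\<theta> + y)"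
    using pos by (simp add: \<kappa>_def)
  have "exp (- B) * (1 - y) ^ (d - 1) * (\<theta> + y) = \<kappa> * (\<theta> - y) * (\<theta> + y)"
    using field_of_eq_iff[OF b(3) assms(2), of d B] b(2) assms(3) unfolding Ep by (auto simp: mult_ac)
  then have Em: "exp (- B) * (1 - y) ^ (d - 1) = \<kappa> * (\<theta> - y)"
    using pos by simp
  have pow: "x ^ d = x ^ (d - 1) * x" for x :: real
    using assms(3) by (simp add: power_Suc2[symmetric])
  have Ep': "exp B * (1 + y) ^ d = \<kappa> * (\<theta> + y) * (1 + y)"
    unfolding pow[of "1 + y"] Ep[symmetric] by simp
  have Em': "exp (- B) * (1 - y) ^ d = \<kappa> * (\<theta> - y) * (1 - y)"
    unfolding pow[of "1 - y"] Em[symmetric] by simp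
  define W where "W = (\<lambda>B. exp B * (1 + bias \<theta> d B) ^ d + exp (- B) * (1 - bias \<theta> d B) ^ d)"
  have W: "W B = 2 * \<kappa> * (\<theta> + y\<^sup>2)"
    unfolding W_def y_def[symmetric] Ep' Em' by (simp add: power2_eq_square algebra_simps)
  have "(W has_real_derivative
      (exp B * (1 + y) ^ d - exp (- B) * (1 - y) ^ d)
      + real d * y' * (exp B * (1 + y) ^ (d - 1) - exp (- B) * (1 - y) ^ (d - 1))) (at B)"
    unfolding W_def
    by (rule derivative_eq_intros refl y' | simp)+ (simp add: y_def algebra_simps)
  also have "(exp B * (1 + y) ^ d - exp (- B) * (1 - y) ^ d)
      + real d * y' * (exp B * (1 + y) ^ (d - 1) - exp (- B) * (1 - y) ^ (d - 1)) =
      2 * \<kappa> * (y * (1 + \<theta>) + real d * y' * y)"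
    unfolding Ep' Em' Ep Em by (simp add: algebra_simps)
  finally have dW: "(W has_real_derivative 2 * \<kappa> * (y * (1 + \<theta>) + real d * y' * y)) (at B)" .
  have "((\<lambda>B. ln (W B)) has_real_derivative 1 / W B * (2 * \<kappa> * (y * (1 + \<theta>) + real d * y' * y))) (at B)"
    using W \<kappa> T by (intro DERIV_chain2[OF DERIV_ln_divide] dW) simp
  also have "1 / W B * (2 * \<kappa> * (y * (1 + \<theta>) + real d * y' * y)) = mag_of \<theta> y + real d * y' * y / (\<theta> + y\<^sup>2)"
    unfolding W mag_of_def add_divide_distrib[symmetric] using \<kappa> by simp
  finally have 1: "((\<lambda>B. ln (W B)) has_real_derivative mag_of \<theta> y + real d * y' * y / (\<theta> + y\<^sup>2)) (at B)" .
  have T': "\<theta> + (bias \<theta> d b)\<^sup>2 > 0" for b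
    using assms(1) by (simp add: add_pos_nonneg)
  have "((\<lambda>B. ln (\<theta> + (bias \<theta> d B)\<^sup>2)) has_real_derivative 1 / (\<theta> + y\<^sup>2) * (2 * y * y')) (at B)"
    unfolding y_def using T' y'
    by (intro DERIV_chain2[OF DERIV_ln_divide]) (auto intro!: derivative_eq_intros)
  then have 2: "((\<lambda>B. real d / 2 * (ln \<theta> - ln (\<theta> + (bias \<theta> d B)\<^sup>2))) has_real_derivative
      real d / 2 * (0 - 1 / (\<theta> + y\<^sup>2) * (2 * y * y'))) (at B)"
    by (intro DERIV_cmult DERIV_diff DERIV_const)
  have "free_energy \<theta> d = (\<lambda>B. real d / 2 * (ln \<theta> - ln (\<theta> + (bias \<theta> d B)\<^sup>2)) + ln (W B))"
    using T' assms(1) by (simp add: free_energy_def W_def Let_def fun_eq_iff ln_divide_pos)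
  moreover have "real d / 2 * (0 - 1 / (\<theta> + y\<^sup>2) * (2 * y * y')) + (mag_of \<theta> y + real d * y' * y / (\<theta> + y\<^sup>2))
      = mag_of \<theta> y"
    by simp
  ultimately show ?thesis
    using DERIV_add[OF 2 1] by (simp add: y_def)
qed

lemma sqrt_tanh:
  assumes "\<beta> > (0::real)"
  shows "0 < sqrt (tanh \<beta>)" "sqrt (tanh \<beta>) < 1" "(sqrt (tanh \<beta>))\<^sup>2 = tanh \<beta>" "0 < tanh \<beta>" "tanh \<beta> < 1"
  using assms tanh_real_lt_1[of \<beta>] by auto

lemma pressure_eq_free_energy:
  assumes "\<beta> > 0" "d \<ge> 2" "regular (tanh \<beta>) d B"
  shows "pressure d \<beta> B = real d / 2 * ln (cosh \<beta>) + free_energy (tanh \<beta>) d B"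
proof -
  note s = sqrt_tanh[OF assms(1)]
  obtain \<phi> where \<phi>: "maximizer (sqrt (tanh \<beta>)) B d \<phi>"
    using maximizer_exists by blast
  have "bias (tanh \<beta>) d B = sqrt (tanh \<beta>) * tan \<phi>"
    using bias_maximizer[OF s(1,2) assms(2) \<phi>] assms(3) s(3) by simp
  moreover have "pressure d \<beta> B = real d / 2 * ln (cosh \<beta>) + ln (site_weight (sqrt (tanh \<beta>)) B d \<phi>)"
    using assms \<phi> by (intro pressure_eq_log_max(1)) (auto simp: maximizer_def)
  ultimately show ?thesis
    using maximizer_local_data(5)[OF s(1,2) assms(2) \<phi>] s(3)
    by (simp add: free_energy_def Let_def)
qed

lemma has_real_derivative_pressure:
  assumes "\<beta> > 0" "d \<ge> 2" "regular (tanh \<beta>) d B"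
  shows "(pressure d \<beta> has_real_derivative mag_of (tanh \<beta>) (bias (tanh \<beta>) d B)) (at B)"
proof -
  note s = sqrt_tanh[OF assms(1)]
  obtain \<epsilon> where \<epsilon>: "\<epsilon> > 0" "\<And>b. \<bar>b - B\<bar> < \<epsilon> \<Longrightarrow> regular (tanh \<beta>) d b"
    using regular_open[OF assms(3)] by blast
  have "((\<lambda>B. real d / 2 * ln (cosh \<beta>) + free_energy (tanh \<beta>) d B) has_real_derivative
      0 + mag_of (tanh \<beta>) (bias (tanh \<beta>) d B)) (at B)"
    by (intro DERIV_add DERIV_const has_real_derivative_free_energy s assms)
  then have D: "((\<lambda>B. real d / 2 * ln (cosh \<beta>) + free_energy (tanh \<beta>) d B) has_real_derivative
      mag_of (tanh \<beta>) (bias (tanh \<beta>) d B)) (at B)"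
    by simp
  show ?thesis
  proof (rule has_field_derivative_transform_within[OF D \<epsilon>(1)])
    fix b assume "b \<in> UNIV" "dist b B < \<epsilon>"
    then show "real d / 2 * ln (cosh \<beta>) + free_energy (tanh \<beta>) d b = pressure d \<beta> b"
      using pressure_eq_free_energy[OF assms(1,2) \<epsilon>(2), of b] by (simp add: dist_real_def)
  qed simp
qed

lemma has_real_derivative_deriv_pressure:
  assumes "\<beta> > 0" "d \<ge> 2" "regular (tanh \<beta>) d B"
  assumes D: "((\<lambda>B. mag_of (tanh \<beta>) (bias (tanh \<beta>) d B)) has_real_derivative D) (at B)"
  shows "(deriv (pressure d \<beta>) has_real_derivative D) (at B)"
proof -
  obtain \<epsilon> where \<epsilon>: "\<epsilon> > 0" "\<And>b. \<bar>b - B\<bar> < \<epsilon> \<Longrightarrow> regular (tanh \<beta>) d b"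
    using regular_open[OF assms(3)] by blast
  show ?thesis
  proof (rule has_field_derivative_transform_within[OF D \<epsilon>(1)])
    fix b assume "b \<in> UNIV" "dist b B < \<epsilon>"
    then show "mag_of (tanh \<beta>) (bias (tanh \<beta>) d b) = deriv (pressure d \<beta>) b"
      using DERIV_imp_deriv[OF has_real_derivative_pressure[OF assms(1,2) \<epsilon>(2), of b]] by (simp add: dist_real_def)
  qed simp
qed

lemma maximizer_infinite_temperature:
  "maximizer 0 B d 0"
proof -
  have "\<bar>cos \<phi> ^ d * (exp B + exp (- B))\<bar> \<le> 1 * (exp B + exp (- B))" for \<phi>
    unfolding abs_mult power_abs by (intro mult_mono power_le_one) (auto simp: abs_if)
  then have "\<bar>site_weight 0 B d \<phi>\<bar> \<le> exp B + exp (- B)" for \<phi>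
    by (simp add: site_weight_eq amplitude_def algebra_simps)
  moreover have "exp B + exp (- B) > 0"
    by (intro add_pos_pos) auto
  ultimately show ?thesis
    by (simp add: maximizer_def) (simp add: site_weight_eq amplitude_def)
qed

lemma pressure_infinite_temperature:
  assumes "d \<ge> 2"
  shows "pressure d 0 B = ln (2 * cosh B)"
proof -
  have "pressure d 0 B = real d / 2 * ln (cosh 0) + ln (site_weight (sqrt (tanh 0)) B d 0)"
    using assms maximizer_infinite_temperature[of B d] by (intro pressure_eq_log_max(1)) (auto simp: maximizer_def)
  moreover have "2 * cosh B = exp B + exp (- B)"
    unfolding cosh_field_def by (simp add: field_simps)
  ultimately show ?thesis
    by (simp add: site_weight_eq amplitude_def)
qed

lemma has_real_derivative_pressure_infinite_temperature:
  assumes "d \<ge> 2"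
  shows "(pressure d 0 has_real_derivative tanh B) (at B)"
    and "(deriv (pressure d 0) has_real_derivative 1 - (tanh B)\<^sup>2) (at B)"
proof -
  have *: "pressure d 0 = (\<lambda>B. ln (2 * cosh B))"
    using pressure_infinite_temperature[OF assms] by auto
  show 1: "(pressure d 0 has_real_derivative tanh B) (at B)" for B
    unfolding * by (auto intro!: derivative_eq_intros simp: tanh_def cosh_real_pos)
  have "deriv (pressure d 0) = tanh"
    using DERIV_imp_deriv[OF 1] by auto
  then show "(deriv (pressure d 0) has_real_derivative 1 - (tanh B)\<^sup>2) (at B)"
    by (auto intro!: derivative_eq_intros)
qed

section \<open>Limits of pressure, magnetization and susceptibility\<close>

text \<open>
  Serves to treat the parity of \<open>d * n\<close>: the extra half-edge makes the quantities for \<open>n\<close> vertices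
  alternate between two sequences, which have the same limit.
\<close>
lemma limit_of_interleaved:
  fixes X :: "nat \<Rightarrow> real"
  assumes "\<And>n. n \<ge> 1 \<Longrightarrow> X n = U (e n) n" "\<And>n. e n \<in> {a, b}" "U a \<longlonglongrightarrow> L" "U b \<longlonglongrightarrow> L"
  shows "X \<longlonglongrightarrow> L"
proof (rule LIMSEQ_I)
  fix r :: real assume "r > 0"
  obtain N1 where N1: "\<And>n. n \<ge> N1 \<Longrightarrow> norm (U a n - L) < r"
    using LIMSEQ_D[OF assms(3) \<open>r > 0\<close>] by blast
  obtain N2 where N2: "\<And>n. n \<ge> N2 \<Longrightarrow> norm (U b n - L) < r"
    using LIMSEQ_D[OF assms(4) \<open>r > 0\<close>] by blast
  have "norm (X n - L) < r" if "n \<ge> max 1 (max N1 N2)" for n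
    using that N1[of n] N2[of n] assms(1)[of n] assms(2)[of n] by auto
  then show "\<exists>N. \<forall>n\<ge>N. norm (X n - L) < r" by blast
qed

lemma exceptional_degree_cases: "exceptional_degree d n \<in> {d, d + 1}"
  by (simp add: exceptional_degree_def)

text \<open>
  Site weights of even degree are nonnegative. If \<open>d\<close> is odd and \<open>n\<close> is odd, the exceptional degree and
  the exponent \<open>n - 1\<close> are even; if \<open>d\<close> is odd and \<open>n\<close> is even, the product is an \<open>n\<close>th power.
\<close>
lemma weight_product_nonneg:
  assumes "n \<ge> 1"
  shows "site_weight s B d \<phi> ^ (n - 1) * site_weight s B (exceptional_degree d n) \<phi> =
    \<bar>site_weight s B d \<phi>\<bar> ^ (n - 1) * \<bar>site_weight s B (exceptional_degree d n) \<phi>\<bar>"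
proof -
  have even_nonneg: "site_weight s B D \<phi> \<ge> 0" if "even D" for D
    using that unfolding site_weight_eq by (intro add_nonneg_nonneg mult_nonneg_nonneg zero_le_even_power) auto
  have "site_weight s B d \<phi> ^ (n - 1) * site_weight s B (exceptional_degree d n) \<phi> \<ge> 0"
  proof (cases "odd d \<and> even n")
    case True
    then have "exceptional_degree d n = d" by (simp add: exceptional_degree_def)
    then have "site_weight s B d \<phi> ^ (n - 1) * site_weight s B (exceptional_degree d n) \<phi> = site_weight s B d \<phi> ^ n"
      using assms by (simp add: power_Suc2[symmetric] del: power_Suc)
    then show ?thesis using True by (simp add: zero_le_even_power)
  next
    case False
    then have "even (exceptional_degree d n)" "even d \<or> even (n - 1)"
      using assms by (auto simp: exceptional_degree_def)
    then have "site_weight s B d \<phi> ^ (n - 1) \<ge> 0"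
      using even_nonneg[of d] by (metis zero_le_even_power zero_le_power)
    then show ?thesis
      using even_nonneg[OF \<open>even (exceptional_degree d n)\<close>] by (rule mult_nonneg_nonneg)
  qed
  then show ?thesis
    by (metis abs_mult abs_of_nonneg power_abs)
qed

lemma annealed_partition_function_pos:
  assumes "w n \<in> {1..n}"
  shows "annealed_partition_function d w n \<beta> B > 0"
proof -
  let ?M = "perfect_matchings (half_edges d w n)"
  have M: "?M \<noteq> {}" "finite ?M"
    using assms by (simp_all add: perfect_matchings_half_edges_nonempty finite_perfect_matchings)
  have "spin_configs n \<noteq> {}"
    by (simp add: spin_configs_def PiE_eq_empty_iff)
  then have "partition_function n \<beta> B P > 0" for P
    unfolding partition_function_def by (intro sum_pos) auto
  then have "(\<Sum>P\<in>?M. partition_function n \<beta> B P) > 0"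
    using M by (intro sum_pos) auto
  moreover have "annealed_partition_function d w n \<beta> B = (\<Sum>P\<in>?M. partition_function n \<beta> B P) / real (card ?M)"
    unfolding annealed_partition_function_def configuration_model_def
    using M by (subst integral_pmf_of_set) auto
  ultimately show ?thesis
    using M by (simp add: card_gt_0_iff)
qed

text \<open>
  Both the integral in the numerator and the normalising integral of powers of the cosine grow
  exponentially at the rate of their maximum; the latter has maximum \<open>1\<close>.
\<close>
lemma pressure_limit:
  assumes "\<beta> \<ge> 0" "d \<ge> 2" and w: "\<And>n. n \<ge> 1 \<Longrightarrow> w n \<in> {1..n}"
  shows "(\<lambda>n. pressure_n d w n \<beta> B) \<longlonglongrightarrow> pressure d \<beta> B"
proof -
  define s where "s = sqrt (tanh \<beta>)"
  have s: "0 \<le> s" "s < 1"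
    using assms(1) tanh_real_lt_1[of \<beta>] by (auto simp: s_def)
  obtain \<phi> where \<phi>: "maximizer s B d \<phi>"
    using maximizer_exists by blast
  then have max: "\<phi> \<in> {-(pi/2)..pi/2}"
    "\<And>\<phi>'. \<phi>' \<in> {-(pi/2)..pi/2} \<Longrightarrow> \<bar>site_weight s B d \<phi>'\<bar> \<le> \<bar>site_weight s B d \<phi>\<bar>"
    by (auto simp: maximizer_def)
  have d1: "d \<ge> 1" using assms by simp
  note amp = maximizer_amplitudes_pos[OF s d1 max]
  have pos: "site_weight s B D \<phi> > 0" for D
    using site_weight_pos[OF amp(1,2)] .
  define J where "J = (\<lambda>D n. integral {-(pi/2)..pi/2} (\<lambda>\<phi>. \<bar>site_weight s B d \<phi>\<bar> ^ (n - 1) * \<bar>site_weight s B D \<phi>\<bar>))"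
  define K where "K = (\<lambda>D n. integral {-(pi/2)..pi/2} (\<lambda>\<phi>. \<bar>cos \<phi> ^ d\<bar> ^ (n - 1) * \<bar>cos \<phi> ^ D\<bar>))"
  define U where "U = (\<lambda>D n. real (d * (n - 1) + D) / (2 * real n) * ln (cosh \<beta>)
      - 1 / real n * ln (K D n) + 1 / real n * ln (J D n))"
  have J: "(\<lambda>n. 1 / real n * ln (J D n)) \<longlonglongrightarrow> ln (site_weight s B d \<phi>)" for D
    using log_laplace[of "-(pi/2)" "pi/2" "site_weight s B d" "site_weight s B D" \<phi>] amp(3) max(2)
      pos[of D] pos[of d] unfolding J_def by (auto simp: continuous_on_site_moment)
  have K: "(\<lambda>n. 1 / real n * ln (K D n)) \<longlonglongrightarrow> 0" for D
    using log_laplace[of "-(pi/2)" "pi/2" "\<lambda>\<phi>. cos \<phi> ^ d" "\<lambda>\<phi>. cos \<phi> ^ D" 0]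
    unfolding K_def by (auto simp: continuous_intros power_abs power_le_one)
  have N: "(\<lambda>n. real (d * (n - 1) + D) / (2 * real n)) \<longlonglongrightarrow> real d / 2" for D
  proof -
    have "(\<lambda>n. (real d * real n + (real D - real d)) / (2 * real n)) \<longlonglongrightarrow> real d / 2"
      by real_asymp
    moreover have "\<forall>\<^sub>F n in sequentially. (real d * real n + (real D - real d)) / (2 * real n)
        = real (d * (n - 1) + D) / (2 * real n)"
      using eventually_ge_at_top[of 1]
    proof eventually_elim
      case (elim n)
      then have "real (n - 1) = real n - 1" by simp
      then show ?case
        by (simp only: of_nat_add of_nat_mult) (simp add: algebra_simps)
    qed
    ultimately show ?thesis by (rule Lim_transform_eventually)
  qed
  have U: "U D \<longlonglongrightarrow> pressure d \<beta> B" for D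
  proof -
    have "U D \<longlonglongrightarrow> real d / 2 * ln (cosh \<beta>) - 0 + ln (site_weight s B d \<phi>)"
      unfolding U_def by (intro tendsto_intros N J K)
    then show ?thesis
      using pressure_eq_log_max(1)[OF assms(1) d1 max(1)] max(2) by (simp add: s_def)
  qed
  show ?thesis
  proof (rule limit_of_interleaved[where U = U and e = "exceptional_degree d" and a = d and b = "d + 1"])
    fix n :: nat assume n: "n \<ge> 1"
    define D where "D = exceptional_degree d n"
    define N where "N = d * (n - 1) + D"
    have "even N"
      using card_half_edges(2)[of w n d] w[OF n] by (simp add: N_def D_def)
    then have N2: "real (N div 2) = real N / 2"
      by (simp add: real_of_nat_div)
    have "cos_integral N = K D n"
      unfolding K_def
    proof (rule integral_cong)
      fix \<phi> :: real assume "\<phi> \<in> {-(pi/2)..pi/2}"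
      then have "cos \<phi> \<ge> 0" by (intro cos_ge_zero) auto
      then show "cos \<phi> ^ N = \<bar>cos \<phi> ^ d\<bar> ^ (n - 1) * \<bar>cos \<phi> ^ D\<bar>"
        by (simp add: N_def power_add power_mult)
    qed
    then have Kpos: "K D n > 0"
      using cos_integral_pos[of N] by simp
    have Z: "annealed_partition_function d w n \<beta> B = cosh \<beta> ^ (N div 2) / K D n * J D n"
      using annealed_partition_function_eq[of \<beta> w n d B] assms(1) w[OF n] weight_product_nonneg[OF n]
        \<open>cos_integral N = K D n\<close> by (simp add: N_def D_def s_def J_def)
    then have "cosh \<beta> ^ (N div 2) / K D n * J D n > 0"
      using annealed_partition_function_pos[of w n d \<beta> B] w[OF n] by simp
    moreover have "cosh \<beta> ^ (N div 2) / K D n > 0"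
      using Kpos by (simp add: cosh_real_pos)
    ultimately have Jpos: "J D n > 0"
      by (rule zero_less_mult_pos)
    have "ln (annealed_partition_function d w n \<beta> B) = real N / 2 * ln (cosh \<beta>) - ln (K D n) + ln (J D n)"
      unfolding Z using Kpos Jpos cosh_real_pos[of \<beta>] N2
      by (simp add: ln_mult_pos ln_divide_pos ln_realpow)
    then show "pressure_n d w n \<beta> B = U (exceptional_degree d n) n"
      unfolding pressure_n_def U_def D_def[symmetric] N_def[symmetric]
      by (simp add: add_divide_distrib diff_divide_distrib mult.commute)
  qed (use U exceptional_degree_cases in auto)
qed

lemma sum_annealed_mass:
  assumes "\<beta> \<ge> 0" "w n \<in> {1..n}"
  shows "(\<Sum>\<sigma>\<in>spin_configs n. annealed_mass d w n \<beta> B \<sigma>) = 1"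
proof -
  let ?M = "perfect_matchings (half_edges d w n)"
  have M: "?M \<noteq> {}" "finite ?M"
    using assms by (simp_all add: perfect_matchings_half_edges_nonempty finite_perfect_matchings)
  have "annealed_partition_function d w n \<beta> B = (\<Sum>\<sigma>\<in>spin_configs n.
      measure_pmf.expectation (configuration_model d w n) (\<lambda>P. exp (- hamiltonian n \<beta> B P \<sigma>)))"
    unfolding annealed_partition_function_def partition_function_def configuration_model_def
    using M by (intro Bochner_Integration.integral_sum integrable_measure_pmf_finite) simp
  then show ?thesis
    unfolding annealed_mass_def sum_divide_distrib[symmetric]
    using annealed_partition_function_pos[of w n d \<beta> B] assms(2) by simp
qed

lemma annealed_expectation_affine:
  assumes "\<beta> \<ge> 0" "w n \<in> {1..n}"
  shows "annealed_expectation d w n \<beta> B (\<lambda>\<sigma>. a * X \<sigma> + c) = a * annealed_expectation d w n \<beta> B X + c"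
proof -
  have "annealed_expectation d w n \<beta> B (\<lambda>\<sigma>. a * X \<sigma> + c) =
    (\<Sum>\<sigma>\<in>spin_configs n. a * (annealed_mass d w n \<beta> B \<sigma> * X \<sigma>) + c * annealed_mass d w n \<beta> B \<sigma>)"
    unfolding annealed_expectation_def by (intro sum.cong refl) (simp add: algebra_simps)
  also have "\<dots> = a * annealed_expectation d w n \<beta> B X + c * (\<Sum>\<sigma>\<in>spin_configs n. annealed_mass d w n \<beta> B \<sigma>)"
    unfolding annealed_expectation_def by (simp add: sum.distrib sum_distrib_left)
  finally show ?thesis
    using sum_annealed_mass[of \<beta> w n d B] assms by simp
qed

lemma annealed_variance_shift:
  assumes "\<beta> \<ge> 0" "w n \<in> {1..n}"
  shows "annealed_variance d w n \<beta> B X =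
    annealed_expectation d w n \<beta> B (\<lambda>\<sigma>. (X \<sigma> - c)\<^sup>2) - (annealed_expectation d w n \<beta> B X - c)\<^sup>2"
proof -
  define e where "e = annealed_expectation d w n \<beta> B X"
  let ?E = "annealed_expectation d w n \<beta> B"
  have "?E (\<lambda>\<sigma>. (X \<sigma> - c)\<^sup>2) - (e - c)\<^sup>2 = ?E (\<lambda>\<sigma>. (X \<sigma> - e)\<^sup>2)"
  proof -
    have "?E (\<lambda>\<sigma>. (X \<sigma> - c)\<^sup>2) = ?E (\<lambda>\<sigma>. (X \<sigma> - e)\<^sup>2 + (2 * (e - c) * X \<sigma> + (c\<^sup>2 - e\<^sup>2)))"
      by (rule arg_cong[where f = ?E]) (auto simp: power2_eq_square algebra_simps)
    also have "\<dots> = ?E (\<lambda>\<sigma>. (X \<sigma> - e)\<^sup>2) + ?E (\<lambda>\<sigma>. 2 * (e - c) * X \<sigma> + (c\<^sup>2 - e\<^sup>2))"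
      unfolding annealed_expectation_def by (simp add: sum.distrib distrib_left)
    also have "?E (\<lambda>\<sigma>. 2 * (e - c) * X \<sigma> + (c\<^sup>2 - e\<^sup>2)) = 2 * (e - c) * e + (c\<^sup>2 - e\<^sup>2)"
      using annealed_expectation_affine[of \<beta> w n d B "2 * (e - c)" X "c\<^sup>2 - e\<^sup>2"] assms by (simp add: e_def)
    finally show ?thesis
      by (simp add: power2_eq_square algebra_simps)
  qed
  then show ?thesis
    by (simp add: annealed_variance_def e_def)
qed

text \<open>
  The variance is computed from the moments around the deterministic value \<open>n * m\<close>. It suffices that
  the mean of the deviation is of smaller order than \<open>sqrt n\<close>.
\<close>
lemma magnetization_susceptibility_of_centred_moments:
  fixes m V B :: real and d :: nat
  assumes "\<beta> \<ge> 0" and w: "\<And>n. n \<ge> 1 \<Longrightarrow> w n \<in> {1..n}"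
  defines "T1 \<equiv> \<lambda>n. annealed_expectation d w n \<beta> B (\<lambda>\<sigma>. total_spin n \<sigma> - real n * m) / sqrt (real n)"
    and "T2 \<equiv> \<lambda>n. annealed_expectation d w n \<beta> B (\<lambda>\<sigma>. (total_spin n \<sigma> - real n * m)\<^sup>2) / real n"
  assumes T1: "T1 \<longlonglongrightarrow> 0" and T2: "T2 \<longlonglongrightarrow> V"
  shows "(\<lambda>n. magnetization_n d w n \<beta> B) \<longlonglongrightarrow> m" "(\<lambda>n. susceptibility_n d w n \<beta> B) \<longlonglongrightarrow> V"
proof -
  have "(\<lambda>n. T1 n * (1 / sqrt (real n)) + m) \<longlonglongrightarrow> 0 * 0 + m"
    by (intro tendsto_add tendsto_mult T1 tendsto_const) real_asymp
  moreover have "\<forall>\<^sub>F n in sequentially. T1 n * (1 / sqrt (real n)) + m = magnetization_n d w n \<beta> B"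
    using eventually_ge_at_top[of 1]
  proof eventually_elim
    case (elim n)
    have "magnetization_n d w n \<beta> B =
        annealed_expectation d w n \<beta> B (\<lambda>\<sigma>. 1 / real n * (total_spin n \<sigma> - real n * m) + m)"
      unfolding magnetization_n_def using elim by (simp add: diff_divide_distrib)
    also have "\<dots> = 1 / real n * annealed_expectation d w n \<beta> B (\<lambda>\<sigma>. total_spin n \<sigma> - real n * m) + m"
      by (rule annealed_expectation_affine[where w = w and n = n, OF assms(1) w[OF elim]])
    finally show ?case
      by (simp add: T1_def)
  qed
  ultimately show "(\<lambda>n. magnetization_n d w n \<beta> B) \<longlonglongrightarrow> m"
    by (simp add: Lim_transform_eventually)
  have "(\<lambda>n. T2 n - (T1 n)\<^sup>2) \<longlonglongrightarrow> V - 0\<^sup>2"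
    by (intro tendsto_intros T1 T2)
  moreover have "\<forall>\<^sub>F n in sequentially. T2 n - (T1 n)\<^sup>2 = susceptibility_n d w n \<beta> B"
    using eventually_ge_at_top[of 1]
  proof eventually_elim
    case (elim n)
    let ?E = "annealed_expectation d w n \<beta> B"
    have n: "sqrt (real n) > 0" "sqrt (real n) * sqrt (real n) = real n" using elim by simp_all
    have X: "total_spin n \<sigma> / sqrt (real n) - sqrt (real n) * m = 1 / sqrt (real n) * (total_spin n \<sigma> - real n * m)" for \<sigma>
      using n by (simp add: field_simps)
    have "?E (\<lambda>\<sigma>. total_spin n \<sigma> / sqrt (real n)) = ?E (\<lambda>\<sigma>. 1 / sqrt (real n) * (total_spin n \<sigma> - real n * m) + sqrt (real n) * m)"
      unfolding X[symmetric] by simp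
    also have "\<dots> = 1 / sqrt (real n) * ?E (\<lambda>\<sigma>. total_spin n \<sigma> - real n * m) + sqrt (real n) * m"
      by (rule annealed_expectation_affine[where w = w and n = n, OF assms(1) w[OF elim]])
    finally have 1: "?E (\<lambda>\<sigma>. total_spin n \<sigma> / sqrt (real n)) - sqrt (real n) * m = T1 n"
      by (simp add: T1_def)
    have "?E (\<lambda>\<sigma>. (total_spin n \<sigma> / sqrt (real n) - sqrt (real n) * m)\<^sup>2) =
        ?E (\<lambda>\<sigma>. 1 / real n * (total_spin n \<sigma> - real n * m)\<^sup>2 + 0)"
      unfolding X using elim by (simp add: power_mult_distrib power_divide)
    also have "\<dots> = 1 / real n * ?E (\<lambda>\<sigma>. (total_spin n \<sigma> - real n * m)\<^sup>2) + 0"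
      by (rule annealed_expectation_affine[where w = w and n = n, OF assms(1) w[OF elim]])
    finally have 2: "?E (\<lambda>\<sigma>. (total_spin n \<sigma> / sqrt (real n) - sqrt (real n) * m)\<^sup>2) = T2 n"
      by (simp add: T2_def)
    show ?case
      unfolding susceptibility_n_def
        annealed_variance_shift[where w = w and n = n and c = "sqrt (real n) * m", OF assms(1) w[OF elim]] 1 2 ..
  qed
  ultimately show "(\<lambda>n. susceptibility_n d w n \<beta> B) \<longlonglongrightarrow> V"
    by (simp add: Lim_transform_eventually)
qed

text \<open>
  The mean and the mean square (below) of \<open>total_spin n \<sigma> - real n * m\<close> for \<open>n = j + 3\<close>, as quotients
  of integrals, with the exceptional degree \<open>D\<close> as a free parameter so that limits can be taken for
  fixed \<open>D\<close>.
\<close>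
definition centred_integral_1 :: "real \<Rightarrow> real \<Rightarrow> real \<Rightarrow> nat \<Rightarrow> nat \<Rightarrow> nat \<Rightarrow> real" where
  "centred_integral_1 s B m d D j =
     (let A = \<lambda>k. site_moment s B m k d; Q = \<lambda>k. site_moment s B m k D; I = \<lambda>f. integral {-(pi/2)..pi/2} f in
      (real (j + 2) * I (\<lambda>x. A 0 x ^ (j + 1) * A 1 x * Q 0 x) + I (\<lambda>x. A 0 x ^ (j + 2) * Q 1 x))
      / I (\<lambda>x. A 0 x ^ (j + 2) * Q 0 x))"

definition centred_integral_2 :: "real \<Rightarrow> real \<Rightarrow> real \<Rightarrow> nat \<Rightarrow> nat \<Rightarrow> nat \<Rightarrow> real" where
  "centred_integral_2 s B m d D j =
     (let A = \<lambda>k. site_moment s B m k d; Q = \<lambda>k. site_moment s B m k D; I = \<lambda>f. integral {-(pi/2)..pi/2} f in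
      (real (j + 2) * (real (j + 1) * I (\<lambda>x. A 0 x ^ j * (A 1 x)\<^sup>2 * Q 0 x)
        + I (\<lambda>x. A 0 x ^ (j + 1) * A 2 x * Q 0 x) + 2 * I (\<lambda>x. A 0 x ^ (j + 1) * A 1 x * Q 1 x))
        + I (\<lambda>x. A 0 x ^ (j + 2) * Q 2 x))
      / I (\<lambda>x. A 0 x ^ (j + 2) * Q 0 x))"

lemma site_moment_0: "site_moment s B m 0 D = site_weight s B D"
  by (simp add: site_moment_def fun_eq_iff)

lemma annealed_centred_moments:
  fixes m B :: real and d j :: nat
  assumes "\<beta> \<ge> 0" "w n \<in> {1..n}" "n = j + 3"
  defines "s \<equiv> sqrt (tanh \<beta>)" and "D \<equiv> exceptional_degree d n"
  shows "annealed_expectation d w n \<beta> B (\<lambda>\<sigma>. total_spin n \<sigma> - real n * m) = centred_integral_1 s B m d D j"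
    and "annealed_expectation d w n \<beta> B (\<lambda>\<sigma>. (total_spin n \<sigma> - real n * m)\<^sup>2) = centred_integral_2 s B m d D j"
proof -
  let ?S = "{-(pi/2)..pi/2}"
  have int: "f integrable_on ?S" if "continuous_on ?S f" for f :: "real \<Rightarrow> real"
    using that by (rule integrable_continuous_interval)
  note cont = continuous_on_site_moment
  define A where "A = (\<lambda>k. site_moment s B m k d)"
  define Q where "Q = (\<lambda>k. site_moment s B m k D)"
  have c: "continuous_on ?S (A k)" "continuous_on ?S (Q k)" for k
    by (simp_all add: A_def Q_def cont)
  have n1: "n - 1 = j + 2" using assms(3) by simp
  have den: "site_weight s B d \<phi> ^ (n - 1) * site_weight s B D \<phi> = A 0 \<phi> ^ (j + 2) * Q 0 \<phi>" for \<phi>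
    by (simp only: n1 A_def Q_def site_moment_0[of s B m])
  note M = sum_config_weight_moments[where w = w and n = n and j = j and s = s and B = B and m = m and d = d, OF assms(2,3), folded D_def]
  have M1: "(\<Sum>\<sigma>\<in>spin_configs n. (total_spin n \<sigma> - real n * m) * config_weight s B d w n \<sigma> \<phi>) =
      real (j + 2) * (A 0 \<phi> ^ (j + 1) * A 1 \<phi> * Q 0 \<phi>) + A 0 \<phi> ^ (j + 2) * Q 1 \<phi>" for \<phi>
    unfolding M(1) A_def Q_def by (simp only: mult.assoc)
  have M2: "(\<Sum>\<sigma>\<in>spin_configs n. (total_spin n \<sigma> - real n * m)\<^sup>2 * config_weight s B d w n \<sigma> \<phi>) =
      real (j + 2) * (real (j + 1) * (A 0 \<phi> ^ j * (A 1 \<phi>)\<^sup>2 * Q 0 \<phi>) + A 0 \<phi> ^ (j + 1) * A 2 \<phi> * Q 0 \<phi>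
        + 2 * (A 0 \<phi> ^ (j + 1) * A 1 \<phi> * Q 1 \<phi>)) + A 0 \<phi> ^ (j + 2) * Q 2 \<phi>" for \<phi>
    unfolding M(2) A_def Q_def by (simp only: mult.assoc)
  note E = annealed_expectation_eq[of \<beta> w n d B, OF assms(1,2), folded s_def D_def, unfolded den]
  show "annealed_expectation d w n \<beta> B (\<lambda>\<sigma>. total_spin n \<sigma> - real n * m) = centred_integral_1 s B m d D j"
    unfolding E M1 centred_integral_1_def Let_def A_def[symmetric] Q_def[symmetric]
    by (subst integral_add) (auto intro!: int continuous_intros c)
  show "annealed_expectation d w n \<beta> B (\<lambda>\<sigma>. (total_spin n \<sigma> - real n * m)\<^sup>2) = centred_integral_2 s B m d D j"
  proof -
    have i: "(\<lambda>x. A 0 x ^ j * (A 1 x)\<^sup>2 * Q 0 x) integrable_on ?S" "(\<lambda>x. A 0 x ^ (j + 1) * A 2 x * Q 0 x) integrable_on ?S"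
      "(\<lambda>x. A 0 x ^ (j + 1) * A 1 x * Q 1 x) integrable_on ?S" "(\<lambda>x. A 0 x ^ (j + 2) * Q 2 x) integrable_on ?S"
      by (intro int continuous_intros c)+
    show ?thesis
      unfolding E M2 centred_integral_2_def Let_def A_def[symmetric] Q_def[symmetric]
      using i by (simp only: integral_add integral_mult_right integrable_add integrable_on_mult_right)
  qed
qed

lemma limits_of_centred_integrals:
  fixes m V B :: real and d :: nat
  assumes "\<beta> \<ge> 0" and w: "\<And>n. n \<ge> 1 \<Longrightarrow> w n \<in> {1..n}"
  defines "s \<equiv> sqrt (tanh \<beta>)"
  assumes 1: "\<And>D. (\<lambda>j. centred_integral_1 s B m d D j / sqrt (real (j + 3))) \<longlonglongrightarrow> 0"
    and 2: "\<And>D. (\<lambda>j. centred_integral_2 s B m d D j / real (j + 3)) \<longlonglongrightarrow> V"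
  shows "(\<lambda>n. magnetization_n d w n \<beta> B) \<longlonglongrightarrow> m" "(\<lambda>n. susceptibility_n d w n \<beta> B) \<longlonglongrightarrow> V"
proof -
  let ?T1 = "\<lambda>n. annealed_expectation d w n \<beta> B (\<lambda>\<sigma>. total_spin n \<sigma> - real n * m) / sqrt (real n)"
  let ?T2 = "\<lambda>n. annealed_expectation d w n \<beta> B (\<lambda>\<sigma>. (total_spin n \<sigma> - real n * m)\<^sup>2) / real n"
  have w3: "w (j + 3) \<in> {1..j + 3}" for j
    by (rule w) simp
  have "(\<lambda>j. ?T1 (j + 3)) \<longlonglongrightarrow> 0"
  proof (rule limit_of_interleaved[where e = "\<lambda>j. exceptional_degree d (j + 3)" and a = d and b = "d + 1"])
    show "?T1 (j + 3) = centred_integral_1 s B m d (exceptional_degree d (j + 3)) j / sqrt (real (j + 3))" for j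
      using annealed_centred_moments(1)[of \<beta> w "j + 3" j d B m, OF assms(1) w3 refl] by (simp add: s_def)
  qed (use 1 exceptional_degree_cases in auto)
  then have T1: "?T1 \<longlonglongrightarrow> 0"
    by (rule LIMSEQ_offset)
  have "(\<lambda>j. ?T2 (j + 3)) \<longlonglongrightarrow> V"
  proof (rule limit_of_interleaved[where e = "\<lambda>j. exceptional_degree d (j + 3)" and a = d and b = "d + 1"])
    show "?T2 (j + 3) = centred_integral_2 s B m d (exceptional_degree d (j + 3)) j / real (j + 3)" for j
      using annealed_centred_moments(2)[of \<beta> w "j + 3" j d B m, OF assms(1) w3 refl] by (simp add: s_def)
  qed (use 2 exceptional_degree_cases in auto)
  then have T2: "?T2 \<longlonglongrightarrow> V"
    by (rule LIMSEQ_offset)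
  show "(\<lambda>n. magnetization_n d w n \<beta> B) \<longlonglongrightarrow> m" "(\<lambda>n. susceptibility_n d w n \<beta> B) \<longlonglongrightarrow> V"
    using magnetization_susceptibility_of_centred_moments[OF assms(1) w T1 T2] by auto
qed

text \<open>
  Laplace's method at the unique maximizer. The quotient of the second and zeroth site moments there
  is the variance of one spin.
\<close>
lemma regular_limits:
  assumes "\<beta> > 0" "d \<ge> 2" "regular (tanh \<beta>) d B" and w: "\<And>n. n \<ge> 1 \<Longrightarrow> w n \<in> {1..n}"
  defines "\<theta> \<equiv> tanh \<beta>"
  defines "y \<equiv> bias \<theta> d B"
  shows "(\<lambda>n. magnetization_n d w n \<beta> B) \<longlonglongrightarrow> mag_of \<theta> y"
    and "(\<lambda>n. susceptibility_n d w n \<beta> B) \<longlonglongrightarrow>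
      ((1 + \<theta>) * (\<theta> - y\<^sup>2) / (\<theta> + y\<^sup>2)\<^sup>2) / (stability \<theta> d y / ((\<theta>\<^sup>2 - y\<^sup>2) * (1 - y\<^sup>2)))"
proof -
  define s where "s = sqrt \<theta>"
  have s: "0 < s" "s < 1" "s\<^sup>2 = \<theta>" "0 < \<theta>" "\<theta> < 1"
    using sqrt_tanh[OF assms(1)] by (simp_all add: s_def \<theta>_def)
  have reg: "regular \<theta> d B" using assms(3) by (simp add: \<theta>_def)
  obtain \<phi> where \<phi>: "maximizer s B d \<phi>"
    using maximizer_exists by blast
  have y: "y = s * tan \<phi>"
    unfolding y_def using bias_maximizer[OF s(1,2) assms(2) \<phi>] reg s(3) by simp
  define m where "m = mag_of \<theta> y"
  define P where "P = site_weight s B d \<phi>"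
  note st = maximizer_stationary[OF s(1,2) assms(2) \<phi>]
  note data = maximizer_local_data[OF s(1,2) assms(2) \<phi>, unfolded s(3), folded y, folded m_def P_def]
  have stab: "stability \<theta> d y > 0"
    using stable_stability_pos[OF assms(2) s(4,5)] bias_props(1)[OF s(4,5) assms(2) reg] by (simp add: y_def)
  have y1: "\<bar>y\<bar> < \<theta>"
    using bias_props(3)[OF s(4,5) assms(2) reg] by (simp add: y_def)
  have "y\<^sup>2 < 1"
    using y1 s(5) by (simp add: abs_square_less_1)
  define c where "c = real d * stability \<theta> d y / (\<theta> * (1 - y\<^sup>2))"
  have c: "c > 0"
    unfolding c_def using stab s(4) assms(2) \<open>y\<^sup>2 < 1\<close> by simp
  have P: "P > 0" using st(4) by (simp add: P_def)
  define A where "A = (\<lambda>k. site_moment s B m k d)"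
  have A0: "A 0 = site_weight s B d"
    by (simp add: A_def site_moment_0[of s B m])
  define A1' where "A1' = site_moment' s B m 1 d \<phi>"
  have peano: "((\<lambda>x. ln (A 0 x / A 0 \<phi>) / (x - \<phi>)\<^sup>2) \<longlongrightarrow> - c / 2) (at \<phi>)"
  proof -
    have "((\<lambda>x. ln (site_weight s B d x / site_weight s B d \<phi>) / (x - \<phi>)\<^sup>2) \<longlongrightarrow> (- c * P) / (2 * site_weight s B d \<phi>)) (at \<phi>)"
      using data(4) st(4,5) by (intro log_quotient_tendsto[OF has_real_derivative_site_moment]) (auto simp: c_def)
    then show ?thesis
      unfolding A0 using P by (simp add: P_def)
  qed
  have max: "\<bar>A 0 x\<bar> < A 0 \<phi>" if "x \<in> {-(pi/2)..pi/2}" "x \<noteq> \<phi>" for x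
    unfolding A0 using maximizer_unique[OF s(1,2) assms(2) _ \<phi> that] reg s(3) by simp
  have val: "A 2 \<phi> / A 0 \<phi> + (A1' / A 0 \<phi>)\<^sup>2 / c =
      ((1 + \<theta>) * (\<theta> - y\<^sup>2) / (\<theta> + y\<^sup>2)\<^sup>2) / (stability \<theta> d y / ((\<theta>\<^sup>2 - y\<^sup>2) * (1 - y\<^sup>2)))"
  proof -
    have "A 2 \<phi> / A 0 \<phi> = 1 - m\<^sup>2"
      using data(2) P unfolding A0 by (simp add: A_def P_def)
    moreover have "A1' / A 0 \<phi> = real d * (\<theta>\<^sup>2 - y\<^sup>2) / (s * (\<theta> + y\<^sup>2))"
      using data(3) P unfolding A0 by (simp add: A1'_def P_def)
    ultimately show ?thesis
      using susceptibility_identity[OF s(4,5) y1 stab assms(2)] by (simp add: m_def s_def c_def)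
  qed
  have A1: "(A 1 has_real_derivative A1') (at \<phi>)" "A 1 \<phi> = 0"
    unfolding A_def A1'_def using has_real_derivative_site_moment data(1) by auto
  have Q0: "site_moment s B m 0 D \<phi> \<noteq> 0" for D
  proof -
    have "amplitude s 1 \<phi> > 0" "amplitude s (- 1) \<phi> > 0"
      using maximizer_amplitudes_pos[of s d \<phi> B] s assms(2) \<phi> by (auto simp: maximizer_def)
    then show ?thesis
      unfolding site_moment_0[of s B m] using site_weight_pos by (metis less_irrefl)
  qed
  have bnd: "-(pi/2) < \<phi>" "\<phi> < pi/2" using st(1) by auto
  have A0pos: "A 0 \<phi> > 0" using st(4) by (simp add: A0)
  note lap = laplace_mean_variance[of "-(pi/2)" "pi/2" A _ \<phi>, OF _ _ bnd A0pos _ max peano c A1]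
  have 1: "(\<lambda>j. centred_integral_1 s B m d D j / sqrt (real (j + 3))) \<longlonglongrightarrow> 0" for D
    using lap(1)[of "\<lambda>k. site_moment s B m k D"] Q0
    unfolding centred_integral_1_def Let_def A_def
    by (simp add: continuous_on_site_moment mult.commute[of "sqrt _"])
  have 2: "(\<lambda>j. centred_integral_2 s B m d D j / real (j + 3)) \<longlonglongrightarrow>
     A 2 \<phi> / A 0 \<phi> + (A1' / A 0 \<phi>)\<^sup>2 / c" for D
    using lap(2)[of "\<lambda>k. site_moment s B m k D"] Q0
    unfolding centred_integral_2_def Let_def A_def divide_divide_eq_left mult.commute[of "integral _ _" "real _"]
    by (simp only: continuous_on_site_moment simp_thms)
  show "(\<lambda>n. magnetization_n d w n \<beta> B) \<longlonglongrightarrow> mag_of \<theta> y"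
    "(\<lambda>n. susceptibility_n d w n \<beta> B) \<longlonglongrightarrow>
      ((1 + \<theta>) * (\<theta> - y\<^sup>2) / (\<theta> + y\<^sup>2)\<^sup>2) / (stability \<theta> d y / ((\<theta>\<^sup>2 - y\<^sup>2) * (1 - y\<^sup>2)))"
    using limits_of_centred_integrals[where \<beta> = \<beta> and w = w and d = d and B = B and m = m
        and V = "A 2 \<phi> / A 0 \<phi> + (A1' / A 0 \<phi>)\<^sup>2 / c"] assms(1) w 1 2
    unfolding val by (simp_all add: s_def \<theta>_def m_def)
qed

text \<open>
  With \<open>s = 0\<close> both amplitudes are the cosine and \<open>m = tanh B\<close> is the mean of a single spin at every
  angle. The site moments of order \<open>1\<close> vanish identically and those of order \<open>2\<close> are
  \<open>1 - m\<^sup>2\<close> times the weight, so the quotients are constant in \<open>j\<close>.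
\<close>
lemma infinite_temperature_limits:
  assumes "d \<ge> 2" and w: "\<And>n. n \<ge> 1 \<Longrightarrow> w n \<in> {1..n}"
  shows "(\<lambda>n. magnetization_n d w n 0 B) \<longlonglongrightarrow> tanh B"
    and "(\<lambda>n. susceptibility_n d w n 0 B) \<longlonglongrightarrow> 1 - (tanh B)\<^sup>2"
proof -
  define m where "m = tanh B"
  define E where "E = exp B + exp (- B)"
  have E: "E > 0" by (simp add: E_def add_pos_pos)
  have mE: "m * E = exp B - exp (- B)"
    using E by (simp add: m_def E_def tanh_altdef)
  have site: "site_moment 0 B m k D \<phi> = ((1 - m) ^ k * exp B + (- 1 - m) ^ k * exp (- B)) * cos \<phi> ^ D" for k D \<phi>
    by (simp add: site_moment_def amplitude_def algebra_simps)
  have s0: "site_moment 0 B m 0 D = (\<lambda>\<phi>. E * cos \<phi> ^ D)" for D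
    by (simp add: site E_def fun_eq_iff)
  have s1: "site_moment 0 B m 1 D = (\<lambda>\<phi>. 0)" for D
  proof -
    have "(1 - m) * exp B + (- 1 - m) * exp (- B) = (exp B - exp (- B)) - m * E"
      by (simp add: E_def algebra_simps)
    then show ?thesis
      using mE by (simp add: site fun_eq_iff)
  qed
  have s2: "site_moment 0 B m 2 D = (\<lambda>\<phi>. (1 - m\<^sup>2) * (E * cos \<phi> ^ D))" for D
  proof -
    have "(1 - m)\<^sup>2 * exp B + (- 1 - m)\<^sup>2 * exp (- B) = (1 + m\<^sup>2) * E - 2 * m * (exp B - exp (- B))"
      by (simp add: E_def power2_eq_square algebra_simps)
    also have "\<dots> = (1 - m\<^sup>2) * E"
      unfolding mE[symmetric] by (simp add: power2_eq_square algebra_simps)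
    finally show ?thesis
      by (simp add: site fun_eq_iff)
  qed
  have 1: "centred_integral_1 0 B m d D j / sqrt (real (j + 3)) = 0" for D j
    unfolding centred_integral_1_def Let_def s1 by simp
  have 2: "centred_integral_2 0 B m d D j / real (j + 3) = 1 - m\<^sup>2" for D j
  proof -
    define Z where "Z = integral {-(pi/2)..pi/2} (\<lambda>\<phi>. (E * cos \<phi> ^ d) ^ (j + 2) * (E * cos \<phi> ^ D))"
    have "(\<lambda>\<phi>. (E * cos \<phi> ^ d) ^ (j + 2) * (E * cos \<phi> ^ D)) = (\<lambda>\<phi>. E ^ (j + 3) * cos \<phi> ^ (d * (j + 2) + D))"
      by (simp add: fun_eq_iff power_mult_distrib power_add power_mult numeral_3_eq_3)
    then have "Z = E ^ (j + 3) * cos_integral (d * (j + 2) + D)"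
      by (simp only: Z_def integral_mult_right)
    then have Z: "Z > 0"
      using E cos_integral_pos by simp
    have i1: "integral {-(pi/2)..pi/2} (\<lambda>x. (E * cos x ^ d) ^ (j + 1) * ((1 - m\<^sup>2) * (E * cos x ^ d)) * (E * cos x ^ D)) = (1 - m\<^sup>2) * Z"
    proof -
      have "(\<lambda>x. (E * cos x ^ d) ^ (j + 1) * ((1 - m\<^sup>2) * (E * cos x ^ d)) * (E * cos x ^ D)) =
        (\<lambda>\<phi>. (1 - m\<^sup>2) * ((E * cos \<phi> ^ d) ^ (j + 2) * (E * cos \<phi> ^ D)))"
        by (simp add: fun_eq_iff mult_ac)
      then show ?thesis by (simp only: Z_def integral_mult_right)
    qed
    have i2: "integral {-(pi/2)..pi/2} (\<lambda>x. (E * cos x ^ d) ^ (j + 2) * ((1 - m\<^sup>2) * (E * cos x ^ D))) = (1 - m\<^sup>2) * Z"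
    proof -
      have "(\<lambda>x. (E * cos x ^ d) ^ (j + 2) * ((1 - m\<^sup>2) * (E * cos x ^ D))) =
        (\<lambda>\<phi>. (1 - m\<^sup>2) * ((E * cos \<phi> ^ d) ^ (j + 2) * (E * cos \<phi> ^ D)))"
        by (simp only: mult.left_commute)
      then show ?thesis by (simp only: Z_def integral_mult_right)
    qed
    have "centred_integral_2 0 B m d D j = (real (j + 2) * ((1 - m\<^sup>2) * Z) + (1 - m\<^sup>2) * Z) / Z"
      unfolding centred_integral_2_def Let_def s0 s1 s2 i1 i2 Z_def[symmetric] by simp
    also have "\<dots> = real (j + 3) * (1 - m\<^sup>2)"
      using Z by (simp add: field_simps)
    finally show ?thesis by simp
  qed
  show "(\<lambda>n. magnetization_n d w n 0 B) \<longlonglongrightarrow> tanh B"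
    "(\<lambda>n. susceptibility_n d w n 0 B) \<longlonglongrightarrow> 1 - (tanh B)\<^sup>2"
    using limits_of_centred_integrals[where \<beta> = 0 and w = w and d = d and B = B and m = m
        and V = "1 - m\<^sup>2"] w 1 2 by (simp_all add: m_def)
qed

lemma bias_mono:
  assumes "0 < \<theta>" "\<theta> < 1" "d \<ge> 2" "0 < B" "B \<le> B'"
  shows "bias \<theta> d B \<le> bias \<theta> d B'"
proof (rule ccontr)
  assume "\<not> ?thesis"
  then have lt: "bias \<theta> d B' < bias \<theta> d B" by simp
  have reg: "regular \<theta> d B" "regular \<theta> d B'"
    using assms by (auto simp: regular_def)
  note b = bias_props[OF assms(1-3) reg(1)] and b' = bias_props[OF assms(1-3) reg(2)]
  have pos: "bias \<theta> d B' > 0" using b'(4) assms by simp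
  have "field_of \<theta> d (bias \<theta> d B') < field_of \<theta> d (bias \<theta> d B)"
  proof (rule field_of_strict_mono[OF assms(3,2) _ lt])
    fix x assume "bias \<theta> d B' < x" "x < bias \<theta> d B"
    then show "stability \<theta> d x > 0"
      using stable_stability_pos[OF assms(3,1,2) b'(1)] stability_mono[OF assms(3,2), of "bias \<theta> d B'" x] pos
      by simp
  qed (use pos b(3) assms in auto)
  then show False
    using b(2) b'(2) assms by simp
qed

text \<open>
  The bias increases with the positive field, so the limit \<open>L\<close> is its infimum. If
  \<open>(d - 1) * \<theta> > 1\<close>, positivity of \<open>stability\<close> bounds the bias below by the positive zero \<open>e\<close> of
  \<open>stability\<close>. Otherwise \<open>field_of \<theta> d\<close> is positive on all of \<open>(0, \<theta>)\<close>, so every small \<open>e > 0\<close> is the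
  bias of some positive field.
\<close>
lemma bias_at_right_0:
  assumes "0 < \<theta>" "\<theta> < 1" "d \<ge> 2"
  obtains L where "(bias \<theta> d \<longlongrightarrow> L) (at_right 0)" "0 \<le> L" "L > 0 \<longleftrightarrow> (real d - 1) * \<theta> > 1"
proof -
  define L where "L = (INF B\<in>{0<..}. bias \<theta> d B)"
  have pos: "bias \<theta> d B > 0" if "B > 0" for B
    using that by (intro bias_props(4)[OF assms]) (auto simp: regular_def)
  have bdd: "bdd_below (bias \<theta> d ` {0<..})"
    using pos by (intro bdd_belowI[of _ 0]) (auto intro: less_imp_le)
  have L_le: "L \<le> bias \<theta> d B" if "B > 0" for B
    unfolding L_def using that bdd by (intro cINF_lower) auto
  have lim: "(bias \<theta> d \<longlongrightarrow> L) (at_right 0)"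
  proof (rule order_tendstoI)
    fix a assume a: "a < L"
    show "\<forall>\<^sub>F B in at_right 0. a < bias \<theta> d B"
      using eventually_at_right_less[of "0::real"]
    proof eventually_elim
      case (elim B)
      then show ?case using L_le[of B] a by simp
    qed
  next
    fix a assume a: "L < a"
    then obtain B1 where B1: "B1 > 0" "bias \<theta> d B1 < a"
      unfolding L_def using bdd by (subst (asm) cINF_less_iff) auto
    have "\<forall>\<^sub>F B in at_right 0. B < B1 \<and> 0 < B"
      using B1(1) by (auto simp: eventually_at_right intro!: exI[of _ B1])
    then show "\<forall>\<^sub>F B in at_right 0. bias \<theta> d B < a"
    proof eventually_elim
      case (elim B)
      then show ?case using bias_mono[OF assms, of B B1] B1 by simp
    qed
  qed
  have L0: "0 \<le> L"
    unfolding L_def using pos by (intro cINF_greatest) (auto intro: less_imp_le)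
  have "L > 0" if big: "(real d - 1) * \<theta> > 1"
  proof -
    define e where "e = sqrt (\<theta> * ((real d - 1) * \<theta> - 1) / (real d - 1 - \<theta>))"
    have dd: "real d - 1 - \<theta> > 0" using assms by auto
    have e: "e > 0"
      unfolding e_def using big assms(1) dd by simp
    have "e \<le> bias \<theta> d B" if "B > 0" for B
    proof -
      have reg: "regular \<theta> d B" using that by (simp add: regular_def)
      define y where "y = bias \<theta> d B"
      have "stability \<theta> d y > 0"
        unfolding y_def using stable_stability_pos[OF assms(3,1,2)] bias_props(1)[OF assms reg] by blast
      then have "\<theta> * ((real d - 1) * \<theta> - 1) \<le> (real d - 1 - \<theta>) * y\<^sup>2"
        by (simp add: stability_def power2_eq_square algebra_simps)
      then have "\<theta> * ((real d - 1) * \<theta> - 1) / (real d - 1 - \<theta>) \<le> y\<^sup>2"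
        using dd by (simp add: divide_le_eq mult.commute)
      then show ?thesis
        unfolding e_def y_def[symmetric] using pos[OF that] by (intro real_le_lsqrt) (auto simp: y_def)
    qed
    then have "e \<le> L"
      unfolding L_def by (intro cINF_greatest) auto
    then show ?thesis using e by simp
  qed
  moreover have "L = 0" if small: "(real d - 1) * \<theta> \<le> 1"
  proof (rule ccontr)
    assume "L \<noteq> 0"
    then have "L > 0" using L0 by simp
    define e where "e = min (L / 2) (\<theta> / 2)"
    have e: "0 < e" "e < L" "e < \<theta>"
      using \<open>L > 0\<close> assms(1) by (auto simp: e_def)
    have stab: "stability \<theta> d x > 0" if "x > 0" for x
    proof -
      have "stability \<theta> d x = \<theta> * (1 - (real d - 1) * \<theta>) + (real d - 1 - \<theta>) * x\<^sup>2"
        by (simp add: stability_def power2_eq_square algebra_simps)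
      moreover have "(real d - 1 - \<theta>) * x\<^sup>2 > 0"
        using assms that by (intro mult_pos_pos) auto
      ultimately show ?thesis
        using small assms(1) by (simp add: add_nonneg_pos)
    qed
    have "field_of \<theta> d 0 < field_of \<theta> d e"
      using e assms by (intro field_of_strict_mono stab) auto
    then have f: "field_of \<theta> d e > 0" by simp
    have "bias \<theta> d (field_of \<theta> d e) = e"
      using e f by (intro bias_eqI[OF assms(3,1,2)]) (auto simp: stable_def)
    then show False
      using L_le[OF f] e by simp
  qed
  ultimately have "L > 0 \<longleftrightarrow> (real d - 1) * \<theta> > 1"
    by fastforce
  then show ?thesis
    using that lim L0 by blast
qed

lemma spontaneous_magnetization_limit:
  assumes "\<beta> > 0" "d \<ge> 2" and w: "\<And>n. n \<ge> 1 \<Longrightarrow> w n \<in> {1..n}"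
  shows "((\<lambda>B. magnetization d w \<beta> B) \<longlongrightarrow> spontaneous_magnetization d w \<beta>) (at_right 0)"
    and "spontaneous_magnetization d w \<beta> > 0 \<longleftrightarrow> (real d - 1) * tanh \<beta> > 1"
proof -
  define \<theta> where "\<theta> = tanh \<beta>"
  have th: "0 < \<theta>" "\<theta> < 1"
    using sqrt_tanh[OF assms(1)] by (simp_all add: \<theta>_def)
  obtain L where L: "(bias \<theta> d \<longlongrightarrow> L) (at_right 0)" "0 \<le> L" "L > 0 \<longleftrightarrow> (real d - 1) * \<theta> > 1"
    using bias_at_right_0[OF th assms(2)] by blast
  have "((\<lambda>B. mag_of \<theta> (bias \<theta> d B)) \<longlongrightarrow> mag_of \<theta> L) (at_right 0)"
    using DERIV_isCont[OF has_real_derivative_mag_of[OF th(1)]] L(1) by (rule isCont_tendsto_compose)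
  moreover have "\<forall>\<^sub>F B in at_right 0. mag_of \<theta> (bias \<theta> d B) = magnetization d w \<beta> B"
    using eventually_at_right_less[of "0::real"]
  proof eventually_elim
    case (elim B)
    then have "regular (tanh \<beta>) d B" by (simp add: regular_def)
    then show ?case
      using limI[OF regular_limits(1)[OF assms(1,2) _ w]] unfolding magnetization_def \<theta>_def by simp
  qed
  ultimately have lim: "((\<lambda>B. magnetization d w \<beta> B) \<longlongrightarrow> mag_of \<theta> L) (at_right 0)"
    by (rule Lim_transform_eventually)
  then have eq: "spontaneous_magnetization d w \<beta> = mag_of \<theta> L"
    unfolding spontaneous_magnetization_def by (intro tendsto_Lim) auto
  show "((\<lambda>B. magnetization d w \<beta> B) \<longlongrightarrow> spontaneous_magnetization d w \<beta>) (at_right 0)"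
    using lim eq by simp
  have "mag_of \<theta> L > 0 \<longleftrightarrow> L > 0"
  proof -
    have "\<theta> + L\<^sup>2 > 0" using th by (simp add: add_pos_nonneg)
    then show ?thesis
      using th unfolding mag_of_def by (simp add: zero_less_divide_iff zero_less_mult_iff)
  qed
  then show "spontaneous_magnetization d w \<beta> > 0 \<longleftrightarrow> (real d - 1) * tanh \<beta> > 1"
    using eq L(3) by (simp add: \<theta>_def)
qed

lemma tanh_artanh_real:
  fixes x :: real
  assumes "\<bar>x\<bar> < 1"
  shows "tanh (artanh x) = x"
proof -
  have pos: "1 + x > 0" "1 - x > 0"
    using assms by auto
  have "exp (- 2 * artanh x) = inverse (exp (ln ((1 + x) / (1 - x))))"
    by (simp add: artanh_def exp_minus)
  also have "\<dots> = (1 - x) / (1 + x)"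
    using pos by simp
  finally have "tanh (artanh x) = (1 - (1 - x) / (1 + x)) / (1 + (1 - x) / (1 + x))"
    by (simp only: tanh_real_altdef)
  also have "\<dots> = x"
    using pos by (simp add: field_simps)
  finally show ?thesis .
qed

text \<open>
  The infimum is taken over the \<open>\<beta> > 0\<close> with \<open>(d - 1) * tanh \<beta> > 1\<close>. This is an open half-line for
  \<open>d \<ge> 3\<close> and empty for \<open>d = 2\<close>.
\<close>
lemma critical_beta_values:
  assumes "d \<ge> 2" and w: "\<And>n. n \<ge> 1 \<Longrightarrow> w n \<in> {1..n}"
  shows "d = 2 \<Longrightarrow> critical_beta d w = \<infinity>"
    and "d \<ge> 3 \<Longrightarrow> critical_beta d w = ereal (artanh (1 / (real d - 1)))"
    and "d \<ge> 3 \<Longrightarrow> artanh (1 / (real d - 1)) = 1 / 2 * ln (real d / (real d - 2))"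
    and "0 < \<beta> \<Longrightarrow> ereal \<beta> < critical_beta d w \<Longrightarrow> (real d - 1) * tanh \<beta> < 1"
proof -
  have set: "{\<beta>. \<beta> > 0 \<and> spontaneous_magnetization d w \<beta> > 0} = {\<beta>. \<beta> > 0 \<and> (real d - 1) * tanh \<beta> > 1}"
    using spontaneous_magnetization_limit(2)[OF _ assms(1) w] by auto
  show d2: "critical_beta d w = \<infinity>" if "d = 2"
  proof -
    have empty: "{\<beta>. \<beta> > 0 \<and> (real d - 1) * tanh \<beta> > 1} = {}"
      using that tanh_real_lt_1 by (auto simp: not_less less_imp_le)
    show ?thesis
      unfolding critical_beta_def set empty by (simp add: top_ereal_def)
  qed
  define b where "b = artanh (1 / (real d - 1))"
  show b: "artanh (1 / (real d - 1)) = 1 / 2 * ln (real d / (real d - 2))" if "d \<ge> 3"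
  proof -
    have "1 + 1 / (real d - 1) = real d / (real d - 1)" "1 - 1 / (real d - 1) = (real d - 2) / (real d - 1)"
      using that by (simp_all add: field_simps)
    then show ?thesis
      using that by (simp add: artanh_def)
  qed
  have tb: "(real d - 1) * tanh \<beta> > 1 \<longleftrightarrow> \<beta> > b" "b > 0" if "d \<ge> 3" for \<beta>
  proof -
    have "tanh b = 1 / (real d - 1)"
      unfolding b_def using that by (intro tanh_artanh_real) auto
    then have "tanh \<beta> > 1 / (real d - 1) \<longleftrightarrow> \<beta> > b"
      using tanh_real_less_iff[of b \<beta>] by simp
    moreover have "(real d - 1) * tanh \<beta> > 1 \<longleftrightarrow> tanh \<beta> > 1 / (real d - 1)"
      using that by (simp add: divide_less_eq mult.commute)
    ultimately show "(real d - 1) * tanh \<beta> > 1 \<longleftrightarrow> \<beta> > b" by simp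
    have "tanh 0 < tanh b"
      using \<open>tanh b = 1 / (real d - 1)\<close> that by simp
    then show "b > 0"
      unfolding tanh_real_less_iff .
  qed
  show d3: "critical_beta d w = ereal (artanh (1 / (real d - 1)))" if "d \<ge> 3"
  proof -
    have "\<beta> > 0 \<and> (real d - 1) * tanh \<beta> > 1 \<longleftrightarrow> \<beta> \<in> {b<..}" for \<beta>
      unfolding tb(1)[OF that] using tb(2)[OF that] by auto
    then have "{\<beta>. \<beta> > 0 \<and> (real d - 1) * tanh \<beta> > 1} = {b<..}"
      by blast
    moreover have "Inf (ereal ` {b<..}) = ereal b"
    proof (rule Inf_eqI)
      fix y assume y: "\<And>i. i \<in> ereal ` {b<..} \<Longrightarrow> y \<le> i"
      show "y \<le> ereal b"
      proof (rule ereal_le_epsilon2)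
        fix e :: real assume "0 < e"
        then show "y \<le> ereal b + ereal e"
          using y[of "ereal (b + e)"] by simp
      qed
    qed auto
    ultimately show ?thesis
      unfolding critical_beta_def set by (simp add: b_def)
  qed
  show "(real d - 1) * tanh \<beta> < 1" if "0 < \<beta>" "ereal \<beta> < critical_beta d w"
  proof (cases "d = 2")
    case True
    then show ?thesis using tanh_real_lt_1[of \<beta>] by simp
  next
    case False
    then have d: "d \<ge> 3" using assms(1) by simp
    then have "\<beta> < b"
      using that d3 by (simp add: b_def)
    then have "tanh \<beta> < tanh b" by simp
    also have "tanh b = 1 / (real d - 1)"
      unfolding b_def using d by (intro tanh_artanh_real) auto
    finally show ?thesis
      using d by (simp add: less_divide_eq mult.commute)
  qed
qed

text \<open>
  The two regimes \<open>\<beta> = 0\<close> and \<open>\<beta> > 0\<close> come together; for \<open>\<beta> > 0\<close> the definition of the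
  critical inverse temperature says that \<open>B\<close> is regular.
\<close>
lemma regime_limits:
  assumes "d \<ge> 2" and w: "\<And>n. n \<ge> 1 \<Longrightarrow> w n \<in> {1..n}" and reg: "(\<beta>, B) \<in> uniqueness_regime d w"
  obtains M V where "(\<lambda>n. magnetization_n d w n \<beta> B) \<longlonglongrightarrow> M" "(pressure d \<beta> has_real_derivative M) (at B)"
    "(\<lambda>n. susceptibility_n d w n \<beta> B) \<longlonglongrightarrow> V" "(deriv (pressure d \<beta>) has_real_derivative V) (at B)"
proof (cases "\<beta> = 0")
  case True
  then show ?thesis
    using that infinite_temperature_limits[OF assms(1) w] has_real_derivative_pressure_infinite_temperature[OF assms(1)] by blast
next
  case False
  then have \<beta>: "\<beta> > 0" using reg by (auto simp: uniqueness_regime_def)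
  have r: "regular (tanh \<beta>) d B"
    using reg critical_beta_values(4)[OF assms(1) w] by (auto simp: uniqueness_regime_def regular_def)
  note th = sqrt_tanh(4,5)[OF \<beta>]
  show ?thesis
    using that[OF regular_limits(1)[OF \<beta> assms(1) r w] has_real_derivative_pressure[OF \<beta> assms(1) r]
      regular_limits(2)[OF \<beta> assms(1) r w]
      has_real_derivative_deriv_pressure[OF \<beta> assms(1) r has_real_derivative_mag_bias[OF th assms(1) r]]] .
qed

theorem theorem1p1:
  fixes d :: nat and w :: "nat \<Rightarrow> nat"
  assumes "d \<ge> 2"
    and "\<And>n. n \<ge> 1 \<Longrightarrow> w n \<in> {1..n}"
  shows
    "(\<forall>\<beta>\<ge>0. \<forall>B.
        (\<exists>t\<in>{0..1}. \<forall>s\<in>{0..1}. pressure_objective d \<beta> B s \<le> pressure_objective d \<beta> B t) \<and>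
        (\<lambda>n. pressure_n d w n \<beta> B) \<longlonglongrightarrow> pressure d \<beta> B) \<and>
     (\<forall>(\<beta>, B)\<in>uniqueness_regime d w.
        (\<lambda>n. magnetization_n d w n \<beta> B) \<longlonglongrightarrow> magnetization d w \<beta> B \<and>
        ((\<lambda>b. pressure d \<beta> b) has_real_derivative magnetization d w \<beta> B) (at B)) \<and>
     (\<forall>\<beta>>0. ((\<lambda>B. magnetization d w \<beta> B) \<longlongrightarrow> spontaneous_magnetization d w \<beta>) (at_right 0)) \<and>
     (d \<ge> 3 \<longrightarrow>
        critical_beta d w = ereal (artanh (1 / (real d - 1))) \<and>
        critical_beta d w = ereal (1 / 2 * ln (real d / (real d - 2)))) \<and>
     (d = 2 \<longrightarrow> critical_beta d w = \<infinity>) \<and>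
     (\<forall>(\<beta>, B)\<in>uniqueness_regime d w.
        (\<lambda>n. susceptibility_n d w n \<beta> B) \<longlonglongrightarrow> susceptibility d w \<beta> B \<and>
        ((\<lambda>b. deriv (\<lambda>b'. pressure d \<beta> b') b) has_real_derivative susceptibility d w \<beta> B) (at B))"
proof (intro conjI allI impI)
  fix \<beta> B :: real assume \<beta>: "\<beta> \<ge> 0"
  show "(\<lambda>n. pressure_n d w n \<beta> B) \<longlonglongrightarrow> pressure d \<beta> B"
    by (rule pressure_limit[OF \<beta> assms])
  obtain \<phi> where "maximizer (sqrt (tanh \<beta>)) B d \<phi>"
    using maximizer_exists by blast
  then show "\<exists>t\<in>{0..1}. \<forall>s\<in>{0..1}. pressure_objective d \<beta> B s \<le> pressure_objective d \<beta> B t"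
    using assms(1) by (intro pressure_eq_log_max(2)[OF \<beta>]) (auto simp: maximizer_def)
next
  show "\<forall>(\<beta>, B)\<in>uniqueness_regime d w.
        (\<lambda>n. magnetization_n d w n \<beta> B) \<longlonglongrightarrow> magnetization d w \<beta> B \<and>
        ((\<lambda>b. pressure d \<beta> b) has_real_derivative magnetization d w \<beta> B) (at B)"
  proof (rule ballI, clarify)
    fix \<beta> B assume reg: "(\<beta>, B) \<in> uniqueness_regime d w"
    obtain M where M: "(\<lambda>n. magnetization_n d w n \<beta> B) \<longlonglongrightarrow> M" "(pressure d \<beta> has_real_derivative M) (at B)"
      using regime_limits[OF assms reg] by metis
    have "magnetization d w \<beta> B = M"
      unfolding magnetization_def by (rule limI[OF M(1)])
    then show "(\<lambda>n. magnetization_n d w n \<beta> B) \<longlonglongrightarrow> magnetization d w \<beta> B \<and>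
        ((\<lambda>b. pressure d \<beta> b) has_real_derivative magnetization d w \<beta> B) (at B)"
      using M by simp
  qed
next
  show "\<forall>(\<beta>, B)\<in>uniqueness_regime d w.
        (\<lambda>n. susceptibility_n d w n \<beta> B) \<longlonglongrightarrow> susceptibility d w \<beta> B \<and>
        ((\<lambda>b. deriv (\<lambda>b'. pressure d \<beta> b') b) has_real_derivative susceptibility d w \<beta> B) (at B)"
  proof (rule ballI, clarify)
    fix \<beta> B assume reg: "(\<beta>, B) \<in> uniqueness_regime d w"
    obtain V where V: "(\<lambda>n. susceptibility_n d w n \<beta> B) \<longlonglongrightarrow> V" "(deriv (pressure d \<beta>) has_real_derivative V) (at B)"
      using regime_limits[OF assms reg] by metis
    have "susceptibility d w \<beta> B = V"
      unfolding susceptibility_def by (rule limI[OF V(1)])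
    then show "(\<lambda>n. susceptibility_n d w n \<beta> B) \<longlonglongrightarrow> susceptibility d w \<beta> B \<and>
        ((\<lambda>b. deriv (\<lambda>b'. pressure d \<beta> b') b) has_real_derivative susceptibility d w \<beta> B) (at B)"
      using V by simp
  qed
next
  fix \<beta> :: real assume "\<beta> > 0"
  then show "((\<lambda>B. magnetization d w \<beta> B) \<longlongrightarrow> spontaneous_magnetization d w \<beta>) (at_right 0)"
    by (rule spontaneous_magnetization_limit(1)[OF _ assms])
next
  assume d: "d \<ge> 3"
  show "critical_beta d w = ereal (artanh (1 / (real d - 1)))"
    by (rule critical_beta_values(2)[OF assms d])
  then show "critical_beta d w = ereal (1 / 2 * ln (real d / (real d - 2)))"
    by (simp only: critical_beta_values(3)[OF assms d])
next
  assume d: "d = 2"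
  show "critical_beta d w = \<infinity>"
    by (rule critical_beta_values(1)[OF assms d])
qed

end
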